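(* Let $1\leq r\leq\infty$ and $1<p<\infty$, and let $p',r'$ denote the conjugate exponents of $p,r$. Let $\mathcal{D}$ be the collection of dyadic cubes of $\mathbb{R}^d$ and let $(\lambda_Q)_{Q\in\mathcal{D}}$ be non-negative real numbers. Suppose that $\sigma$ and $\omega$ are locally integrable positive functions on $\mathbb{R}^d$. With the operators $T$, $T_R$, $T_R^*$ associated with $(\lambda_Q)_{Q\in\mathcal{D}}$ as defined in the context, the two weight norm inequality $$\|T(f\sigma)\|_{L^p_{\ell^r}(\omega)}\leq \tilde{C}\,\|f\|_{L^p(\sigma)}\qquad\text{for all } f\in L^p(\sigma)$$ holds for some finite constant $\tilde C$ if and only if both of the following testing conditions hold for some finite constants $C$ and $C^*$: $$\|T_R(\sigma)\|_{L^p_{\ell^r}(\omega)}\leq C\,\sigma(R)^{1/p}\qquad\text{for all } R\in\mathcal{D},$$ $$\|T_R^*(g\,\omega)\|_{L^{p'}(\sigma)}\leq C^*\,\|g\|_{L^\infty_{\ell^{r'}}(\omega)}\,\omega(R)^{1/p'}\qquad\text{for all } R\in\mathcal{D}\text{ and all } g=(a_Q1_Q)_{Q\in\mathcal{D}}\text{ with constants } a_Q\geq 0.$$ Moreover, the least constants $\tilde C$, $C$, $C^*$ in these inequalities satisfy $$\tilde{C}\leq C_{p',r'}\,20\,p\,p'\,(C+C^* ),$$ where $C_{p',r'}$ is the constant of Stein's inequality (its value is given in the context).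
   Context: $\mathcal{D}$ is the standard collection of dyadic cubes of $\mathbb{R}^d$. For a locally integrable function $f$ and $Q\in\mathcal{D}$, $\langle f\rangle_Q:=\frac{1}{|Q|}\int_Q f\,dx$, where $|Q|$ is Lebesgue measure, and $1_Q$ is the indicator function of $Q$. For a weight $\sigma$ write $\sigma(Q):=\int_Q\sigma\,dx$ and $\langle f\rangle_Q^\sigma:=\frac{1}{\sigma(Q)}\int_Q f\sigma\,dx$, and similarly for $\omega$. $L^p(\sigma)$ is the space of functions $f$ on $\mathbb{R}^d$ with norm $(\int|f|^p\sigma\,dx)^{1/p}$. For sequences $g=(g_Q)_{Q\in\mathcal{D}}$ of functions on $\mathbb{R}^d$, $|g(x)|_{r}:=\|(g_Q(x))_{Q\in\mathcal{D}}\|_{\ell^r(\mathcal{D})}$ and $\|g\|_{L^p_{\ell^r}(\omega)}:=\big\|\,|g|_r\,\big\|_{L^p(\omega)}$; $\|g\|_{L^\infty_{\ell^{r'}}(\omega)}$ is the $\omega$-essential supremum of $|g(x)|_{r'}$. For localized sequences indexed by $\{Q\in\mathcal{D}: Q\subseteq R\}$ the $\ell^r$ norm is taken over that index set. The operators are $$T(f):=(\lambda_Q\langle f\rangle_Q1_Q)_{Q\in\mathcal{D}},\qquad T_R(f):=(\lambda_Q\langle f\rangle_Q1_Q)_{Q\in\mathcal{D},\,Q\subseteq R}\quad(R\in\mathcal{D}),$$ and the formal adjoint of $T_R$ is $$T_R^*(g):=\sum_{Q\in\mathcal{D},\,Q\subseteq R}\lambda_Q\langle g_Q\rangle_Q1_Q,\qquad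 g=(g_Q)_{Q\in\mathcal{D}}.$$ Here $T(f\sigma)$ is $T$ applied to the product $f\sigma$, $T_R(\sigma)$ is $T_R$ applied to the function $\sigma$, and $T_R^*(g\,\omega)$ is $T_R^*$ applied to $(g_Q\omega)_{Q\in\mathcal{D}}$. $C_{p',r'}$ is the constant in Stein's inequality $\|(\langle g_Q\rangle_Q^\omega1_Q)_{Q\in\mathcal{D}}\|_{L^{p'}_{\ell^{r'}}(\omega)}\leq C_{p',r'}\|(g_Q1_Q)_{Q\in\mathcal{D}}\|_{L^{p'}_{\ell^{r'}}(\omega)}$, with the value $$C_{p',r'}=\begin{cases}(p'/r')^{1/r'}&\text{if } p'\geq r',\\ (p/r)^{1/r}&\text{if } p'<r'.\end{cases}$$ *)

theory Defs
  imports "HOL-Probability.Essential_Supremum"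
begin

definition dyadic_cubes :: "(real ^ 'n) set set" where
  "dyadic_cubes =
     {{x. \<forall>i. 2 powi k * of_int (m $ i) \<le> x $ i \<and> x $ i < 2 powi k * (of_int (m $ i) + 1)}
       | (k :: int) (m :: int ^ 'n). True}"

definition dyadic_subcubes :: "(real ^ 'n) set \<Rightarrow> (real ^ 'n) set set" where
  "dyadic_subcubes R = {Q \<in> dyadic_cubes. Q \<subseteq> R}"

definition locally_integrable :: "(real ^ 'n \<Rightarrow> real) \<Rightarrow> bool" where
  "locally_integrable f \<longleftrightarrow> (\<forall>K. compact K \<longrightarrow> set_integrable lebesgue K f)"

definition average :: "(real ^ 'n) set \<Rightarrow> (real ^ 'n \<Rightarrow> real) \<Rightarrow> real" where
  "average Q f = (LINT x:Q|lebesgue. f x) / measure lebesgue Q"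

definition weight_of :: "(real ^ 'n \<Rightarrow> real) \<Rightarrow> (real ^ 'n) set \<Rightarrow> real" where
  "weight_of w Q = (LINT x:Q|lebesgue. w x)"

text \<open>Norms take values in \<^typ>\<open>ennreal\<close>, since the quantities on the left-hand sides of the
  inequalities may be infinite. Powers of extended non-negative reals are only used with
  positive exponents.\<close>

definition epowr :: "ennreal \<Rightarrow> real \<Rightarrow> ennreal" where
  "epowr x a = (if x = \<infinity> then \<infinity> else ennreal (enn2real x powr a))"

definition Lp_norm :: "real \<Rightarrow> (real ^ 'n \<Rightarrow> real) \<Rightarrow> (real ^ 'n \<Rightarrow> ennreal) \<Rightarrow> ennreal" where
  "Lp_norm p w h = epowr (\<integral>\<^sup>+x. epowr (h x) p * ennreal (w x) \<partial>lebesgue) (1 / p)"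

definition Linf_norm :: "(real ^ 'n \<Rightarrow> real) \<Rightarrow> (real ^ 'n \<Rightarrow> ennreal) \<Rightarrow> ennreal" where
  "Linf_norm w h = esssup (density lebesgue (\<lambda>x. ennreal (w x))) h"

definition Lp_space :: "real \<Rightarrow> (real ^ 'n \<Rightarrow> real) \<Rightarrow> (real ^ 'n \<Rightarrow> real) set" where
  "Lp_space p w =
     {f \<in> borel_measurable lebesgue. Lp_norm p w (\<lambda>x. ennreal \<bar>f x\<bar>) < \<infinity>}"

definition lr_norm :: "ennreal \<Rightarrow> 'i set \<Rightarrow> ('i \<Rightarrow> real) \<Rightarrow> ennreal" where
  "lr_norm r I a =
     (if r = \<infinity> then (SUP i\<in>I. ennreal \<bar>a i\<bar>)
      else epowr (\<Sum>\<^sub>\<infinity>i\<in>I. ennreal (\<bar>a i\<bar> powr enn2real r)) (1 / enn2real r))"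

text \<open>A sequence of functions indexed by a set \<open>I\<close> of cubes is represented by a total function on
  all sets; only its values on \<open>I\<close> matter, and \<open>I\<close> is passed to the norm. Thus the operator
  \<open>T\<^sub>R\<close> is \<open>T_op\<close> with the norm taken over \<^term>\<open>dyadic_subcubes R\<close>.\<close>

definition Lp_lr_norm ::
  "real \<Rightarrow> ennreal \<Rightarrow> (real ^ 'n \<Rightarrow> real) \<Rightarrow> (real ^ 'n) set set \<Rightarrow>
   ((real ^ 'n) set \<Rightarrow> real ^ 'n \<Rightarrow> real) \<Rightarrow> ennreal" where
  "Lp_lr_norm p r w I g = Lp_norm p w (\<lambda>x. lr_norm r I (\<lambda>Q. g Q x))"

definition Linf_lr_norm ::
  "ennreal \<Rightarrow> (real ^ 'n \<Rightarrow> real) \<Rightarrow> (real ^ 'n) set set \<Rightarrow>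
   ((real ^ 'n) set \<Rightarrow> real ^ 'n \<Rightarrow> real) \<Rightarrow> ennreal" where
  "Linf_lr_norm r w I g = Linf_norm w (\<lambda>x. lr_norm r I (\<lambda>Q. g Q x))"

definition T_op ::
  "((real ^ 'n) set \<Rightarrow> real) \<Rightarrow> (real ^ 'n \<Rightarrow> real) \<Rightarrow> (real ^ 'n) set \<Rightarrow> real ^ 'n \<Rightarrow> real" where
  "T_op lam f Q x = lam Q * average Q f * indicator Q x"

text \<open>The formal adjoint of \<open>T\<^sub>R\<close>. Since the series may diverge, it is taken in
  \<^typ>\<open>ennreal\<close>; this is the intended value only for non-negative \<open>g\<close>, the only case used.\<close>

definition T_adj ::
  "((real ^ 'n) set \<Rightarrow> real) \<Rightarrow> (real ^ 'n) set \<Rightarrow> ((real ^ 'n) set \<Rightarrow> real ^ 'n \<Rightarrow> real) \<Rightarrow>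
   real ^ 'n \<Rightarrow> ennreal" where
  "T_adj lam R g x =
     (\<Sum>\<^sub>\<infinity>Q\<in>dyadic_subcubes R. ennreal (lam Q * average Q (g Q) * indicator Q x))"

definition two_weight_bound where
  "two_weight_bound p r lam \<sigma> \<omega> C \<longleftrightarrow>
     (\<forall>f\<in>Lp_space p \<sigma>.
        Lp_lr_norm p r \<omega> dyadic_cubes (T_op lam (\<lambda>x. f x * \<sigma> x))
          \<le> ennreal C * Lp_norm p \<sigma> (\<lambda>x. ennreal \<bar>f x\<bar>))"

definition testing_bound where
  "testing_bound p r lam \<sigma> \<omega> C \<longleftrightarrow>
     (\<forall>R\<in>dyadic_cubes.
        Lp_lr_norm p r \<omega> (dyadic_subcubes R) (T_op lam \<sigma>)
          \<le> ennreal C * ennreal (weight_of \<sigma> R powr (1 / p)))"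

text \<open>Below, \<open>p'\<close> and \<open>r'\<close> are the conjugate exponents.\<close>

definition dual_testing_bound where
  "dual_testing_bound p' r' lam \<sigma> \<omega> C \<longleftrightarrow>
     (\<forall>R\<in>dyadic_cubes. \<forall>a :: (real ^ 'n) set \<Rightarrow> real. (\<forall>Q\<in>dyadic_cubes. 0 \<le> a Q) \<longrightarrow>
        (let g = (\<lambda>Q x. a Q * indicator Q x) in
          Lp_norm p' \<sigma> (T_adj lam R (\<lambda>Q x. g Q x * \<omega> x))
            \<le> ennreal C * Linf_lr_norm r' \<omega> dyadic_cubes g
                * ennreal (weight_of \<omega> R powr (1 / p'))))"

text \<open>The constant in Stein's inequality. In the first case \<open>r'\<close> is finite, in the second
  \<open>r < p\<close> is finite, so no infinite exponent is ever truncated by \<^const>\<open>enn2real\<close>.\<close>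

definition stein_const :: "real \<Rightarrow> real \<Rightarrow> ennreal \<Rightarrow> ennreal \<Rightarrow> real" where
  "stein_const p p' r r' =
     (if ennreal p' \<ge> r' then (p' / enn2real r') powr (1 / enn2real r')
      else (p / enn2real r) powr (1 / enn2real r))"

definition is_least_const :: "(real \<Rightarrow> bool) \<Rightarrow> real \<Rightarrow> bool" where
  "is_least_const P C \<longleftrightarrow> 0 \<le> C \<and> P C \<and> (\<forall>C'\<ge>0. P C' \<longrightarrow> C \<le> C')"

end

theory Submission
  imports Defs
begin

text \<open>
  Sawyer's testing principle for the positive dyadic operator: the norm inequality for \<open>T\<close> and the
  one for its adjoint need only be checked on indicators, respectively on bounded sequences
  localized to a cube. Restricting the norm inequality to such functions, with duality for the
  adjoint, shows that the testing conditions are necessary. The content is the converse.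

  \<^bold>\<open>Reduction to finite forests.\<close> By monotone convergence only finite families \<open>D\<close> of dyadic cubes
  matter. Ordered by inclusion, \<open>D\<close> is a forest: the cubes containing a given one form a chain. The
  points of \<open>q \<in> D\<close> that lie in no smaller cube of \<open>D\<close> form the atom of \<open>q\<close>; the atoms are disjoint,
  and all functions built from \<open>D\<close> are constant on them. The function \<open>f\<close> is not, but it enters
  \<open>T\<close> only through its integrals over cubes, and by Hoelder's inequality these do not decrease when
  \<open>\<bar>f\<bar>\<close> is replaced on every atom by its \<open>L\<^sup>p\<close> mean. Hence each of the three inequalities holds with
  a constant \<open>C\<close> if and only if corresponding inequalities between finite real sums over \<open>D\<close> hold
  with the same \<open>C\<close> for all \<open>D\<close> (the three lemmas whose names end in \<open>iff_forests\<close>). In this form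
  the inequalities are plainly closed conditions on \<open>C\<close>, so least constants exist.

  \<^bold>\<open>The dual element.\<close> Let \<open>b\<^sub>Q\<close> be the value of \<open>T(f\<sigma>)\<^sub>Q\<close> on \<open>Q\<close> and let \<open>\<phi>\<close> be the \<open>l\<^sup>r\<close> norm of the
  sequence at a point. Along the chain of cubes containing the point, \<open>\<phi>\<^sup>p\<close> is a telescoping sum of
  increments, one for each cube. Writing the increment at \<open>Q\<close> as \<open>A\<^sub>Q b\<^sub>Q\<close> defines coefficients \<open>A\<^sub>Q\<close>
  that are constant on \<open>Q\<close>, and convexity of powers gives the pointwise bound
  \<open>C\<^bsub>p',r'\<^esub> \<phi>\<^bsup>p-1\<^esup>\<close> for the \<open>l\<^bsup>r'\<^esup>\<close> norm of \<open>(A\<^sub>Q)\<close> (lemma \<open>chain_dual_element\<close>); this is where the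
  constant of Stein's inequality enters. Integrating \<open>\<phi>\<^sup>p\<close> therefore reduces the theorem to a bound
  for the bilinear form of \<open>f\<close> and \<open>(A\<^sub>Q)\<close>.

  \<^bold>\<open>Parallel stopping cubes.\<close> For the bilinear form (lemma \<open>bilinear_bound\<close>), let \<open>u\<close> be the largest
  \<open>\<sigma>\<close>-average of \<open>f\<close> over the cubes containing \<open>Q\<close>, and \<open>w\<close> the \<open>l\<^bsup>r'\<^esup>\<close> norm of the coefficients of
  the cubes containing \<open>Q\<close>, both rounded down to powers of two. A stopping cube is one where the
  respective quantity has increased. Every \<open>Q\<close> lies below one stopping cube \<open>F\<close> for \<open>u\<close> and one, \<open>G\<close>,
  for \<open>w\<close>, on which \<open>u\<close> and \<open>w\<close> have the value they have at \<open>Q\<close>, and \<open>F\<close>, \<open>G\<close> are nested. If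
  \<open>G \<subseteq> F\<close>, the averages of \<open>f\<close> are at most \<open>2 u(F)\<close>, and the testing condition on \<open>F\<close> applies; otherwise
  the coefficients have norm at most \<open>2 w(G)\<close>, and the dual testing condition on \<open>G\<close> applies. What
  remains are the sums of \<open>u(F)\<^sup>p \<sigma>(F)\<close> and of \<open>w(G)\<^bsup>p'\<^esup> \<omega>(G)\<close>. Both are geometric along chains,
  and they are bounded by the norms of \<open>f\<close> (lemma \<open>Carleson_embedding\<close>) and of the coefficients, with
  factors \<open>2 p'\<close> and \<open>2\<close>. Rounding contributes a factor \<open>2\<close> in \<open>u\<close> and in \<open>w\<close>, so the constant of the
  bilinear form is \<open>16 p' (C + C\<^sup>*)\<close>, which is at most \<open>20 p p' (C + C\<^sup>*)\<close>.
\<close>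

section \<open>Elementary inequalities\<close>

text \<open>Convexity: the function \<open>h powr c\<close> lies above its tangent at \<open>h = D\<close>. In the applications \<open>D\<close> is
  a mean value of \<open>h\<close>, so that integrating this inequality gives Jensen's.\<close>

lemma Young_tangent:
  fixes c h D :: real
  assumes "1 < c" "0 \<le> h" "0 \<le> D"
  shows "c * h * D powr (c - 1) \<le> h powr c + (c - 1) * D powr c"
proof -
  define c' where "c' = c / (c - 1)"
  have c': "c' > 1" "1 / c + 1 / c' = 1" "(c - 1) * c' = c"
    using assms by (auto simp: c'_def field_simps)
  have "h * D powr (c - 1) \<le> h powr c / c + (D powr (c - 1)) powr c' / c'"
    using Youngs_inequality[of c c' h "D powr (c - 1)"] c' assms by simp
  also have "(D powr (c - 1)) powr c' / c' = (c - 1) * D powr c / c"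
    unfolding powr_powr c'(3) using assms by (simp add: c'_def)
  finally have "c * (h * D powr (c - 1)) \<le> c * (h powr c / c + (c - 1) * D powr c / c)"
    using assms by (intro mult_left_mono) auto
  also have "\<dots> = h powr c + (c - 1) * D powr c"
    using assms by (simp add: field_simps)
  finally show ?thesis by (simp add: mult.assoc)
qed

text \<open>Jensen's inequality for the exponent \<open>c\<close> and the function \<open>s * u powr (s - 1)\<close> on \<open>[x, y]\<close>: the
  difference quotient is its mean value, and the right-hand side is the integral of its \<open>c\<close>-th
  power. The proof integrates the tangent inequality at the mean \<open>D\<close> by monotonicity of an
  antiderivative \<open>K\<close>.\<close>

lemma powr_increment_le:
  fixes x y s c :: real
  assumes "0 \<le> x" "x < y" "0 < s" "1 < c" "0 < (s - 1) * c + 1"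
  defines "t \<equiv> (s - 1) * c + 1"
  shows "((y powr s - x powr s) / (y - x)) powr c * (y - x)
           \<le> s powr c / t * (y powr t - x powr t)"
proof -
  define D where "D = (y powr s - x powr s) / (y - x)"
  have D0: "0 < D"
    unfolding D_def using assms by (intro divide_pos_pos) (auto intro: powr_less_mono2)
  have t0: "0 < t" using assms by simp
  define K where "K = (\<lambda>u. s powr c / t * u powr t - c * D powr (c - 1) * u powr s
                          + (c - 1) * D powr c * u)"
  have "K x \<le> K y"
  proof (rule DERIV_nonneg_imp_increasing_open[where f = K])
    show "x \<le> y" using assms by simp
    show "continuous_on {x..y} K"
      unfolding K_def using t0 assms by (intro continuous_intros continuous_on_powr') auto
    fix u assume u: "x < u" "u < y"
    hence u0: "0 < u" using assms by simp
    have "(K has_real_derivative s powr c / t * (t * u powr (t - 1))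
             - c * D powr (c - 1) * (s * u powr (s - 1)) + (c - 1) * D powr c) (at u)"
      unfolding K_def using u0 by (auto intro!: derivative_eq_intros)
    moreover have "s powr c / t * (t * u powr (t - 1)) = (s * u powr (s - 1)) powr c"
      using t0 u0 assms by (simp add: powr_mult powr_powr t_def)
    moreover have "c * (s * u powr (s - 1)) * D powr (c - 1)
        \<le> (s * u powr (s - 1)) powr c + (c - 1) * D powr c"
      using assms D0 by (intro Young_tangent) auto
    ultimately show "\<exists>z. (K has_real_derivative z) (at u) \<and> 0 \<le> z"
      by (intro exI conjI) (assumption, simp add: mult_ac)
  qed
  hence "c * D powr (c - 1) * (y powr s - x powr s) - (c - 1) * D powr c * (y - x)
           \<le> s powr c / t * (y powr t - x powr t)"
    unfolding K_def by (simp add: algebra_simps)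
  moreover have "y powr s - x powr s = D * (y - x)"
    using assms by (simp add: D_def)
  moreover have "c * D powr (c - 1) * (D * (y - x)) = c * D powr c * (y - x)"
    using D0 by (simp add: powr_diff)
  ultimately show ?thesis
    unfolding D_def[symmetric] by (simp add: algebra_simps)
qed

lemma weighted_Holder:
  fixes p q :: real
  assumes p: "1 < p" "1 / p + 1 / q = 1" and "finite I"
    and nn: "\<And>i. i \<in> I \<Longrightarrow> 0 \<le> x i" "\<And>i. i \<in> I \<Longrightarrow> 0 \<le> y i" "\<And>i. i \<in> I \<Longrightarrow> 0 \<le> w i"
  shows "(\<Sum>i\<in>I. x i * y i * w i)
           \<le> (\<Sum>i\<in>I. x i powr p * w i) powr (1 / p) * (\<Sum>i\<in>I. y i powr q * w i) powr (1 / q)"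
proof -
  define X where "X = (\<Sum>i\<in>I. x i powr p * w i)"
  define Y where "Y = (\<Sum>i\<in>I. y i powr q * w i)"
  have q: "q > 1" using p by (smt (verit) divide_less_eq_1_pos divide_nonpos_nonneg less_divide_eq_1_pos zero_less_divide_1_iff)
  have XY: "X \<ge> 0" "Y \<ge> 0" unfolding X_def Y_def by (auto intro!: sum_nonneg mult_nonneg_nonneg nn)
  show ?thesis
  proof (cases "X = 0 \<or> Y = 0")
    case True
    have "x i * y i * w i = 0" if "i \<in> I" for i
    proof -
      have "x i powr p * w i = 0 \<or> y i powr q * w i = 0"
        using True that \<open>finite I\<close> nn unfolding X_def Y_def
        by (subst (asm) (1 2) sum_nonneg_eq_0_iff) auto
      thus ?thesis by auto
    qed
    hence "(\<Sum>i\<in>I. x i * y i * w i) = 0" by (intro sum.neutral) auto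
    thus ?thesis by simp
  next
    case False
    define a where "a = X powr (1 / p)"
    define b where "b = Y powr (1 / q)"
    have ab: "a > 0" "b > 0" "a powr p = X" "b powr q = Y"
      using False XY p q by (auto simp: a_def b_def powr_powr)
    have "(\<Sum>i\<in>I. x i * y i * w i) = a * b * (\<Sum>i\<in>I. (x i / a) * (y i / b) * w i)"
      using ab by (simp add: sum_distrib_left)
    also have "(\<Sum>i\<in>I. (x i / a) * (y i / b) * w i)
        \<le> (\<Sum>i\<in>I. ((x i / a) powr p / p + (y i / b) powr q / q) * w i)"
      using p q ab nn by (intro sum_mono mult_right_mono Youngs_inequality) auto
    also have "\<dots> = (\<Sum>i\<in>I. x i powr p * w i * (1 / (X * p)) + y i powr q * w i * (1 / (Y * q)))"
      using ab nn by (intro sum.cong) (auto simp: powr_divide field_simps)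
    also have "\<dots> = X * (1 / (X * p)) + Y * (1 / (Y * q))"
      unfolding sum.distrib sum_distrib_right[symmetric] X_def[symmetric] Y_def[symmetric] ..
    also have "\<dots> = 1" using False p by simp
    finally show ?thesis using ab by (simp add: a_def b_def X_def Y_def mult_left_mono)
  qed
qed

lemma conjugate_gt_1:
  fixes p p' :: real
  assumes "1 < p" "1 / p + 1 / p' = 1" shows "1 < p'" "p' = p / (p - 1)" "p / p' = p - 1"
proof -
  have "1 / p' = (p - 1) / p" using assms by (simp add: field_simps)
  hence "p' = p / (p - 1)" by (metis div_by_1 divide_divide_eq_right mult_1)
  thus "p' = p / (p - 1)" "1 < p'" "p / p' = p - 1" using assms by auto
qed

text \<open>The absorption step that ends every duality argument below: a quantity that is bounded by a
  smaller power of itself is bounded outright.\<close>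

lemma le_of_le_mult_powr:
  fixes p p' :: real
  assumes p: "1 < p" "1 / p + 1 / p' = 1" and "0 \<le> T" "0 \<le> K" "T \<le> K * T powr (1 / p')"
  shows "T powr (1 / p) \<le> K"
proof (cases "T = 0")
  case False
  hence T: "T > 0" using assms by simp
  have "T powr (1 / p) * T powr (1 / p') = T"
    unfolding powr_add[symmetric] using p T by simp
  hence "T powr (1 / p) * T powr (1 / p') \<le> K * T powr (1 / p')" using assms by simp
  thus ?thesis using T by (simp add: mult_le_cancel_right)
qed (use assms in auto)

section \<open>The finite \<open>l\<^sup>r\<close> norm as a real number\<close>

text \<open>Meant for non-negative entries. The element \<open>0\<close> in the maximum gives the empty family norm \<open>0\<close>,
  as in the case of finite \<open>r\<close>.\<close>

definition real_lr_norm :: "ennreal \<Rightarrow> 'i set \<Rightarrow> ('i \<Rightarrow> real) \<Rightarrow> real" where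
  "real_lr_norm r I a =
     (if r = \<infinity> then Max (insert 0 (a ` I))
      else (\<Sum>i\<in>I. a i powr enn2real r) powr (1 / enn2real r))"

lemma ennreal_inverse_eq_1:
  fixes x :: ennreal
  assumes "inverse x = 1" shows "x = 1"
proof (cases x rule: ennreal_cases)
  case (real c)
  hence "c > 0" using assms by (cases "c = 0") auto
  hence "ennreal (inverse c) = ennreal 1" using assms real by (simp add: inverse_ennreal)
  thus ?thesis using \<open>c > 0\<close> real by (subst (asm) ennreal_inj) auto
qed (use assms in auto)

lemma conjugate_exponents_cases:
  fixes r r' :: ennreal
  assumes "1 \<le> r" "inverse r + inverse r' = 1"
  obtains "r = 1" "r' = \<infinity>" | "r = \<infinity>" "r' = 1"
  | \<rho> \<rho>' :: real where "r = ennreal \<rho>" "r' = ennreal \<rho>'" "1 < \<rho>" "1 < \<rho>'" "1 / \<rho> + 1 / \<rho>' = 1"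
proof (cases r rule: ennreal_cases)
  case top
  hence "inverse r' = 1" using assms by simp
  hence "r' = 1" by (rule ennreal_inverse_eq_1)
  thus ?thesis using that(2) top by simp
next
  case (real \<rho>)
  hence r1: "1 \<le> \<rho>" using assms by (metis ennreal_1 ennreal_le_iff)
  show ?thesis
  proof (cases r' rule: ennreal_cases)
    case top
    hence "inverse r = 1" using assms by simp
    hence "r = 1" by (rule ennreal_inverse_eq_1)
    thus ?thesis using that(1) top by simp
  next
    case (real \<rho>')
    have "\<rho>' > 0"
      using assms real by (intro neq_le_trans[OF _ real(1)]) auto
    hence "ennreal (1 / \<rho> + 1 / \<rho>') = ennreal 1"
      using assms r1 \<open>r = ennreal \<rho>\<close> real
      by (simp add: inverse_ennreal divide_inverse ennreal_plus[symmetric] del: ennreal_plus)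
    hence eq: "1 / \<rho> + 1 / \<rho>' = 1"
      using r1 \<open>\<rho>' > 0\<close> by (subst (asm) ennreal_inj) auto
    hence "\<rho> \<noteq> 1" "1 / \<rho> > 0" "1 / \<rho>' > 0" using \<open>\<rho>' > 0\<close> r1 by auto
    hence "\<rho> > 1" "1 / \<rho>' < 1" using eq r1 by linarith+
    hence "\<rho> > 1" "\<rho>' > 1" using \<open>\<rho>' > 0\<close> by auto
    thus ?thesis using that(3)[of \<rho> \<rho>'] eq \<open>r = ennreal \<rho>\<close> real by simp
  qed
qed

lemma exponent_pos:
  assumes "1 \<le> r" "r \<noteq> \<infinity>" shows "0 < enn2real r"
  using assms by (cases r rule: ennreal_cases) (auto simp: enn2real_positive_iff)

lemma real_lr_norm_empty [simp]: "real_lr_norm r {} a = 0"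
  by (simp add: real_lr_norm_def)

lemma real_lr_norm_nonneg: "finite I \<Longrightarrow> 0 \<le> real_lr_norm r I a"
  by (auto simp: real_lr_norm_def)

lemma real_lr_norm_cong: "(\<And>i. i \<in> I \<Longrightarrow> a i = b i) \<Longrightarrow> real_lr_norm r I a = real_lr_norm r I b"
  by (simp add: real_lr_norm_def)

lemma real_lr_norm_mono:
  assumes "1 \<le> r" "finite J" "I \<subseteq> J" "\<And>i. i \<in> I \<Longrightarrow> 0 \<le> a i" "\<And>i. i \<in> I \<Longrightarrow> a i \<le> b i"
  shows "real_lr_norm r I a \<le> real_lr_norm r J b"
proof (cases "r = \<infinity>")
  case True
  have "finite I" using assms finite_subset by blast
  have "\<exists>c\<in>insert 0 (b ` J). z \<le> c" if "z \<in> insert 0 (a ` I)" for z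
    using that assms(3,5) by auto
  hence "z \<le> Max (insert 0 (b ` J))" if "z \<in> insert 0 (a ` I)" for z
    using that \<open>finite J\<close> by (subst Max_ge_iff) auto
  hence "Max (insert 0 (a ` I)) \<le> Max (insert 0 (b ` J))"
    using \<open>finite I\<close> by (intro Max.boundedI) auto
  thus ?thesis using True by (simp add: real_lr_norm_def)
next
  case False
  note pos = exponent_pos[OF assms(1) False]
  have "(\<Sum>i\<in>I. a i powr enn2real r) \<le> (\<Sum>i\<in>I. b i powr enn2real r)"
    using assms pos by (intro sum_mono powr_mono2) auto
  also have "\<dots> \<le> (\<Sum>i\<in>J. b i powr enn2real r)"
    using assms by (intro sum_mono2) auto
  finally show ?thesis using False pos
    by (auto simp: real_lr_norm_def intro!: powr_mono2 sum_nonneg)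
qed

lemma real_lr_norm_Holder:
  assumes "1 \<le> r" "inverse r + inverse r' = 1" "finite I"
    and nn: "\<And>i. i \<in> I \<Longrightarrow> 0 \<le> a i" "\<And>i. i \<in> I \<Longrightarrow> 0 \<le> b i"
  shows "(\<Sum>i\<in>I. a i * b i) \<le> real_lr_norm r I a * real_lr_norm r' I b"
  using assms(1,2)
proof (cases rule: conjugate_exponents_cases)
  case 1
  have "(\<Sum>i\<in>I. a i * b i) \<le> (\<Sum>i\<in>I. a i * Max (insert 0 (b ` I)))"
    using assms by (intro sum_mono mult_left_mono Max_ge) auto
  thus ?thesis using 1 nn by (simp add: real_lr_norm_def sum_distrib_right sum_nonneg)
next
  case 2
  have "(\<Sum>i\<in>I. a i * b i) \<le> (\<Sum>i\<in>I. Max (insert 0 (a ` I)) * b i)"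
    using assms by (intro sum_mono mult_right_mono Max_ge) auto
  thus ?thesis using 2 nn by (simp add: real_lr_norm_def sum_distrib_left sum_nonneg)
next
  case (3 \<rho> \<rho>')
  have "(\<Sum>i\<in>I. a i * b i * 1) \<le> (\<Sum>i\<in>I. a i powr \<rho> * 1) powr (1 / \<rho>)
          * (\<Sum>i\<in>I. b i powr \<rho>' * 1) powr (1 / \<rho>')"
    using 3 assms by (intro weighted_Holder) auto
  thus ?thesis using 3 by (simp add: real_lr_norm_def)
qed

lemma lr_norm_finite:
  assumes "1 \<le> r" "finite I"
  shows "lr_norm r I a = ennreal (real_lr_norm r I (\<lambda>i. \<bar>a i\<bar>))"
proof (cases "r = \<infinity>")
  case True
  show ?thesis
  proof (cases "I = {}")
    case True
    with \<open>r = \<infinity>\<close> show ?thesis by (simp add: lr_norm_def real_lr_norm_def bot_ennreal)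
  next
    case False
    have fin: "finite ((\<lambda>i. ennreal \<bar>a i\<bar>) ` I)" using assms by simp
    have "Max ((\<lambda>i. \<bar>a i\<bar>) ` I) \<ge> 0"
      using False assms by (auto simp: Max_ge_iff)
    hence "real_lr_norm r I (\<lambda>i. \<bar>a i\<bar>) = Max ((\<lambda>i. \<bar>a i\<bar>) ` I)"
      using False \<open>r = \<infinity>\<close> assms by (simp add: real_lr_norm_def max_absorb2)
    also have "ennreal \<dots> = Max (ennreal ` ((\<lambda>i. \<bar>a i\<bar>) ` I))"
      using False assms by (intro mono_Max_commute) (auto intro!: monoI ennreal_leI)
    also have "\<dots> = (SUP i\<in>I. ennreal \<bar>a i\<bar>)"
      using False assms by (subst Max_Sup) (auto simp: image_image)
    finally show ?thesis using \<open>r = \<infinity>\<close> by (simp add: lr_norm_def)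
  qed
next
  case False
  thus ?thesis using assms
    by (simp add: lr_norm_def real_lr_norm_def epowr_def sum_ennreal sum_nonneg)
qed

lemma real_lr_norm_zero_extension:
  assumes r: "1 \<le> r" and "finite J" "I \<subseteq> J"
  shows "real_lr_norm r J (\<lambda>i. if i \<in> I then a i else 0) = real_lr_norm r I a"
proof (cases "r = \<infinity>")
  case True
  have "insert 0 ((\<lambda>i. if i \<in> I then a i else 0) ` J) = insert 0 (a ` I)"
    using assms by (auto simp: image_iff)
  thus ?thesis using True by (simp add: real_lr_norm_def)
next
  case False
  have "(\<Sum>i\<in>J. (if i \<in> I then a i else 0) powr enn2real r) = (\<Sum>i\<in>I. a i powr enn2real r)"
    using assms by (intro sum.mono_neutral_cong_right) auto
  thus ?thesis using False by (simp add: real_lr_norm_def)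
qed

section \<open>The dual element of a chain\<close>

text \<open>The elements below \<open>x\<close> do not occur in the term of \<open>x\<close>, so removing the least element of \<open>I\<close>
  removes one term and leaves the others unchanged.\<close>

lemma chain_telescope:
  fixes I :: "'a :: order set" and \<Phi> :: "'a set \<Rightarrow> real"
  assumes "finite I" "\<And>x y. x \<in> I \<Longrightarrow> y \<in> I \<Longrightarrow> x \<le> y \<or> y \<le> x"
  shows "(\<Sum>x\<in>I. \<Phi> {y\<in>I. x \<le> y} - \<Phi> {y\<in>I. x < y}) = \<Phi> I - \<Phi> {}"
  using assms
proof (induction I rule: finite_psubset_induct)
  case (psubset I)
  show ?case
  proof (cases "I = {}")
    case False
    then obtain z where z: "z \<in> I" "\<And>y. y \<in> I \<Longrightarrow> y \<le> z \<Longrightarrow> y = z"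
      using finite_has_minimal[OF psubset.hyps] by (metis)
    hence low: "z \<le> y" if "y \<in> I" for y using psubset.prems that by metis
    let ?J = "I - {z}"
    have "{y\<in>I. z \<le> y} = I" "{y\<in>I. z < y} = ?J"
      using low by (auto simp: order.strict_iff_order)
    moreover have "{y\<in>I. x \<le> y} = {y\<in>?J. x \<le> y}" "{y\<in>I. x < y} = {y\<in>?J. x < y}"
      if "x \<in> ?J" for x
      using that low z by (auto dest: order.antisym less_imp_le)
    moreover have "(\<Sum>x\<in>?J. \<Phi> {y\<in>?J. x \<le> y} - \<Phi> {y\<in>?J. x < y}) = \<Phi> ?J - \<Phi> {}"
      using z psubset.prems by (intro psubset.IH) auto
    moreover have "(\<Sum>x\<in>I. \<Phi> {y\<in>I. x \<le> y} - \<Phi> {y\<in>I. x < y}) =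
        \<Phi> {y\<in>I. z \<le> y} - \<Phi> {y\<in>I. z < y} + (\<Sum>x\<in>?J. \<Phi> {y\<in>I. x \<le> y} - \<Phi> {y\<in>I. x < y})"
      using z psubset.hyps by (intro sum.remove)
    moreover have "(\<Sum>x\<in>?J. \<Phi> {y\<in>I. x \<le> y} - \<Phi> {y\<in>I. x < y})
        = (\<Sum>x\<in>?J. \<Phi> {y\<in>?J. x \<le> y} - \<Phi> {y\<in>?J. x < y})"
      using calculation(3,4) by (intro sum.cong) simp_all
    ultimately show ?thesis by simp
  qed auto
qed


text \<open>The constant that \<open>powr_increment_le\<close> produces for \<open>s = p / \<rho>\<close> and \<open>c = \<rho>'\<close>. It equals
  \<open>(p / \<rho>) powr (\<rho>' - 1) * (p' / \<rho>')\<close>. One of the two factors is at most \<open>1\<close>, the first one if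
  \<open>\<rho>' \<le> p'\<close> and the second one otherwise; the other is a power of the constant in Stein's inequality.\<close>

lemma stein_const_ge:
  fixes p p' \<rho> \<rho>' :: real
  assumes p: "1 < p" "1 / p + 1 / p' = 1" and r: "1 < \<rho>" "1 < \<rho>'" "1 / \<rho> + 1 / \<rho>' = 1"
  shows "0 < (p / \<rho> - 1) * \<rho>' + 1" "\<rho> * ((p / \<rho> - 1) * \<rho>' + 1) = (p - 1) * \<rho>'"
    "(p / \<rho>) powr \<rho>' / ((p / \<rho> - 1) * \<rho>' + 1)
       \<le> stein_const p p' (ennreal \<rho>) (ennreal \<rho>') powr \<rho>'"
proof -
  define t where "t = (p / \<rho> - 1) * \<rho>' + 1"
  have \<rho>': "\<rho>' = \<rho> / (\<rho> - 1)" using conjugate_gt_1[OF r(1,3)] by simp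
  have t: "t = (p - 1) / (\<rho> - 1)"
    using r(1) by (simp add: t_def \<rho>' field_simps)
  have t0: "t > 0" using t p r by simp
  thus "0 < (p / \<rho> - 1) * \<rho>' + 1" by (simp add: t_def)
  show "\<rho> * ((p / \<rho> - 1) * \<rho>' + 1) = (p - 1) * \<rho>'"
  proof -
    have "\<rho> * t = (p - 1) * \<rho>'" by (simp add: t \<rho>')
    thus ?thesis by (simp add: t_def)
  qed
  have pt: "(p / \<rho>) / t = p' / \<rho>'"
    using conjugate_gt_1[OF p] p r by (simp add: t \<rho>' field_simps)
  have s: "p / \<rho> > 0" using p r by simp
  have "(p / \<rho>) powr \<rho>' = (p / \<rho>) powr (\<rho>' - 1 + 1)" by simp
  also have "\<dots> = (p / \<rho>) powr (\<rho>' - 1) * (p / \<rho>)"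
    unfolding powr_add using s by (simp only: powr_one less_imp_le)
  finally have "(p / \<rho>) powr \<rho>' / t = (p / \<rho>) powr (\<rho>' - 1) * ((p / \<rho>) / t)"
    by simp
  also have "\<dots> \<le> stein_const p p' (ennreal \<rho>) (ennreal \<rho>') powr \<rho>'"
  proof (cases "\<rho>' \<le> p'")
    case True
    have "p / \<rho> \<le> 1"
    proof -
      have "1 / p' \<le> 1 / \<rho>'" using True r(2) by (intro divide_left_mono) auto
      hence "1 / \<rho> \<le> 1 / p" using p r by linarith
      thus ?thesis using p r by (simp add: field_simps)
    qed
    hence "(p / \<rho>) powr (\<rho>' - 1) \<le> 1" using s p r by (intro powr_le1) auto
    hence "(p / \<rho>) powr (\<rho>' - 1) * (p' / \<rho>') \<le> p' / \<rho>'"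
      using True r by (intro mult_left_le_one_le) auto
    thus ?thesis using True r conjugate_gt_1(1)[OF p] unfolding pt
      by (simp add: stein_const_def powr_powr)
  next
    case False
    have "p' / \<rho>' \<le> 1" using False r by simp
    hence "(p / \<rho>) powr (\<rho>' - 1) * (p' / \<rho>') \<le> (p / \<rho>) powr (\<rho>' - 1)"
      by (intro mult_left_le) auto
    moreover have "\<rho>' / \<rho> = \<rho>' - 1" using conjugate_gt_1[of \<rho>' \<rho>] r by (simp add: add.commute)
    ultimately show ?thesis using False r conjugate_gt_1(1)[OF p] unfolding pt
      by (simp add: stein_const_def powr_powr ennreal_le_iff)
  qed
  finally show "(p / \<rho>) powr \<rho>' / ((p / \<rho> - 1) * \<rho>' + 1)
       \<le> stein_const p p' (ennreal \<rho>) (ennreal \<rho>') powr \<rho>'" by (simp add: t_def)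
qed

text \<open>The index \<open>i\<close> raises the norm from \<open>x\<close> to \<open>y\<close>, and \<open>A\<close> is the coefficient for which \<open>A * b i\<close> is the
  gain in the \<open>p\<close>-th power. The point is that \<open>A powr r'\<close> is again controlled by a gain, namely in the
  power \<open>(p - 1) * r'\<close> of the norm, so that the bounds for several indices telescope as well. For
  \<open>1 < r < \<infinity>\<close> this is \<open>powr_increment_le\<close> in the variable \<open>x powr r\<close>, in which the norm is additive; in
  the two extreme cases it is Young's inequality.\<close>

lemma dual_increment:
  fixes p p' :: real and r r' :: ennreal
  assumes p: "1 < p" "1 / p + 1 / p' = 1" and r: "1 \<le> r" "inverse r + inverse r' = 1"
    and J: "finite J" "i \<notin> J" "\<And>j. j \<in> insert i J \<Longrightarrow> 0 \<le> b j"
  defines "x \<equiv> real_lr_norm r J b" and "y \<equiv> real_lr_norm r (insert i J) b"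
  defines "A \<equiv> (y powr p - x powr p) / b i"
  shows "0 \<le> A" "A * b i = y powr p - x powr p"
    and "r' = \<infinity> \<Longrightarrow> A \<le> stein_const p p' r r' * y powr (p - 1)"
    and "r' \<noteq> \<infinity> \<Longrightarrow> A powr enn2real r' \<le> stein_const p p' r r' powr enn2real r'
           * (y powr ((p - 1) * enn2real r') - x powr ((p - 1) * enn2real r'))"
proof -
  define \<beta> where "\<beta> = b i"
  have \<beta>0: "0 \<le> \<beta>" using J by (simp add: \<beta>_def)
  have x0: "0 \<le> x" unfolding x_def using J by (simp add: real_lr_norm_nonneg)
  have xy: "x \<le> y" unfolding x_def y_def using J r by (intro real_lr_norm_mono) auto
  have p': "1 < p'" "p' = p / (p - 1)" using conjugate_gt_1[OF p] by auto
  from r have y_eq: "r = 1 \<and> r' = \<infinity> \<and> y = x + \<beta> \<or> r = \<infinity> \<and> r' = 1 \<and> y = max \<beta> x \<or>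
     (\<exists>\<rho> \<rho>'. r = ennreal \<rho> \<and> r' = ennreal \<rho>' \<and> 1 < \<rho> \<and> 1 < \<rho>' \<and> 1 / \<rho> + 1 / \<rho>' = 1 \<and>
            y powr \<rho> = x powr \<rho> + \<beta> powr \<rho>)" (is "?c1 \<or> ?c2 \<or> ?c3")
  proof (cases rule: conjugate_exponents_cases)
    case 1
    hence "y = \<beta> + x" using J by (simp add: x_def y_def \<beta>_def real_lr_norm_def sum_nonneg)
    thus ?thesis using 1 by simp
  next
    case 2
    have "insert 0 (b ` insert i J) = insert \<beta> (insert 0 (b ` J))" by (auto simp: \<beta>_def)
    moreover have "Max (insert \<beta> (insert 0 (b ` J))) = max \<beta> (Max (insert 0 (b ` J)))"
      using J by (intro Max_insert) auto
    ultimately have "y = max \<beta> x" using 2 by (simp add: x_def y_def real_lr_norm_def)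
    thus ?thesis using 2 by simp
  next
    case (3 \<rho> \<rho>')
    hence "y powr \<rho> = x powr \<rho> + \<beta> powr \<rho>"
      using J by (simp add: x_def y_def \<beta>_def real_lr_norm_def powr_powr sum_nonneg)
    thus ?thesis using 3 by blast
  qed
  have zero: "x = y" if "\<beta> = 0"
    using y_eq
  proof (elim disjE exE conjE)
    fix \<rho> assume "1 < (\<rho>::real)" "y powr \<rho> = x powr \<rho> + \<beta> powr \<rho>"
    hence "(y powr \<rho>) powr (1 / \<rho>) = (x powr \<rho>) powr (1 / \<rho>)" using that by simp
    thus "x = y" using x0 xy \<open>1 < \<rho>\<close> by (simp add: powr_powr)
  qed (use that x0 in auto)
  show A0: "0 \<le> A" unfolding A_def using \<beta>0 p x0 xy by (simp add: \<beta>_def powr_mono2)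
  show Ab: "A * b i = y powr p - x powr p"
    using zero by (cases "\<beta> = 0") (auto simp: A_def \<beta>_def)
  have young: "p * u * v powr (p - 1) \<le> u powr p + (p - 1) * v powr p" if "0 \<le> u" "0 \<le> v" for u v
    using Young_tangent p that by blast
  have vp: "v powr p = v powr (p - 1) * v" if "0 \<le> v" for v
    using that p by (cases "v = 0") (auto simp: powr_diff)
  {
    assume r': "r' = \<infinity>"
    hence c: "r = 1" "y = x + \<beta>" using y_eq by auto
    show "A \<le> stein_const p p' r r' * y powr (p - 1)"
    proof (cases "\<beta> = 0")
      case False
      have "y powr p - x powr p \<le> p * y powr (p - 1) * (y - x)"
        using young[of x y] vp[of y] x0 xy by (simp add: algebra_simps)
      moreover have "\<not> \<infinity> \<le> ennreal p'" by (simp add: top_unique)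
      ultimately show ?thesis using False \<beta>0 c r' p
        by (simp add: A_def \<beta>_def[symmetric] stein_const_def divide_le_eq mult_ac)
    qed (use p in \<open>simp add: A_def \<beta>_def stein_const_def\<close>)
  }
  assume fin: "r' \<noteq> \<infinity>"
  show "A powr enn2real r' \<le> stein_const p p' r r' powr enn2real r'
           * (y powr ((p - 1) * enn2real r') - x powr ((p - 1) * enn2real r'))"
  proof (cases "x = y")
    case True
    thus ?thesis by (simp add: A_def)
  next
    case False
    hence lt: "x < y" "0 < \<beta>" using xy zero \<beta>0 by force+
    from y_eq fin consider ?c2 | ?c3 by blast
    thus ?thesis
    proof cases
      case 1
      hence y: "y = \<beta>" and r': "r' = 1" using False by (auto simp: max_def split: if_splits)
      have st: "stein_const p p' r r' = p'" using p'(1) r' by (simp add: stein_const_def)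
      have "(p - 1) * (y powr p - x powr p) \<le> p * (y powr (p - 1) - x powr (p - 1)) * y"
        using young[of y x] vp[of y] vp[of x] x0 xy by (simp add: algebra_simps)
      hence "y powr p - x powr p \<le> p' * (y powr (p - 1) - x powr (p - 1)) * y"
        using p by (simp add: p'(2) field_simps)
      hence "A \<le> p' * (y powr (p - 1) - x powr (p - 1))"
        using lt y by (simp add: A_def \<beta>_def[symmetric] divide_le_eq)
      thus ?thesis using r' st A0 p'(1) by simp
    next
      case 2
      then obtain \<rho> \<rho>' where c: "r = ennreal \<rho>" "r' = ennreal \<rho>'" "1 < \<rho>" "1 < \<rho>'"
        "1 / \<rho> + 1 / \<rho>' = 1" "y powr \<rho> = x powr \<rho> + \<beta> powr \<rho>" by blast
      define X where "X = x powr \<rho>"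
      define Y where "Y = y powr \<rho>"
      define s where "s = p / \<rho>"
      define t where "t = (s - 1) * \<rho>' + 1"
      note st = stein_const_ge[OF p c(3,4,5)]
      have XY: "X < Y" "0 \<le> X" unfolding X_def Y_def using lt x0 c by (auto intro: powr_less_mono2)
      have pw: "x powr p = X powr s" "y powr p = Y powr s"
          "x powr ((p - 1) * \<rho>') = X powr t" "y powr ((p - 1) * \<rho>') = Y powr t"
        using c(3) st(2) by (simp_all add: X_def Y_def s_def t_def powr_powr)
      have d0: "0 \<le> Y powr s - X powr s"
        using XY p c by (simp add: s_def powr_mono2)
      have \<beta>: "\<beta> powr \<rho> = Y - X" using c by (simp add: X_def Y_def)
      have "\<rho>' = \<rho> * (\<rho>' - 1)" using c(3,5) conjugate_gt_1(2)[OF c(3,5)] by (simp add: field_simps)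
      hence "\<beta> powr \<rho>' = (Y - X) powr (\<rho>' - 1)" by (metis \<beta> powr_powr)
      hence "A powr \<rho>' = (Y powr s - X powr s) powr \<rho>' / (Y - X) powr (\<rho>' - 1)"
        unfolding A_def \<beta>_def[symmetric] pw using d0 \<beta>0 by (simp add: powr_divide)
      also have "\<dots> = ((Y powr s - X powr s) / (Y - X)) powr \<rho>' * (Y - X)"
        using XY d0 by (simp add: powr_divide powr_diff)
      also have "\<dots> \<le> s powr \<rho>' / t * (Y powr t - X powr t)"
        unfolding t_def using XY p c st by (intro powr_increment_le) (auto simp: s_def)
      also have "\<dots> \<le> stein_const p p' r r' powr \<rho>' * (Y powr t - X powr t)"
        using st XY by (intro mult_right_mono) (auto simp: s_def t_def c intro!: powr_mono2)
      finally show ?thesis using c by (simp add: pw)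
    qed
  qed
qed

text \<open>For the norming functional of \<open>l\<^sup>r\<close>, the bound would hold with constant \<open>1\<close>, but its coefficient at
  \<open>x\<close> depends on the whole chain. Here it depends only on the elements \<open>y \<ge> x\<close>. When the chain
  consists of the cubes containing a point, \<open>A\<close> is therefore a sequence of constants, one for each
  cube, as the dual testing condition requires.\<close>

lemma chain_dual_element:
  fixes I :: "'a :: order set" and p p' :: real and r r' :: ennreal
  assumes p: "1 < p" "1 / p + 1 / p' = 1" and r: "1 \<le> r" "inverse r + inverse r' = 1"
    and I: "finite I" "\<And>x y. x \<in> I \<Longrightarrow> y \<in> I \<Longrightarrow> x \<le> y \<or> y \<le> x" "\<And>x. x \<in> I \<Longrightarrow> 0 \<le> b x"
  defines "A \<equiv> (\<lambda>x. (real_lr_norm r {y\<in>I. x \<le> y} b powr p - real_lr_norm r {y\<in>I. x < y} b powr p) / b x)"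
  shows "\<And>x. x \<in> I \<Longrightarrow> 0 \<le> A x"
    and "(\<Sum>x\<in>I. A x * b x) = real_lr_norm r I b powr p"
    and "real_lr_norm r' I A \<le> stein_const p p' r r' * real_lr_norm r I b powr (p - 1)"
proof -
  have ins: "{y\<in>I. x \<le> y} = insert x {y\<in>I. x < y}" if "x \<in> I" for x
    using that by (auto simp: order.order_iff_strict)
  have inc': "0 \<le> A x" "A x * b x = real_lr_norm r {y\<in>I. x \<le> y} b powr p - real_lr_norm r {y\<in>I. x < y} b powr p"
      "r' = \<infinity> \<Longrightarrow> A x \<le> stein_const p p' r r' * real_lr_norm r {y\<in>I. x \<le> y} b powr (p - 1)"
      "r' \<noteq> \<infinity> \<Longrightarrow> A x powr enn2real r' \<le> stein_const p p' r r' powr enn2real r' *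
         (real_lr_norm r {y\<in>I. x \<le> y} b powr ((p - 1) * enn2real r')
           - real_lr_norm r {y\<in>I. x < y} b powr ((p - 1) * enn2real r'))" if "x \<in> I" for x
    using dual_increment[OF p r, of "{y\<in>I. x < y}" x b] that I(1,3)
    unfolding ins[OF that, symmetric] A_def by auto
  show "\<And>x. x \<in> I \<Longrightarrow> 0 \<le> A x" by (rule inc')
  show "(\<Sum>x\<in>I. A x * b x) = real_lr_norm r I b powr p"
    using chain_telescope[OF I(1,2), of "\<lambda>J. real_lr_norm r J b powr p"] p
    by (simp add: inc' cong: sum.cong)
  have S0: "0 \<le> stein_const p p' r r'" by (simp add: stein_const_def)
  show "real_lr_norm r' I A \<le> stein_const p p' r r' * real_lr_norm r I b powr (p - 1)"
  proof (cases "r' = \<infinity>")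
    case True
    have "A x \<le> stein_const p p' r r' * real_lr_norm r I b powr (p - 1)" if "x \<in> I" for x
    proof -
      have "real_lr_norm r {y\<in>I. x \<le> y} b powr (p - 1) \<le> real_lr_norm r I b powr (p - 1)"
        using p I r by (intro powr_mono2 real_lr_norm_mono real_lr_norm_nonneg) auto
      thus ?thesis using inc'(3)[OF that True] S0 by (meson mult_left_mono order_trans)
    qed
    thus ?thesis using True S0 I(1) by (auto simp: real_lr_norm_def)
  next
    case False
    define c where "c = enn2real r'"
    have c0: "c > 0"
      using r
      by (cases rule: conjugate_exponents_cases) (use False in \<open>auto simp: c_def\<close>)
    have "(\<Sum>x\<in>I. A x powr c) \<le> (\<Sum>x\<in>I. stein_const p p' r r' powr c *
         (real_lr_norm r {y\<in>I. x \<le> y} b powr ((p - 1) * c) - real_lr_norm r {y\<in>I. x < y} b powr ((p - 1) * c)))"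
      unfolding c_def by (intro sum_mono inc' False)
    also have "\<dots> = stein_const p p' r r' powr c * real_lr_norm r I b powr ((p - 1) * c)"
      using chain_telescope[OF I(1,2), of "\<lambda>J. real_lr_norm r J b powr ((p - 1) * c)"] p c0
      by (simp add: sum_distrib_left[symmetric])
    also have "\<dots> = (stein_const p p' r r' * real_lr_norm r I b powr (p - 1)) powr c"
      using S0 by (simp add: powr_mult powr_powr)
    finally have "(\<Sum>x\<in>I. A x powr c) powr (1 / c)
        \<le> ((stein_const p p' r r' * real_lr_norm r I b powr (p - 1)) powr c) powr (1 / c)"
      using c0 by (intro powr_mono2) (auto intro: sum_nonneg)
    thus ?thesis using c0 False S0 by (simp add: real_lr_norm_def c_def powr_powr)
  qed
qed

section \<open>Finite forests and stopping elements\<close>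

text \<open>An element \<open>q\<close> of the forest stands for a cube and at the same time for its atom. Then \<open>upset D q\<close>
  are the cubes that contain the atom, functions constant on atoms are functions on \<open>D\<close>, and if \<open>m\<close>
  gives the measures of the atoms, \<open>mass D m Q\<close> is the measure of the cube \<open>Q\<close>.\<close>

definition upset :: "'a :: order set \<Rightarrow> 'a \<Rightarrow> 'a set" where
  "upset D q = {Q\<in>D. q \<le> Q}"

definition mass :: "'a :: order set \<Rightarrow> ('a \<Rightarrow> real) \<Rightarrow> 'a \<Rightarrow> real" where
  "mass D m Q = (\<Sum>q\<in>{q\<in>D. q \<le> Q}. m q)"

locale finite_forest =
  fixes D :: "'a :: order set"
  assumes finite_D: "finite D"
    and comparable: "\<lbrakk>q \<in> D; Q \<in> D; Q' \<in> D; q \<le> Q; q \<le> Q'\<rbrakk> \<Longrightarrow> Q \<le> Q' \<or> Q' \<le> Q"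

text \<open>Fubini's theorem: a sum over cubes against their measure is an integral over the atoms.\<close>

lemma sum_mass_swap:
  assumes "finite D" "S \<subseteq> D"
  shows "(\<Sum>Q\<in>S. c Q * mass D m Q) = (\<Sum>q\<in>D. (\<Sum>Q\<in>{Q\<in>S. q \<le> Q}. c Q) * m q)"
proof -
  have "finite S" using assms finite_subset by blast
  have "(\<Sum>Q\<in>S. c Q * mass D m Q) = (\<Sum>Q\<in>S. \<Sum>q\<in>{q\<in>D. q \<le> Q}. c Q * m q)"
    by (simp add: mass_def sum_distrib_left)
  also have "\<dots> = (\<Sum>q\<in>D. \<Sum>Q\<in>{Q\<in>S. q \<le> Q}. c Q * m q)"
    using \<open>finite S\<close> assms(1) by (rule sum.swap_restrict)
  finally show ?thesis by (simp add: sum_distrib_right)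
qed

lemma mass_nonneg: "(\<And>q. q \<in> D \<Longrightarrow> 0 \<le> m q) \<Longrightarrow> 0 \<le> mass D m Q"
  by (auto simp: mass_def intro: sum_nonneg)

text \<open>Rounding down to a power of two, with \<open>0\<close> as an additional value. Distinct values differ at least
  by a factor two, also when one of them is \<open>0\<close>, so that vanishing averages need no separate
  treatment.\<close>

definition dyadic_floor :: "real \<Rightarrow> real" where
  "dyadic_floor x = (if x \<le> 0 then 0 else 2 powr \<lfloor>log 2 x\<rfloor>)"

lemma dyadic_floor_nonneg: "0 \<le> dyadic_floor x"
  by (simp add: dyadic_floor_def)

lemma dyadic_floor_le: "0 \<le> x \<Longrightarrow> dyadic_floor x \<le> x"
  by (auto simp: dyadic_floor_def le_log_iff[symmetric])

lemma le_2_dyadic_floor: "x \<le> 2 * dyadic_floor x"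
proof (cases "x \<le> 0")
  case False
  hence "x = 2 powr log 2 x" by simp
  also have "\<dots> \<le> 2 powr (1 + \<lfloor>log 2 x\<rfloor>)" by (intro powr_mono) linarith+
  also have "\<dots> = 2 * dyadic_floor x" using False by (simp add: dyadic_floor_def powr_add)
  finally show ?thesis .
qed (simp add: dyadic_floor_def)

lemma dyadic_floor_mono: "x \<le> y \<Longrightarrow> dyadic_floor x \<le> dyadic_floor y"
  by (auto simp: dyadic_floor_def intro!: floor_mono)

lemma dyadic_floor_gap:
  assumes "dyadic_floor x < dyadic_floor y" shows "2 * dyadic_floor x \<le> dyadic_floor y"
proof (cases "x \<le> 0")
  case True
  thus ?thesis by (simp add: dyadic_floor_def)
next
  case False
  hence y: "\<not> y \<le> 0" using assms by (auto simp: dyadic_floor_def split: if_splits)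
  have "\<lfloor>log 2 x\<rfloor> < \<lfloor>log 2 y\<rfloor>" using assms False y by (simp add: dyadic_floor_def)
  hence "1 + real_of_int \<lfloor>log 2 x\<rfloor> \<le> real_of_int \<lfloor>log 2 y\<rfloor>" by linarith
  hence "2 powr (1 + real_of_int \<lfloor>log 2 x\<rfloor>) \<le> 2 powr real_of_int \<lfloor>log 2 y\<rfloor>"
    by (intro powr_mono) auto
  thus ?thesis using False y by (simp add: dyadic_floor_def powr_add)
qed

text \<open>Numbers that at least double from one to the next form a geometric series, dominated by the
  largest.\<close>

lemma sum_geometric_bound:
  fixes V :: "real set"
  assumes "finite V" "0 < s" "\<And>v. v \<in> V \<Longrightarrow> 0 \<le> v" "\<And>v. v \<in> V \<Longrightarrow> v \<le> B"
    and "\<And>v v'. v \<in> V \<Longrightarrow> v' \<in> V \<Longrightarrow> v < v' \<Longrightarrow> 2 * v \<le> v'"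
  shows "(\<Sum>v\<in>V. v powr s) \<le> B powr s / (1 - 2 powr (-s))"
  using assms
proof (induction V arbitrary: B rule: finite_linorder_max_induct)
  case empty
  have "2 powr (-s) < 2 powr 0" using \<open>0 < s\<close> by (intro powr_less_mono) auto
  thus ?case by simp
next
  case (insert b V)
  have c: "0 < 1 - 2 powr (-s)"
    using powr_less_mono[of "-s" 0 2] \<open>0 < s\<close> by simp
  have b: "0 \<le> b" "b \<le> B" using insert.prems by auto
  have "(\<Sum>v\<in>V. v powr s) \<le> (b / 2) powr s / (1 - 2 powr (-s))"
  proof (rule insert.IH)
    fix v assume v: "v \<in> V"
    hence "v < b" using insert.hyps by blast
    hence "2 * v \<le> b" using insert.prems(4) v by blast
    thus "v \<le> b / 2" by simp
  qed (use insert.prems in auto)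
  also have "(b / 2) powr s = b powr s * 2 powr (-s)"
    using b by (subst powr_divide) (auto simp: powr_minus_divide)
  finally have "(\<Sum>v\<in>insert b V. v powr s) \<le> b powr s + b powr s * 2 powr (-s) / (1 - 2 powr (-s))"
    using insert.hyps by (subst sum.insert) auto
  also have "\<dots> = b powr s * (1 + 2 powr (-s) / (1 - 2 powr (-s)))"
    by (simp only: distrib_left mult_1_right times_divide_eq_right)
  also have "1 + 2 powr (-s) / (1 - 2 powr (-s)) = 1 / (1 - 2 powr (-s))"
  proof -
    have "1 - 2 powr (-s) \<noteq> 0" using c by linarith
    thus ?thesis by (simp add: add_divide_eq_if_simps del: powr_eq_one_iff)
  qed
  also have "b powr s * (1 / (1 - 2 powr (-s))) = b powr s / (1 - 2 powr (-s))"
    by (simp only: times_divide_eq_right mult_1_right)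
  also have "\<dots> \<le> B powr s / (1 - 2 powr (-s))"
    using b c insert.prems by (intro divide_right_mono powr_mono2) auto
  finally show ?case .
qed

text \<open>A height increases towards smaller elements, and at least doubles whenever it changes. The
  stopping elements are those at which it has just changed. Each \<open>Q\<close> lies below exactly one stopping
  element of the same height, \<open>top_of D w Q\<close>.\<close>

definition stops :: "'a :: order set \<Rightarrow> ('a \<Rightarrow> real) \<Rightarrow> 'a set" where
  "stops D w = {F\<in>D. \<forall>Q\<in>D. F < Q \<longrightarrow> w Q \<noteq> w F}"

definition top_of :: "'a :: order set \<Rightarrow> ('a \<Rightarrow> real) \<Rightarrow> 'a \<Rightarrow> 'a" where
  "top_of D w Q = (THE F. F \<in> stops D w \<and> Q \<le> F \<and> w F = w Q)"

definition height :: "'a :: order set \<Rightarrow> ('a \<Rightarrow> real) \<Rightarrow> bool" where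
  "height D w \<longleftrightarrow> (\<forall>Q\<in>D. 0 \<le> w Q) \<and> (\<forall>q\<in>D. \<forall>Q\<in>D. q \<le> Q \<longrightarrow> w Q \<le> w q) \<and>
     (\<forall>Q\<in>D. \<forall>Q'\<in>D. w Q < w Q' \<longrightarrow> 2 * w Q \<le> w Q')"

lemma height_dyadic_floor:
  assumes "\<And>q Q. q \<in> D \<Longrightarrow> Q \<in> D \<Longrightarrow> q \<le> Q \<Longrightarrow> X Q \<le> X q"
  shows "height D (\<lambda>Q. dyadic_floor (X Q))"
  unfolding height_def
  by (auto intro: dyadic_floor_nonneg dyadic_floor_mono dyadic_floor_gap assms)

lemma stops_subset: "stops D w \<subseteq> D"
  by (auto simp: stops_def)

context finite_forest
begin

lemma finite_upset: "finite (upset D q)"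
  using finite_D by (simp add: upset_def)

lemma finite_stops: "finite (stops D w)"
  using finite_D stops_subset finite_subset by blast

text \<open>The members of \<open>S\<close> above \<open>q\<close> form a chain; \<open>Q0\<close> is its least element.\<close>

lemma chain_minimum:
  assumes "S \<subseteq> D" "q \<in> D" "Q \<in> S" "q \<le> Q"
  obtains Q0 where "Q0 \<in> S" "q \<le> Q0" "{Q\<in>S. q \<le> Q} \<subseteq> upset D Q0"
proof -
  have "finite {Q\<in>S. q \<le> Q}" using finite_subset[OF assms(1) finite_D] by simp
  moreover have "{Q\<in>S. q \<le> Q} \<noteq> {}" using assms by auto
  ultimately obtain Q0 where Q0: "Q0 \<in> {Q\<in>S. q \<le> Q}"
    "\<And>Q. Q \<in> {Q\<in>S. q \<le> Q} \<Longrightarrow> Q \<le> Q0 \<Longrightarrow> Q0 = Q"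
    using finite_has_minimal[of "{Q\<in>S. q \<le> Q}"] by blast
  hence "Q0 \<le> Q" if "Q \<in> {Q\<in>S. q \<le> Q}" for Q
    using comparable[of q Q0 Q] that assms by auto
  thus ?thesis using that Q0(1) assms by (auto simp: upset_def)
qed

lemma top_of_unique:
  assumes w: "height D w" and Q: "Q \<in> D" and F: "F \<in> stops D w" "Q \<le> F" "w F = w Q"
  shows "top_of D w Q = F"
  unfolding top_of_def
proof (rule the_equality)
  fix F' assume F': "F' \<in> stops D w \<and> Q \<le> F' \<and> w F' = w Q"
  have "\<not> F < F'" "\<not> F' < F" using F F' by (auto simp: stops_def)
  moreover have "F \<le> F' \<or> F' \<le> F"
    using F F' Q stops_subset by (intro comparable[of Q]) auto
  ultimately show "F' = F" by auto
qed (use F in auto)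

lemma top_of:
  assumes w: "height D w" and Q: "Q \<in> D"
  shows "top_of D w Q \<in> stops D w" "Q \<le> top_of D w Q" "w (top_of D w Q) = w Q"
proof -
  define S where "S = {Q'\<in>D. Q \<le> Q' \<and> w Q' = w Q}"
  have "finite S" "S \<noteq> {}" using finite_D Q by (auto simp: S_def)
  from finite_has_maximal[OF this] obtain F
    where F: "F \<in> S" "\<And>Q'. Q' \<in> S \<Longrightarrow> F \<le> Q' \<Longrightarrow> F = Q'" by blast
  have "F \<in> stops D w"
    unfolding stops_def
  proof (intro CollectI conjI ballI impI notI)
    fix Q' assume "Q' \<in> D" "F < Q'" "w Q' = w F"
    moreover from this have "Q \<le> Q'" "w Q' = w Q" "F \<le> Q'" using F(1) by (auto simp: S_def)
    ultimately have "F = Q'" using F(2) by (simp add: S_def)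
    thus False using \<open>F < Q'\<close> by simp
  qed (use F in \<open>simp add: S_def\<close>)
  hence "top_of D w Q = F" using F by (intro top_of_unique w Q) (auto simp: S_def)
  thus "top_of D w Q \<in> stops D w" "Q \<le> top_of D w Q" "w (top_of D w Q) = w Q"
    using F \<open>F \<in> stops D w\<close> by (auto simp: S_def)
qed

text \<open>Heights are monotone, so all elements between \<open>Q\<close> and its top have the same height. This makes
  the parallel use of two heights work: if the tops \<open>F\<close>, \<open>G\<close> of \<open>Q\<close> for the two of them satisfy
  \<open>G \<le> F\<close>, then \<open>F\<close> can be recovered from \<open>G\<close>.\<close>

lemma top_of_between:
  assumes w: "height D w" and Q: "Q \<in> D" "Q' \<in> D" "Q \<le> Q'" "Q' \<le> top_of D w Q"
  shows "top_of D w Q' = top_of D w Q"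
proof (rule top_of_unique[OF w Q(2)])
  note t = top_of[OF w Q(1)]
  show "top_of D w Q \<in> stops D w" "Q' \<le> top_of D w Q" using t Q by auto
  have "w (top_of D w Q) \<le> w Q'" "w Q' \<le> w Q"
    using w Q t stops_subset unfolding height_def by blast+
  thus "w (top_of D w Q) = w Q'" using t by simp
qed

text \<open>Stopping elements above \<open>q\<close> have distinct heights, hence heights in geometric progression.\<close>

lemma sum_stops_above:
  assumes w: "height D w" and q: "q \<in> D" and s: "0 < s"
  shows "(\<Sum>F\<in>{F\<in>stops D w. q \<le> F}. w F powr s) \<le> w q powr s / (1 - 2 powr (-s))"
proof -
  have inj: "inj_on w {F\<in>stops D w. q \<le> F}"
  proof (rule inj_onI)
    fix F F' assume F: "F \<in> {F\<in>stops D w. q \<le> F}" "F' \<in> {F\<in>stops D w. q \<le> F}" "w F = w F'"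
    have "\<not> F < F'" "\<not> F' < F" using F by (auto simp: stops_def)
    moreover have "F \<le> F' \<or> F' \<le> F" using F q by (intro comparable[of q]) (auto simp: stops_def)
    ultimately show "F = F'" by auto
  qed
  have "(\<Sum>F\<in>{F\<in>stops D w. q \<le> F}. w F powr s) = (\<Sum>v\<in>w ` {F\<in>stops D w. q \<le> F}. v powr s)"
    by (simp add: sum.reindex[OF inj])
  also have "\<dots> \<le> w q powr s / (1 - 2 powr (-s))"
  proof (rule sum_geometric_bound)
    have w': "0 \<le> w Q" "q \<le> Q \<Longrightarrow> w Q \<le> w q" "\<And>Q'. Q' \<in> D \<Longrightarrow> w Q < w Q' \<Longrightarrow> 2 * w Q \<le> w Q'"
      if "Q \<in> D" for Q using w q that by (auto simp: height_def)
    fix v assume "v \<in> w ` {F\<in>stops D w. q \<le> F}"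
    then obtain F where F: "F \<in> D" "q \<le> F" "v = w F" using stops_subset by blast
    show "0 \<le> v" "v \<le> w q" using w' F by auto
    fix v' assume "v' \<in> w ` {F\<in>stops D w. q \<le> F}" "v < v'"
    then obtain F' where "F' \<in> D" "v' = w F'" using stops_subset by blast
    thus "2 * v \<le> v'" using w'(3)[OF F(1)] F(3) \<open>v < v'\<close> by simp
  qed (use finite_stops s in auto)
  finally show ?thesis .
qed

text \<open>One factor \<open>w F\<close> turns \<open>mass D m F\<close> into an integral of \<open>f\<close>. After exchanging sum and integral, the
  remaining powers \<open>p - 1\<close> form a geometric series at every atom, dominated by its largest term.
  Hoelder's inequality bounds the result by the norm of \<open>f\<close> times a power of the left-hand side, which
  is absorbed. The ratio \<open>2 powr (p - 1)\<close> of the series tends to \<open>1\<close> as \<open>p\<close> does; this is the origin of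
  the factor \<open>p'\<close>.\<close>

lemma Carleson_embedding:
  fixes p p' :: real
  assumes p: "1 < p" "1 / p + 1 / p' = 1" and w: "height D w"
    and f: "\<And>q. q \<in> D \<Longrightarrow> 0 \<le> f q" and m: "\<And>q. q \<in> D \<Longrightarrow> 0 \<le> m q"
    and avg: "\<And>F. F \<in> stops D w \<Longrightarrow> w F * mass D m F \<le> mass D (\<lambda>q. f q * m q) F"
  shows "(\<Sum>F\<in>stops D w. w F powr p * mass D m F) powr (1 / p)
           \<le> 2 * p' * (\<Sum>q\<in>D. f q powr p * m q) powr (1 / p)"
proof -
  define T where "T = (\<Sum>F\<in>stops D w. w F powr p * mass D m F)"
  define c where "c = 1 / (1 - 2 powr (-(p - 1)))"
  define N where "N = (\<Sum>q\<in>D. f q powr p * m q) powr (1 / p)"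
  define W where "W = (\<Sum>q\<in>D. (w q powr (p - 1)) powr p' * m q)"
  have w0: "0 \<le> w Q" if "Q \<in> D" for Q using w that by (simp add: height_def)
  have T0: "0 \<le> T" unfolding T_def using m by (auto intro!: sum_nonneg mult_nonneg_nonneg mass_nonneg)
  have p': "p' > 1" "p' = p / (p - 1)" using conjugate_gt_1[OF p] by auto
  have c: "0 \<le> c" "c \<le> 2 * p'"
  proof -
    \<comment> \<open>The estimate \<open>2 powr (p - 1) \<ge> 1 + (p - 1) / 2\<close> bounds the sum \<open>c\<close> of the geometric series.\<close>
    have "(p - 1) * ln 2 \<ge> (p - 1) * (1 / 2)"
      using ln2_ge_two_thirds p by (intro mult_left_mono) auto
    moreover have "exp ((p - 1) * ln 2) \<ge> 1 + (p - 1) * ln 2" by (rule exp_ge_add_one_self)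
    ultimately have e: "2 powr (p - 1) \<ge> (p + 1) / 2" by (simp add: powr_def field_simps)
    have "c = 2 powr (p - 1) / (2 powr (p - 1) - 1)"
      using e p unfolding c_def powr_minus by (simp add: field_simps)
    also have "\<dots> = 1 + 1 / (2 powr (p - 1) - 1)" using e p by (simp add: field_simps)
    also have "\<dots> \<le> 1 + 1 / ((p - 1) / 2)"
      using e p by (intro add_left_mono divide_left_mono mult_pos_pos) (auto simp: field_simps)
    also have "\<dots> = (p + 1) / (p - 1)" using p by (simp add: field_simps)
    also have "\<dots> \<le> 2 * p'" using p by (simp add: p'(2) divide_right_mono)
    finally show "c \<le> 2 * p'" .
    show "0 \<le> c" using powr_less_mono[of "-(p - 1)" 0 2] p by (simp add: c_def)
  qed
  have split: "w F powr p = w F powr (p - 1) * w F" if "F \<in> stops D w" for F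
    using w0[of F] that stops_subset[of D w] by (cases "w F = 0") (auto simp: powr_diff)
  have "T \<le> (\<Sum>F\<in>stops D w. w F powr (p - 1) * mass D (\<lambda>q. f q * m q) F)"
    unfolding T_def
  proof (rule sum_mono)
    fix F assume F: "F \<in> stops D w"
    have "w F powr (p - 1) * (w F * mass D m F) \<le> w F powr (p - 1) * mass D (\<lambda>q. f q * m q) F"
      by (intro mult_left_mono avg F) simp
    thus "w F powr p * mass D m F \<le> w F powr (p - 1) * mass D (\<lambda>q. f q * m q) F"
      by (simp add: split[OF F] mult.assoc)
  qed
  also have "\<dots> = (\<Sum>q\<in>D. (\<Sum>F\<in>{F\<in>stops D w. q \<le> F}. w F powr (p - 1)) * (f q * m q))"
    by (intro sum_mass_swap finite_D stops_subset)
  also have "\<dots> \<le> (\<Sum>q\<in>D. (c * w q powr (p - 1)) * (f q * m q))"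
    using sum_stops_above[OF w, where s = "p - 1"] p f m
    by (intro sum_mono mult_right_mono) (auto simp: c_def)
  also have "\<dots> = c * (\<Sum>q\<in>D. f q * w q powr (p - 1) * m q)"
    by (simp add: sum_distrib_left mult_ac)
  also have "\<dots> \<le> c * ((\<Sum>q\<in>D. f q powr p * m q) powr (1 / p)
        * (\<Sum>q\<in>D. (w q powr (p - 1)) powr p' * m q) powr (1 / p'))"
    using c f m by (intro mult_left_mono weighted_Holder p finite_D) auto
  finally have T: "T \<le> c * (N * W powr (1 / p'))" by (simp only: N_def W_def)
  \<comment> \<open>The height at an atom is attained at a stopping element above it.\<close>
  have "W \<le> T"
  proof -
    have "(w q powr (p - 1)) powr p' \<le> (\<Sum>F\<in>{F\<in>stops D w. q \<le> F}. w F powr p)" if "q \<in> D" for q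
    proof -
      have "(w q powr (p - 1)) powr p' = w (top_of D w q) powr p"
        using p top_of(3)[OF w that] by (simp add: powr_powr p'(2))
      also have "\<dots> \<le> (\<Sum>F\<in>{F\<in>stops D w. q \<le> F}. w F powr p)"
        using top_of[OF w that] finite_stops[of w] by (intro member_le_sum) auto
      finally show ?thesis .
    qed
    thus ?thesis unfolding T_def W_def sum_mass_swap[OF finite_D stops_subset]
      using m by (intro sum_mono mult_right_mono) auto
  qed
  hence "W powr (1 / p') \<le> T powr (1 / p')"
    using p'(1) m by (intro powr_mono2) (auto simp: W_def intro!: sum_nonneg)
  hence "c * (N * W powr (1 / p')) \<le> c * (N * T powr (1 / p'))"
    using c by (intro mult_left_mono) (auto simp: N_def)
  with T have "T \<le> (c * N) * T powr (1 / p')" by simp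
  hence "T powr (1 / p) \<le> c * N"
    using c by (intro le_of_le_mult_powr[OF p T0]) (auto simp: N_def)
  also have "\<dots> \<le> 2 * p' * N"
    using c by (intro mult_right_mono) (auto simp: N_def)
  finally show ?thesis by (simp add: T_def N_def)
qed

text \<open>Here the heights are dominated by \<open>g\<close> pointwise, not just on average, so the geometric series
  alone gives the bound.\<close>

lemma sum_stops_powr_le:
  fixes s :: real
  assumes s: "1 < s" and w: "height D w"
    and n: "\<And>q. q \<in> D \<Longrightarrow> 0 \<le> n q" and g: "\<And>q. q \<in> D \<Longrightarrow> w q \<le> g q"
  shows "(\<Sum>G\<in>stops D w. w G powr s * mass D n G) powr (1 / s)
           \<le> 2 * (\<Sum>q\<in>D. g q powr s * n q) powr (1 / s)"
proof -
  have w0: "0 \<le> w Q" if "Q \<in> D" for Q using w that by (simp add: height_def)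
  have "2 powr (-s) \<le> 2 powr (-1)" using s by (intro powr_mono) auto
  hence c: "0 < 1 - 2 powr (-s)" "1 / (1 - 2 powr (-s)) \<le> 2"
    by (auto simp: powr_minus_divide divide_le_eq)
  have "(\<Sum>G\<in>stops D w. w G powr s * mass D n G)
      = (\<Sum>q\<in>D. (\<Sum>F\<in>{F\<in>stops D w. q \<le> F}. w F powr s) * n q)"
    by (intro sum_mass_swap finite_D stops_subset)
  also have "\<dots> \<le> (\<Sum>q\<in>D. (2 * g q powr s) * n q)"
  proof (intro sum_mono mult_right_mono n)
    fix q assume q: "q \<in> D"
    have "(\<Sum>F\<in>{F\<in>stops D w. q \<le> F}. w F powr s) \<le> 1 / (1 - 2 powr (-s)) * w q powr s"
      using sum_stops_above[OF w q, of s] s by simp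
    also have "\<dots> \<le> 2 * g q powr s"
      using c s w0[OF q] g[OF q] by (intro mult_mono powr_mono2) simp_all
    finally show "(\<Sum>F\<in>{F\<in>stops D w. q \<le> F}. w F powr s) \<le> 2 * g q powr s" .
  qed
  also have "\<dots> = 2 * (\<Sum>q\<in>D. g q powr s * n q)"
    by (simp add: sum_distrib_left mult_ac)
  finally have "(\<Sum>G\<in>stops D w. w G powr s * mass D n G) powr (1 / s)
      \<le> (2 * (\<Sum>q\<in>D. g q powr s * n q)) powr (1 / s)"
    using s n by (intro powr_mono2) (auto intro!: sum_nonneg mult_nonneg_nonneg mass_nonneg)
  also have "\<dots> = 2 powr (1 / s) * (\<Sum>q\<in>D. g q powr s * n q) powr (1 / s)"
    using n by (intro powr_mult) 
  also have "\<dots> \<le> 2 powr 1 * (\<Sum>q\<in>D. g q powr s * n q) powr (1 / s)"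
    using s by (intro mult_right_mono powr_mono) auto
  finally show ?thesis by simp
qed

text \<open>Every stopping element \<open>G\<close> for \<open>w\<close> has a single top \<open>F\<close> for \<open>u\<close>. The functions \<open>h F\<close> with different \<open>F\<close>
  are thus controlled by disjoint sets of \<open>G\<close>, and the sum over \<open>F\<close> meets each \<open>G\<close> only once.\<close>

lemma sum_over_stop_pairs:
  fixes s :: real
  assumes s: "0 < s" and u: "height D u" and w: "height D w"
    and n: "\<And>q. q \<in> D \<Longrightarrow> 0 \<le> n q"
    and h: "\<And>F q. F \<in> stops D u \<Longrightarrow> q \<in> D \<Longrightarrow> 0 \<le> h F q"
      "\<And>F q. F \<in> stops D u \<Longrightarrow> q \<in> D \<Longrightarrow> h F q \<noteq> 0 \<Longrightarrow>
          \<exists>G\<in>stops D w. q \<le> G \<and> top_of D u G = F \<and> h F q \<le> 2 * w G"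
  shows "(\<Sum>F\<in>stops D u. \<Sum>q\<in>D. h F q powr s * n q)
           \<le> 2 powr s * (\<Sum>G\<in>stops D w. w G powr s * mass D n G)"
proof -
  define P where "P = (\<lambda>q F. {G\<in>{G\<in>stops D w. q \<le> G}. top_of D u G = F})"
  have finP: "finite (P q F)" for q F using finite_stops[of w] by (simp add: P_def)
  have pt: "h F q powr s \<le> (\<Sum>G\<in>P q F. 2 powr s * w G powr s)"
    if F: "F \<in> stops D u" and q: "q \<in> D" for F q
  proof (cases "h F q = 0")
    case False
    then obtain G where G: "G \<in> P q F" "h F q \<le> 2 * w G" using h(2)[OF F q] by (auto simp: P_def)
    have "0 \<le> w G" using G(1) w stops_subset[of D w] by (auto simp: P_def height_def)
    have "h F q powr s \<le> (2 * w G) powr s" using G h(1)[OF F q] s by (intro powr_mono2) auto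
    also have "\<dots> = 2 powr s * w G powr s" using \<open>0 \<le> w G\<close> by (simp add: powr_mult)
    also have "\<dots> \<le> (\<Sum>G\<in>P q F. 2 powr s * w G powr s)"
      using G finP by (intro member_le_sum) auto
    finally show ?thesis .
  qed (auto intro: sum_nonneg)
  have "(\<Sum>F\<in>stops D u. \<Sum>q\<in>D. h F q powr s * n q)
      \<le> (\<Sum>F\<in>stops D u. \<Sum>q\<in>D. (\<Sum>G\<in>P q F. 2 powr s * w G powr s) * n q)"
    using pt n by (intro sum_mono mult_right_mono) auto
  also have "\<dots> = (\<Sum>q\<in>D. (\<Sum>F\<in>stops D u. \<Sum>G\<in>P q F. 2 powr s * w G powr s) * n q)"
    by (subst sum.swap) (simp add: sum_distrib_right)
  also have "\<dots> = (\<Sum>q\<in>D. (\<Sum>G\<in>{G\<in>stops D w. q \<le> G}. 2 powr s * w G powr s) * n q)"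
  proof (intro sum.cong refl)
    fix q
    have "(\<Sum>F\<in>stops D u. \<Sum>G\<in>P q F. 2 powr s * w G powr s)
        = (\<Sum>G\<in>{G\<in>stops D w. q \<le> G}. 2 powr s * w G powr s)"
      unfolding P_def using finite_stops top_of(1)[OF u] stops_subset[of D w]
      by (intro sum.group) auto
    thus "(\<Sum>F\<in>stops D u. \<Sum>G\<in>P q F. 2 powr s * w G powr s) * n q
        = (\<Sum>G\<in>{G\<in>stops D w. q \<le> G}. 2 powr s * w G powr s) * n q" by simp
  qed
  also have "\<dots> = (\<Sum>G\<in>stops D w. 2 powr s * w G powr s * mass D n G)"
    by (intro sum_mass_swap[symmetric] finite_D stops_subset)
  finally show ?thesis by (simp add: sum_distrib_left mult_ac)
qed

end



section \<open>The two weight problem on a finite forest\<close>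

text \<open>The three inequalities, raised to the power \<open>p\<close> or \<open>p'\<close>. The weights \<open>m\<close>, \<open>n\<close> are the measures of
  the atoms with respect to \<open>\<sigma>\<close>, \<open>\<omega>\<close>, and \<open>k Q\<close> is \<open>\<lambda>\<^sub>Q\<close> divided by the volume of \<open>Q\<close>. The restriction to
  atoms with \<open>0 < n q\<close> in the dual testing condition expresses that an essential supremum is taken.\<close>

definition forest_two_weight where
  "forest_two_weight D p r k m n C \<longleftrightarrow>
     (\<forall>f. (\<forall>q\<in>D. 0 \<le> f q) \<longrightarrow>
        (\<Sum>q\<in>D. real_lr_norm r (upset D q) (\<lambda>Q. k Q * mass D (\<lambda>q. f q * m q) Q) powr p * n q)
          \<le> C powr p * (\<Sum>q\<in>D. f q powr p * m q))"

definition forest_testing where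
  "forest_testing D p r k m n C \<longleftrightarrow>
     (\<forall>R\<in>D. (\<Sum>q\<in>D. real_lr_norm r {Q\<in>upset D q. Q \<le> R} (\<lambda>Q. k Q * mass D m Q) powr p * n q)
        \<le> C powr p * mass D m R)"

definition forest_dual_testing where
  "forest_dual_testing D p' r' k m n C \<longleftrightarrow>
     (\<forall>R\<in>D. \<forall>a L. (\<forall>Q\<in>D. 0 \<le> a Q) \<longrightarrow> 0 \<le> L \<longrightarrow>
        (\<forall>q\<in>D. 0 < n q \<longrightarrow> real_lr_norm r' (upset D q) a \<le> L) \<longrightarrow>
        (\<Sum>q\<in>D. (\<Sum>Q\<in>{Q\<in>upset D q. Q \<le> R}. k Q * a Q * mass D n Q) powr p' * m q)
          \<le> (C * L) powr p' * mass D n R)"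

context finite_forest
begin

definition running_max :: "('a \<Rightarrow> real) \<Rightarrow> 'a \<Rightarrow> real" where
  "running_max x Q = Max (insert 0 (x ` upset D Q))"

lemma running_max_height: "height D (\<lambda>Q. dyadic_floor (running_max x Q))"
  unfolding running_max_def using finite_upset
  by (intro height_dyadic_floor Max_mono) (auto simp: upset_def)

lemma running_max_ge: "Q \<in> D \<Longrightarrow> x Q \<le> running_max x Q"
  unfolding running_max_def using finite_upset by (intro Max_ge) (auto simp: upset_def)

text \<open>If the maximum is attained at an element above \<open>F\<close>, then that element has the same height as \<open>F\<close>,
  which for a stopping element is possible only for \<open>F\<close> itself.\<close>

lemma dyadic_floor_running_max_le:
  assumes F: "F \<in> stops D (\<lambda>Q. dyadic_floor (running_max x Q))" and x: "0 \<le> x F"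
  shows "dyadic_floor (running_max x F) \<le> x F"
proof -
  have "running_max x F \<in> insert 0 (x ` upset D F)"
    unfolding running_max_def using finite_upset by (intro Max_in) auto
  then consider "running_max x F = 0" | Q where "Q \<in> D" "F \<le> Q" "running_max x F = x Q"
    by (auto simp: upset_def)
  thus ?thesis
  proof cases
    case 1
    thus ?thesis using x by (simp add: dyadic_floor_def)
  next
    case 2
    show ?thesis
    proof (cases "F = Q")
      case True
      have "0 \<le> running_max x F" unfolding running_max_def using finite_upset by (intro Max_ge) auto
      thus ?thesis using 2 True dyadic_floor_le by simp
    next
      case False
      hence lt: "F < Q" using 2 by simp
      have FD: "F \<in> D" using F by (simp add: stops_def)
      have "dyadic_floor (running_max x F) \<le> dyadic_floor (running_max x Q)"
        using 2 running_max_ge[of Q x] by (intro dyadic_floor_mono) simp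
      moreover have "dyadic_floor (running_max x Q) \<le> dyadic_floor (running_max x F)"
        using running_max_height[of x] 2 FD unfolding height_def by blast
      ultimately show ?thesis using F lt 2 by (auto simp: stops_def)
    qed
  qed
qed

text \<open>The members of \<open>S\<close> above \<open>q\<close> lie above the least one of them, \<open>Q0\<close>, so their norm is at most the
  quantity that defines the height of \<open>Q0\<close>.\<close>

lemma real_lr_norm_stopped_le:
  assumes r: "1 \<le> r" and S: "S \<subseteq> D" and a: "\<And>Q. Q \<in> D \<Longrightarrow> 0 \<le> a Q" and q: "q \<in> D"
    and ne: "real_lr_norm r {Q\<in>S. q \<le> Q} a \<noteq> 0"
  obtains Q0 where "Q0 \<in> S" "q \<le> Q0"
    "real_lr_norm r {Q\<in>S. q \<le> Q} a \<le> 2 * dyadic_floor (real_lr_norm r (upset D Q0) a)"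
proof -
  have "{Q\<in>S. q \<le> Q} \<noteq> {}" using ne by (metis real_lr_norm_empty)
  then obtain Q where "Q \<in> S" "q \<le> Q" by auto
  then obtain Q0 where Q0: "Q0 \<in> S" "q \<le> Q0" "{Q\<in>S. q \<le> Q} \<subseteq> upset D Q0"
    using chain_minimum[OF S q] by metis
  have "real_lr_norm r {Q\<in>S. q \<le> Q} a \<le> real_lr_norm r (upset D Q0) a"
    using r finite_upset Q0(3) a S by (intro real_lr_norm_mono) auto
  also have "\<dots> \<le> 2 * dyadic_floor (real_lr_norm r (upset D Q0) a)" by (rule le_2_dyadic_floor)
  finally show ?thesis using that Q0 by blast
qed

text \<open>The parallel stopping argument. The sum over \<open>Q\<close> is split into \<open>S1\<close>, where the top for \<open>w\<close> lies
  below the top \<open>F\<close> for \<open>u\<close>, and the rest \<open>S2\<close>, where the top for \<open>u\<close> lies below the top \<open>G\<close> for \<open>w\<close>. On \<open>S1\<close>,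
  the sum is grouped by \<open>F\<close>: the average of \<open>f\<close> is replaced by \<open>2 * u F\<close>, what remains is the image of
  the constant function, to which the testing condition on \<open>F\<close> applies, and the coefficients
  belonging to \<open>F\<close> are estimated by the heights of the tops for \<open>w\<close>. On \<open>S2\<close>, grouped by \<open>G\<close>, the
  roles are exchanged.\<close>

lemma bilinear_bound:
  fixes p p' :: real and r r' :: ennreal
  assumes p: "1 < p" "1 / p + 1 / p' = 1" and r: "1 \<le> r" "inverse r + inverse r' = 1"
    and m: "\<And>q. q \<in> D \<Longrightarrow> 0 \<le> m q" and n: "\<And>q. q \<in> D \<Longrightarrow> 0 \<le> n q"
    and k: "\<And>q. q \<in> D \<Longrightarrow> 0 \<le> k q"
    and f: "\<And>q. q \<in> D \<Longrightarrow> 0 \<le> f q" and a: "\<And>q. q \<in> D \<Longrightarrow> 0 \<le> a q"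
    and C: "0 \<le> C" "forest_testing D p r k m n C"
    and Cs: "0 \<le> Cs" "forest_dual_testing D p' r' k m n Cs"
  shows "(\<Sum>Q\<in>D. k Q * mass D (\<lambda>q. f q * m q) Q * a Q * mass D n Q)
    \<le> 16 * p' * (C + Cs) * (\<Sum>q\<in>D. f q powr p * m q) powr (1 / p)
        * (\<Sum>q\<in>D. real_lr_norm r' (upset D q) a powr p' * n q) powr (1 / p')"
proof -
  define x where "x = (\<lambda>Q. mass D (\<lambda>q. f q * m q) Q / mass D m Q)"
  define u where "u = (\<lambda>Q. dyadic_floor (running_max x Q))"
  define w where "w = (\<lambda>Q. dyadic_floor (real_lr_norm r' (upset D Q) a))"
  define Nf where "Nf = (\<Sum>q\<in>D. f q powr p * m q) powr (1 / p)"
  define Ng where "Ng = (\<Sum>q\<in>D. real_lr_norm r' (upset D q) a powr p' * n q) powr (1 / p')"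
  define Uf where "Uf = (\<Sum>F\<in>stops D u. u F powr p * mass D m F)"
  define Wg where "Wg = (\<Sum>G\<in>stops D w. w G powr p' * mass D n G)"
  define tm where "tm = (\<lambda>Q. k Q * mass D (\<lambda>q. f q * m q) Q * a Q * mass D n Q)"
  have p': "1 < p'" using conjugate_gt_1[OF p] by simp
  have pc: "1 < p'" "1 / p' + 1 / p = 1" using p p' by auto
  have r': "1 \<le> r'" using r by (cases rule: conjugate_exponents_cases) (auto simp: ennreal_ge_1)
  have M0: "0 \<le> mass D m Q" and N0: "0 \<le> mass D n Q" and f0: "0 \<le> mass D (\<lambda>q. f q * m q) Q" for Q
    using m n f by (auto intro!: mass_nonneg)
  have x0: "0 \<le> x Q" for Q using M0 f0 by (simp add: x_def)
  have u: "height D u" unfolding u_def by (rule running_max_height)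
  have w: "height D w"
    unfolding w_def using r' finite_upset a
    by (intro height_dyadic_floor real_lr_norm_mono) (auto simp: upset_def)
  have u0: "0 \<le> u Q" and w0: "0 \<le> w Q" for Q by (simp_all add: u_def w_def dyadic_floor_nonneg)
  \<comment> \<open>If the mass of \<open>Q\<close> vanishes, so does that of \<open>f\<close>, in accordance with \<open>x Q = 0\<close>.\<close>
  have avg: "mass D (\<lambda>q. f q * m q) Q = x Q * mass D m Q" if "Q \<in> D" for Q
  proof (cases "mass D m Q = 0")
    case True
    hence "m q = 0" if "q \<in> D" "q \<le> Q" for q
      using that m finite_D True sum_nonneg_eq_0_iff[of "{q\<in>D. q \<le> Q}" m]
      by (auto simp: mass_def)
    thus ?thesis using True by (simp add: mass_def)
  qed (simp add: x_def)
  have xu: "x Q \<le> 2 * u Q" if "Q \<in> D" for Q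
    using running_max_ge[OF that, of x] le_2_dyadic_floor[of "running_max x Q"] by (simp add: u_def)
  have fu: "mass D (\<lambda>q. f q * m q) Q \<le> 2 * u Q * mass D m Q" if "Q \<in> D" for Q
    unfolding avg[OF that] using xu[OF that] M0 by (intro mult_right_mono) auto
  have Uf0: "0 \<le> Uf" unfolding Uf_def using M0 by (auto intro!: sum_nonneg)
  have Wg0: "0 \<le> Wg" unfolding Wg_def using N0 by (auto intro!: sum_nonneg)
  have Uf: "Uf powr (1 / p) \<le> 2 * p' * Nf"
    unfolding Uf_def Nf_def
  proof (rule Carleson_embedding[OF p u f m])
    fix F assume F: "F \<in> stops D u"
    hence "u F \<le> x F" unfolding u_def using x0 by (intro dyadic_floor_running_max_le) auto
    thus "u F * mass D m F \<le> mass D (\<lambda>q. f q * m q) F"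
      using F stops_subset[of D u] M0 by (subst avg) (auto intro: mult_right_mono)
  qed auto
  have Wg: "Wg powr (1 / p') \<le> 2 * Ng"
    unfolding Wg_def Ng_def
    by (intro sum_stops_powr_le p' w n) (auto simp: w_def intro!: dyadic_floor_le real_lr_norm_nonneg finite_upset)
  have UW: "(2 powr p * Uf) powr (1 / p) \<le> 4 * p' * Nf" "(2 powr p' * Wg) powr (1 / p') \<le> 4 * Ng"
  proof -
    have "(2 powr p * Uf) powr (1 / p) = 2 * Uf powr (1 / p)"
      "(2 powr p' * Wg) powr (1 / p') = 2 * Wg powr (1 / p')"
      using Uf0 Wg0 p p' by (simp_all add: powr_mult powr_powr)
    thus "(2 powr p * Uf) powr (1 / p) \<le> 4 * p' * Nf" "(2 powr p' * Wg) powr (1 / p') \<le> 4 * Ng"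
      using Uf Wg by linarith+
  qed
  have fin: "finite {Q\<in>S. P Q}" if "S \<subseteq> D" for S P
    using finite_subset[OF that finite_D] by simp

  \<comment> \<open>The coefficients belonging to \<open>F\<close> and containing \<open>q\<close> have norm \<open>h F q\<close>.\<close>
  define S1 where "S1 = {Q\<in>D. top_of D w Q \<le> top_of D u Q}"
  define S1F where "S1F = (\<lambda>F. {Q\<in>S1. top_of D u Q = F})"
  define h where "h = (\<lambda>F q. real_lr_norm r' {Q\<in>S1F F. q \<le> Q} a)"
  have S1F: "S1F F \<subseteq> D" for F by (auto simp: S1F_def S1_def)
  have h0: "0 \<le> h F q" for F q unfolding h_def using fin[OF S1F] by (intro real_lr_norm_nonneg) auto
  define HF where "HF = (\<lambda>F. \<Sum>q\<in>D. h F q powr p' * n q)"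
  have HF0: "0 \<le> HF F" for F unfolding HF_def using n by (auto intro!: sum_nonneg)
  have HF_sum: "(\<Sum>F\<in>stops D u. HF F) \<le> 2 powr p' * Wg"
    unfolding HF_def Wg_def
  proof (rule sum_over_stop_pairs[OF _ u w n h0])
    fix F q assume F: "F \<in> stops D u" and q: "q \<in> D" and "h F q \<noteq> 0"
    hence "real_lr_norm r' {Q\<in>S1F F. q \<le> Q} a \<noteq> 0" by (simp add: h_def)
    from real_lr_norm_stopped_le[OF r' S1F a q this] obtain Q0
      where Q0: "Q0 \<in> S1F F" "q \<le> Q0" "h F q \<le> 2 * w Q0"
      unfolding h_def w_def by blast
    have D0: "Q0 \<in> D" using Q0 S1F by auto
    note t = top_of[OF w D0]
    have "top_of D w Q0 \<le> top_of D u Q0" "top_of D u Q0 = F" using Q0 by (auto simp: S1F_def S1_def)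
    moreover from this have "top_of D u (top_of D w Q0) = F"
      using top_of_between[OF u D0, of "top_of D w Q0"] t stops_subset by blast
    ultimately show "\<exists>G\<in>stops D w. q \<le> G \<and> top_of D u G = F \<and> h F q \<le> 2 * w G"
      using Q0 t by (intro bexI[of _ "top_of D w Q0"]) auto
  qed (use p' in auto)
  have "(\<Sum>Q\<in>S1. tm Q) = (\<Sum>F\<in>stops D u. \<Sum>Q\<in>S1F F. tm Q)"
    unfolding S1F_def using fin[of D] top_of(1)[OF u] finite_stops
    by (intro sum.group[symmetric]) (auto simp: S1_def)
  also have "\<dots> \<le> (\<Sum>F\<in>stops D u. 2 * C * ((u F powr p * mass D m F) powr (1 / p) * HF F powr (1 / p')))"
  proof (rule sum_mono)
    fix F assume F: "F \<in> stops D u"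
    have FD: "F \<in> D" using F stops_subset by blast
    define K where "K = (\<lambda>q. real_lr_norm r {Q\<in>upset D q. Q \<le> F} (\<lambda>Q. k Q * mass D m Q))"
    have "(\<Sum>Q\<in>S1F F. tm Q) \<le> (\<Sum>Q\<in>S1F F. 2 * u F * (k Q * mass D m Q * a Q) * mass D n Q)"
    proof (rule sum_mono)
      fix Q assume Q: "Q \<in> S1F F"
      hence QD: "Q \<in> D" using S1F by auto
      have "u Q = u F" using Q top_of(3)[OF u QD] by (simp add: S1F_def)
      hence "mass D (\<lambda>q. f q * m q) Q \<le> 2 * u F * mass D m Q" using fu[OF QD] by simp
      hence "(k Q * a Q * mass D n Q) * mass D (\<lambda>q. f q * m q) Q
          \<le> (k Q * a Q * mass D n Q) * (2 * u F * mass D m Q)"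
        using k a N0 QD by (intro mult_left_mono) auto
      thus "tm Q \<le> 2 * u F * (k Q * mass D m Q * a Q) * mass D n Q"
        by (simp add: tm_def mult_ac)
    qed
    also have "\<dots> = (\<Sum>q\<in>D. (\<Sum>Q\<in>{Q\<in>S1F F. q \<le> Q}. 2 * u F * (k Q * mass D m Q * a Q)) * n q)"
      by (intro sum_mass_swap finite_D S1F)
    also have "\<dots> \<le> (\<Sum>q\<in>D. 2 * u F * (K q * h F q * n q))"
    proof (rule sum_mono)
      fix q assume q: "q \<in> D"
      have "(\<Sum>Q\<in>{Q\<in>S1F F. q \<le> Q}. k Q * mass D m Q * a Q)
          \<le> real_lr_norm r {Q\<in>S1F F. q \<le> Q} (\<lambda>Q. k Q * mass D m Q) * h F q"
        unfolding h_def using S1F[of F] fin[OF S1F] k a M0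
        by (intro real_lr_norm_Holder r) auto
      also have "\<dots> \<le> K q * h F q"
        unfolding K_def
      proof (intro mult_right_mono real_lr_norm_mono r h0)
        show "{Q \<in> S1F F. q \<le> Q} \<subseteq> {Q \<in> upset D q. Q \<le> F}"
          using S1F[of F] top_of(2)[OF u] by (auto simp: upset_def S1F_def)
      qed (use S1F[of F] k M0 finite_upset in auto)
      finally have "2 * u F * n q * (\<Sum>Q\<in>{Q\<in>S1F F. q \<le> Q}. k Q * mass D m Q * a Q)
          \<le> 2 * u F * n q * (K q * h F q)"
        using u0 n[OF q] by (intro mult_left_mono) auto
      thus "(\<Sum>Q\<in>{Q\<in>S1F F. q \<le> Q}. 2 * u F * (k Q * mass D m Q * a Q)) * n q
          \<le> 2 * u F * (K q * h F q * n q)"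
        by (simp add: sum_distrib_left mult_ac)
    qed
    also have "\<dots> = 2 * u F * (\<Sum>q\<in>D. K q * h F q * n q)" by (simp add: sum_distrib_left)
    also have "\<dots> \<le> 2 * u F * ((\<Sum>q\<in>D. K q powr p * n q) powr (1 / p) * HF F powr (1 / p'))"
      unfolding HF_def using u0 n h0 finite_upset
      by (intro mult_left_mono weighted_Holder p finite_D) (auto simp: K_def intro!: real_lr_norm_nonneg)
    also have "\<dots> \<le> 2 * u F * ((C powr p * mass D m F) powr (1 / p) * HF F powr (1 / p'))"
      using C(2) FD u0 n p unfolding forest_testing_def K_def
      by (intro mult_left_mono mult_right_mono powr_mono2) (auto intro!: sum_nonneg)
    also have "\<dots> = 2 * C * ((u F powr p * mass D m F) powr (1 / p) * HF F powr (1 / p'))"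
      using C(1) M0 u0 p by (simp add: powr_mult powr_powr)
    finally show "(\<Sum>Q\<in>S1F F. tm Q)
        \<le> 2 * C * ((u F powr p * mass D m F) powr (1 / p) * HF F powr (1 / p'))" .
  qed
  also have "\<dots> = 2 * C * (\<Sum>F\<in>stops D u.
      (u F powr p * mass D m F) powr (1 / p) * HF F powr (1 / p') * 1)"
    by (simp add: sum_distrib_left)
  also have "\<dots> \<le> 2 * C * ((\<Sum>F\<in>stops D u. ((u F powr p * mass D m F) powr (1 / p)) powr p * 1) powr (1 / p)
       * (\<Sum>F\<in>stops D u. (HF F powr (1 / p')) powr p' * 1) powr (1 / p'))"
    using C(1) by (intro mult_left_mono weighted_Holder p finite_stops) auto
  also have "\<dots> = 2 * C * (Uf powr (1 / p) * (\<Sum>F\<in>stops D u. HF F) powr (1 / p'))"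
    using p p' M0 HF0 by (simp add: powr_powr Uf_def)
  also have "\<dots> \<le> 2 * C * ((2 * p' * Nf) * (4 * Ng))"
  proof (intro mult_left_mono mult_mono Uf)
    have "(\<Sum>F\<in>stops D u. HF F) powr (1 / p') \<le> (2 powr p' * Wg) powr (1 / p')"
      using HF_sum HF0 p' by (intro powr_mono2) (auto intro: sum_nonneg)
    thus "(\<Sum>F\<in>stops D u. HF F) powr (1 / p') \<le> 4 * Ng" using UW by simp
  qed (use C(1) p' in \<open>auto simp: Nf_def Ng_def\<close>)
  finally have part1: "(\<Sum>Q\<in>S1. tm Q) \<le> 16 * p' * C * Nf * Ng" by (simp add: mult_ac)

  \<comment> \<open>The largest average of \<open>f\<close>, up to rounding, over the cubes belonging to \<open>G\<close> and containing \<open>q\<close> is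
    \<open>e G q\<close>.\<close>
  define S2 where "S2 = {Q\<in>D. \<not> top_of D w Q \<le> top_of D u Q}"
  define S2G where "S2G = (\<lambda>G. {Q\<in>S2. top_of D w Q = G})"
  define e where "e = (\<lambda>G q. real_lr_norm \<infinity> {Q\<in>S2G G. q \<le> Q} (\<lambda>Q. 2 * u Q))"
  have S2G: "S2G G \<subseteq> D" for G by (auto simp: S2G_def S2_def)
  have e0: "0 \<le> e G q" for G q unfolding e_def using fin[OF S2G] by (intro real_lr_norm_nonneg) auto
  define EG where "EG = (\<lambda>G. \<Sum>q\<in>D. e G q powr p * m q)"
  have EG0: "0 \<le> EG G" for G unfolding EG_def using m by (auto intro!: sum_nonneg)
  have EG_sum: "(\<Sum>G\<in>stops D w. EG G) \<le> 2 powr p * Uf"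
    unfolding EG_def Uf_def
  proof (rule sum_over_stop_pairs[OF _ w u m e0])
    fix G q assume G: "G \<in> stops D w" and q: "q \<in> D" and ne: "e G q \<noteq> 0"
    have "e G q \<in> insert 0 ((\<lambda>Q. 2 * u Q) ` {Q\<in>S2G G. q \<le> Q})"
      unfolding e_def real_lr_norm_def using fin[OF S2G, of G] by (simp only: if_True simp_thms) (intro Max_in, auto)
    then obtain Q where Q: "Q \<in> S2G G" "q \<le> Q" "e G q = 2 * u Q" using ne by auto
    have QD: "Q \<in> D" using Q S2G by auto
    note tu = top_of[OF u QD] and tw = top_of[OF w QD]
    have "top_of D u Q \<le> top_of D w Q \<or> top_of D w Q \<le> top_of D u Q"
      using comparable[OF QD _ _ tu(2) tw(2)] tu(1) tw(1) stops_subset by blast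
    hence "top_of D u Q \<le> top_of D w Q" "top_of D w Q = G"
      using Q by (auto simp: S2G_def S2_def)
    moreover from this have "top_of D w (top_of D u Q) = G"
      using top_of_between[OF w QD, of "top_of D u Q"] tu stops_subset by blast
    ultimately show "\<exists>F\<in>stops D u. q \<le> F \<and> top_of D w F = G \<and> e G q \<le> 2 * u F"
      using Q tu by (intro bexI[of _ "top_of D u Q"]) auto
  qed (use p in auto)
  have "(\<Sum>Q\<in>S2. tm Q) = (\<Sum>G\<in>stops D w. \<Sum>Q\<in>S2G G. tm Q)"
    unfolding S2G_def using fin[of D] top_of(1)[OF w] finite_stops
    by (intro sum.group[symmetric]) (auto simp: S2_def)
  also have "\<dots> \<le> (\<Sum>G\<in>stops D w. 2 * Cs * (EG G powr (1 / p) * (w G powr p' * mass D n G) powr (1 / p')))"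
  proof (rule sum_mono)
    fix G assume G: "G \<in> stops D w"
    have GD: "G \<in> D" using G stops_subset by blast
    define aG where "aG = (\<lambda>Q. if Q \<in> S2G G then a Q else 0)"
    define K where "K = (\<lambda>q. \<Sum>Q\<in>{Q\<in>upset D q. Q \<le> G}. k Q * aG Q * mass D n Q)"
    have aG0: "0 \<le> aG Q" if "Q \<in> D" for Q using a that by (simp add: aG_def)
    have K0: "0 \<le> K q" for q unfolding K_def using k aG0 N0 by (auto intro!: sum_nonneg simp: upset_def)
    \<comment> \<open>The sequence \<open>aG\<close> is admissible in the dual testing condition on \<open>G\<close> with \<open>L = 2 * w G\<close>.\<close>
    have "real_lr_norm r' (upset D q) aG \<le> 2 * w G" if q: "q \<in> D" for q
    proof -
      have "real_lr_norm r' (upset D q) aG = real_lr_norm r' (upset D q) (\<lambda>Q. if Q \<in> {Q\<in>S2G G. q \<le> Q} then a Q else 0)"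
        by (intro real_lr_norm_cong) (auto simp: aG_def upset_def)
      also have "\<dots> = real_lr_norm r' {Q\<in>S2G G. q \<le> Q} a"
        using finite_upset S2G[of G] by (intro real_lr_norm_zero_extension r') (auto simp: upset_def)
      finally have eq: "real_lr_norm r' (upset D q) aG = real_lr_norm r' {Q\<in>S2G G. q \<le> Q} a" .
      show ?thesis
      proof (cases "real_lr_norm r' {Q\<in>S2G G. q \<le> Q} a = 0")
        case False
        from real_lr_norm_stopped_le[OF r' S2G a q False] obtain Q0
          where Q0: "Q0 \<in> S2G G" "real_lr_norm r' {Q\<in>S2G G. q \<le> Q} a \<le> 2 * w Q0"
          unfolding w_def by blast
        have "w Q0 = w G" using Q0 top_of(3)[OF w, of Q0] S2G by (auto simp: S2G_def S2_def)
        thus ?thesis using Q0 eq by simp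
      qed (simp add: eq w0)
    qed
    hence test: "(\<Sum>q\<in>D. K q powr p' * m q) \<le> (Cs * (2 * w G)) powr p' * mass D n G"
      using Cs(2) GD aG0 w0 unfolding forest_dual_testing_def K_def by simp
    have "(\<Sum>Q\<in>S2G G. tm Q) \<le> (\<Sum>Q\<in>S2G G. 2 * u Q * (k Q * aG Q * mass D n Q) * mass D m Q)"
    proof (rule sum_mono)
      fix Q assume Q: "Q \<in> S2G G"
      hence QD: "Q \<in> D" using S2G by auto
      have "(k Q * a Q * mass D n Q) * mass D (\<lambda>q. f q * m q) Q
          \<le> (k Q * a Q * mass D n Q) * (2 * u Q * mass D m Q)"
        using k a N0 QD fu[OF QD] by (intro mult_left_mono) auto
      thus "tm Q \<le> 2 * u Q * (k Q * aG Q * mass D n Q) * mass D m Q"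
        using Q by (simp add: tm_def aG_def mult_ac)
    qed
    also have "\<dots> = (\<Sum>q\<in>D. (\<Sum>Q\<in>{Q\<in>S2G G. q \<le> Q}. 2 * u Q * (k Q * aG Q * mass D n Q)) * m q)"
      by (intro sum_mass_swap finite_D S2G)
    also have "\<dots> \<le> (\<Sum>q\<in>D. e G q * K q * m q)"
    proof (intro sum_mono mult_right_mono m)
      fix q assume q: "q \<in> D"
      have "(\<Sum>Q\<in>{Q\<in>S2G G. q \<le> Q}. 2 * u Q * (k Q * aG Q * mass D n Q))
          \<le> (\<Sum>Q\<in>{Q\<in>S2G G. q \<le> Q}. e G q * (k Q * aG Q * mass D n Q))"
      proof (intro sum_mono mult_right_mono)
        fix Q assume Q: "Q \<in> {Q\<in>S2G G. q \<le> Q}"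
        show "2 * u Q \<le> e G q"
          unfolding e_def real_lr_norm_def using fin[OF S2G, of G] Q
          by (simp only: if_True simp_thms) (intro Max_ge, auto)
        show "0 \<le> k Q * aG Q * mass D n Q" using Q S2G[of G] k aG0 N0 by auto
      qed
      also have "\<dots> = e G q * (\<Sum>Q\<in>{Q\<in>S2G G. q \<le> Q}. k Q * aG Q * mass D n Q)"
        by (simp add: sum_distrib_left)
      also have "\<dots> \<le> e G q * K q"
        unfolding K_def
      proof (intro mult_left_mono sum_mono2 e0)
        show "{Q \<in> S2G G. q \<le> Q} \<subseteq> {Q \<in> upset D q. Q \<le> G}"
          using S2G[of G] top_of(2)[OF w] by (auto simp: upset_def S2G_def)
      qed (use finite_D k aG0 N0 in \<open>auto simp: upset_def\<close>)
      finally show "(\<Sum>Q\<in>{Q\<in>S2G G. q \<le> Q}. 2 * u Q * (k Q * aG Q * mass D n Q)) \<le> e G q * K q" .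
    qed
    also have "\<dots> \<le> EG G powr (1 / p) * (\<Sum>q\<in>D. K q powr p' * m q) powr (1 / p')"
      unfolding EG_def by (intro weighted_Holder p finite_D e0 K0 m)
    also have "\<dots> \<le> EG G powr (1 / p) * ((Cs * (2 * w G)) powr p' * mass D n G) powr (1 / p')"
      using test m p' by (intro mult_left_mono powr_mono2) (auto intro!: sum_nonneg)
    also have "\<dots> = 2 * Cs * (EG G powr (1 / p) * (w G powr p' * mass D n G) powr (1 / p'))"
      using Cs(1) N0 w0 p' by (simp add: powr_mult powr_powr)
    finally show "(\<Sum>Q\<in>S2G G. tm Q)
        \<le> 2 * Cs * (EG G powr (1 / p) * (w G powr p' * mass D n G) powr (1 / p'))" .
  qed
  also have "\<dots> = 2 * Cs * (\<Sum>G\<in>stops D w.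
      EG G powr (1 / p) * (w G powr p' * mass D n G) powr (1 / p') * 1)"
    by (simp add: sum_distrib_left)
  also have "\<dots> \<le> 2 * Cs * ((\<Sum>G\<in>stops D w. (EG G powr (1 / p)) powr p * 1) powr (1 / p)
       * (\<Sum>G\<in>stops D w. ((w G powr p' * mass D n G) powr (1 / p')) powr p' * 1) powr (1 / p'))"
    using Cs(1) by (intro mult_left_mono weighted_Holder p finite_stops) auto
  also have "\<dots> = 2 * Cs * ((\<Sum>G\<in>stops D w. EG G) powr (1 / p) * Wg powr (1 / p'))"
    using p p' N0 EG0 by (simp add: powr_powr Wg_def)
  also have "\<dots> \<le> 2 * Cs * ((4 * p' * Nf) * (2 * Ng))"
  proof (intro mult_left_mono mult_mono Wg)
    have "(\<Sum>G\<in>stops D w. EG G) powr (1 / p) \<le> (2 powr p * Uf) powr (1 / p)"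
      using EG_sum EG0 p by (intro powr_mono2) (auto intro: sum_nonneg)
    thus "(\<Sum>G\<in>stops D w. EG G) powr (1 / p) \<le> 4 * p' * Nf" using UW by simp
  qed (use Cs(1) p' in \<open>auto simp: Nf_def Ng_def\<close>)
  finally have part2: "(\<Sum>Q\<in>S2. tm Q) \<le> 16 * p' * Cs * Nf * Ng" by (simp add: mult_ac)

  have "(\<Sum>Q\<in>D. tm Q) = (\<Sum>Q\<in>S1. tm Q) + (\<Sum>Q\<in>S2. tm Q)"
    using finite_D by (subst sum.union_disjoint[symmetric]) (auto simp: S1_def S2_def intro!: sum.cong)
  also have "\<dots> \<le> 16 * p' * (C + Cs) * Nf * Ng"
    using part1 part2 by (simp add: algebra_simps)
  finally show ?thesis by (simp add: tm_def Nf_def Ng_def)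
qed


text \<open>Duality: pairing the image of \<open>f\<close> with the dual element of the chain above each atom gives its
  norm \<open>T\<close>. Since the coefficients \<open>A\<close> belong to cubes, this pairing is the bilinear form. The norm of \<open>A\<close>
  is bounded by a power of \<open>T\<close>, which is absorbed.\<close>

theorem forest_two_weight_of_testing:
  fixes p p' :: real and r r' :: ennreal
  assumes p: "1 < p" "1 / p + 1 / p' = 1" and r: "1 \<le> r" "inverse r + inverse r' = 1"
    and m: "\<And>q. q \<in> D \<Longrightarrow> 0 \<le> m q" and n: "\<And>q. q \<in> D \<Longrightarrow> 0 \<le> n q"
    and k: "\<And>q. q \<in> D \<Longrightarrow> 0 \<le> k q"
    and C: "0 \<le> C" "forest_testing D p r k m n C"
    and Cs: "0 \<le> Cs" "forest_dual_testing D p' r' k m n Cs"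
  shows "forest_two_weight D p r k m n (stein_const p p' r r' * 20 * p * p' * (C + Cs))"
  unfolding forest_two_weight_def
proof (intro allI impI)
  fix f :: "'a \<Rightarrow> real" assume f: "\<forall>q\<in>D. 0 \<le> f q"
  define b where "b = (\<lambda>Q. k Q * mass D (\<lambda>q. f q * m q) Q)"
  define \<phi> where "\<phi> = (\<lambda>q. real_lr_norm r (upset D q) b)"
  define A where "A = (\<lambda>x. (real_lr_norm r (upset D x) b powr p - real_lr_norm r {y\<in>D. x < y} b powr p) / b x)"
  define T where "T = (\<Sum>q\<in>D. \<phi> q powr p * n q)"
  define Nf where "Nf = (\<Sum>q\<in>D. f q powr p * m q) powr (1 / p)"
  define S where "S = stein_const p p' r r'"
  have S0: "0 \<le> S" by (simp add: S_def stein_const_def)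
  have p': "1 < p'" "p' = p / (p - 1)" using conjugate_gt_1[OF p] by auto
  have b0: "0 \<le> b Q" if "Q \<in> D" for Q
    using that k f m by (auto simp: b_def intro!: mult_nonneg_nonneg mass_nonneg)
  have \<phi>0: "0 \<le> \<phi> q" for q unfolding \<phi>_def by (intro real_lr_norm_nonneg finite_upset)
  have T0: "0 \<le> T" unfolding T_def using n by (auto intro!: sum_nonneg)
  have A: "0 \<le> A q" "(\<Sum>Q\<in>upset D q. A Q * b Q) = \<phi> q powr p"
    "real_lr_norm r' (upset D q) A \<le> S * \<phi> q powr (p - 1)" if q: "q \<in> D" for q
  proof -
    define A' where "A' = (\<lambda>x. (real_lr_norm r {y\<in>upset D q. x \<le> y} b powr p
        - real_lr_norm r {y\<in>upset D q. x < y} b powr p) / b x)"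
    have "{y\<in>upset D q. x \<le> y} = upset D x" "{y\<in>upset D q. x < y} = {y\<in>D. x < y}"
      if "x \<in> upset D q" for x using that by (auto simp: upset_def)
    hence eq: "A' x = A x" if "x \<in> upset D q" for x using that by (simp add: A_def A'_def)
    have ch: "x \<le> y \<or> y \<le> x" if "x \<in> upset D q" "y \<in> upset D q" for x y
      using comparable[OF q] that by (auto simp: upset_def)
    have bb: "0 \<le> b x" if "x \<in> upset D q" for x using b0 that by (simp add: upset_def)
    have c: "0 \<le> A' x" if "x \<in> upset D q" for x
      unfolding A'_def by (rule chain_dual_element(1)[OF p r finite_upset]) (use ch bb that in auto)
    have c2: "(\<Sum>Q\<in>upset D q. A' Q * b Q) = real_lr_norm r (upset D q) b powr p"
      unfolding A'_def by (rule chain_dual_element(2)[OF p r finite_upset]) (use ch bb in auto)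
    have c3: "real_lr_norm r' (upset D q) A' \<le> S * real_lr_norm r (upset D q) b powr (p - 1)"
      unfolding A'_def S_def by (rule chain_dual_element(3)[OF p r finite_upset]) (use ch bb in auto)
    have qq: "q \<in> upset D q" using q by (simp add: upset_def)
    hence "0 \<le> A' q" by (rule c)
    thus "0 \<le> A q" using eq[OF qq] by simp
    have "(\<Sum>Q\<in>upset D q. A Q * b Q) = (\<Sum>Q\<in>upset D q. A' Q * b Q)" by (intro sum.cong) (auto simp: eq)
    thus "(\<Sum>Q\<in>upset D q. A Q * b Q) = \<phi> q powr p" using c2 by (simp add: \<phi>_def)
    have "real_lr_norm r' (upset D q) A = real_lr_norm r' (upset D q) A'" by (intro real_lr_norm_cong) (simp add: eq)
    thus "real_lr_norm r' (upset D q) A \<le> S * \<phi> q powr (p - 1)" using c3 by (simp add: \<phi>_def)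
  qed
  have "T = (\<Sum>q\<in>D. (\<Sum>Q\<in>{Q\<in>D. q \<le> Q}. A Q * b Q) * n q)"
    unfolding T_def using A(2) by (intro sum.cong) (auto simp: upset_def)
  also have "\<dots> = (\<Sum>Q\<in>D. A Q * b Q * mass D n Q)"
    by (intro sum_mass_swap[symmetric] finite_D) simp
  also have "\<dots> = (\<Sum>Q\<in>D. k Q * mass D (\<lambda>q. f q * m q) Q * A Q * mass D n Q)"
    by (intro sum.cong) (simp_all add: b_def mult_ac)
  also have "\<dots> \<le> 16 * p' * (C + Cs) * Nf * (\<Sum>q\<in>D. real_lr_norm r' (upset D q) A powr p' * n q) powr (1 / p')"
    unfolding Nf_def by (rule bilinear_bound[OF p r]) (use m n k f A(1) C Cs in auto)
  also have "\<dots> \<le> 16 * p' * (C + Cs) * Nf * (S * T powr (1 / p'))"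
  proof (intro mult_left_mono)
    have "(\<Sum>q\<in>D. real_lr_norm r' (upset D q) A powr p' * n q) \<le> (\<Sum>q\<in>D. S powr p' * (\<phi> q powr p * n q))"
    proof (rule sum_mono)
      fix q assume q: "q \<in> D"
      have "real_lr_norm r' (upset D q) A powr p' \<le> (S * \<phi> q powr (p - 1)) powr p'"
        using A(3)[OF q] p' finite_upset by (intro powr_mono2 real_lr_norm_nonneg) auto
      also have "\<dots> = S powr p' * \<phi> q powr p"
        using S0 p by (simp add: powr_mult powr_powr p'(2))
      finally show "real_lr_norm r' (upset D q) A powr p' * n q \<le> S powr p' * (\<phi> q powr p * n q)"
        using n[OF q] by (simp add: mult.assoc[symmetric] mult_right_mono)
    qed
    also have "\<dots> = S powr p' * T" by (simp add: T_def sum_distrib_left)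
    finally have "(\<Sum>q\<in>D. real_lr_norm r' (upset D q) A powr p' * n q) powr (1 / p') \<le> (S powr p' * T) powr (1 / p')"
      using p'(1) n by (intro powr_mono2) (auto intro!: sum_nonneg)
    also have "\<dots> = S * T powr (1 / p')"
      using S0 T0 p'(1) by (simp add: powr_mult powr_powr)
    finally show "(\<Sum>q\<in>D. real_lr_norm r' (upset D q) A powr p' * n q) powr (1 / p') \<le> S * T powr (1 / p')" .
  qed (use C(1) Cs(1) p'(1) in \<open>auto simp: Nf_def\<close>)
  finally have "T \<le> (S * 16 * p' * (C + Cs) * Nf) * T powr (1 / p')" by (simp add: mult_ac)
  hence "T powr (1 / p) \<le> S * 16 * p' * (C + Cs) * Nf"
    using S0 p'(1) C(1) Cs(1) by (intro le_of_le_mult_powr[OF p T0]) (auto simp: Nf_def)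
  also have "\<dots> \<le> S * 20 * p * p' * (C + Cs) * Nf"
  proof (intro mult_right_mono)
    show "S * 16 \<le> S * 20 * p" using S0 p mult_left_mono[of 16 "20 * p" S] by simp
  qed (use p'(1) C(1) Cs(1) in \<open>auto simp: Nf_def\<close>)
  finally have "(T powr (1 / p)) powr p \<le> (S * 20 * p * p' * (C + Cs) * Nf) powr p"
    using p by (intro powr_mono2) auto
  also have "\<dots> = (S * 20 * p * p' * (C + Cs)) powr p * Nf powr p" by (rule powr_mult)
  also have "Nf powr p = (\<Sum>q\<in>D. f q powr p * m q)"
    using m p by (simp add: Nf_def powr_powr sum_nonneg)
  also have "(T powr (1 / p)) powr p = T" using T0 p by (simp add: powr_powr)
  finally show "(\<Sum>q\<in>D. real_lr_norm r (upset D q) (\<lambda>Q. k Q * mass D (\<lambda>q. f q * m q) Q) powr p * n q)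
      \<le> (stein_const p p' r r' * 20 * p * p' * (C + Cs)) powr p * (\<Sum>q\<in>D. f q powr p * m q)"
    by (simp add: T_def \<phi>_def b_def S_def)
qed

text \<open>The indicator of \<open>R\<close> has the same averages as \<open>1\<close> over the cubes inside \<open>R\<close>.\<close>

lemma forest_testing_of_two_weight:
  assumes p: "1 < p" and r: "1 \<le> r"
    and m: "\<And>q. q \<in> D \<Longrightarrow> 0 \<le> m q" and n: "\<And>q. q \<in> D \<Longrightarrow> 0 \<le> n q"
    and k: "\<And>q. q \<in> D \<Longrightarrow> 0 \<le> k q" and two: "forest_two_weight D p r k m n C"
  shows "forest_testing D p r k m n C"
  unfolding forest_testing_def
proof (intro ballI)
  fix R assume R: "R \<in> D"
  define f where "f = (\<lambda>q. if q \<le> R then 1 else 0 :: real)"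
  have "(\<Sum>q\<in>D. real_lr_norm r {Q\<in>upset D q. Q \<le> R} (\<lambda>Q. k Q * mass D m Q) powr p * n q)
      \<le> (\<Sum>q\<in>D. real_lr_norm r (upset D q) (\<lambda>Q. k Q * mass D (\<lambda>q. f q * m q) Q) powr p * n q)"
  proof (intro sum_mono mult_right_mono n powr_mono2 real_lr_norm_mono r finite_upset)
    fix q Q assume Q: "Q \<in> {Q\<in>upset D q. Q \<le> R}"
    hence "mass D m Q = mass D (\<lambda>q. f q * m q) Q"
      unfolding mass_def by (intro sum.cong) (auto simp: f_def)
    thus "k Q * mass D m Q \<le> k Q * mass D (\<lambda>q. f q * m q) Q" by simp
    show "0 \<le> k Q * mass D m Q"
      using Q k m by (auto simp: upset_def intro!: mult_nonneg_nonneg mass_nonneg)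
  qed (use p finite_upset in \<open>auto intro!: real_lr_norm_nonneg\<close>)
  also have "\<dots> \<le> C powr p * (\<Sum>q\<in>D. f q powr p * m q)"
    using two unfolding forest_two_weight_def by (auto simp: f_def)
  also have "(\<Sum>q\<in>D. f q powr p * m q) = mass D m R"
    unfolding mass_def using finite_D by (intro sum.mono_neutral_cong_right) (auto simp: f_def)
  finally show "(\<Sum>q\<in>D. real_lr_norm r {Q\<in>upset D q. Q \<le> R} (\<lambda>Q. k Q * mass D m Q) powr p * n q)
      \<le> C powr p * mass D m R" .
qed

text \<open>Duality with the extremal function: the adjoint applied to \<open>a\<close> is \<open>H\<close>, and \<open>f = H powr (p' - 1)\<close> norms
  it. Moving the operator to \<open>f\<close> and applying Hoelder's inequality to the two pairings leaves a power
  of the norm of \<open>H\<close> on the right, which is absorbed.\<close>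

lemma forest_dual_testing_of_two_weight:
  fixes p p' :: real and r r' :: ennreal
  assumes p: "1 < p" "1 / p + 1 / p' = 1" and r: "1 \<le> r" "inverse r + inverse r' = 1"
    and m: "\<And>q. q \<in> D \<Longrightarrow> 0 \<le> m q" and n: "\<And>q. q \<in> D \<Longrightarrow> 0 \<le> n q"
    and k: "\<And>q. q \<in> D \<Longrightarrow> 0 \<le> k q"
    and C: "0 \<le> C" and two: "forest_two_weight D p r k m n C"
  shows "forest_dual_testing D p' r' k m n C"
  unfolding forest_dual_testing_def
proof (intro ballI allI impI)
  fix R a L
  assume R: "R \<in> D" and a: "\<forall>Q\<in>D. 0 \<le> a Q" and L: "0 \<le> L"
    and aL: "\<forall>q\<in>D. 0 < n q \<longrightarrow> real_lr_norm r' (upset D q) a \<le> L"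
  have p': "1 < p'" "p' = p / (p - 1)" using conjugate_gt_1[OF p] by auto
  have pc: "1 < p'" "1 / p' + 1 / p = 1" using p p' by auto
  define H where "H = (\<lambda>q. \<Sum>Q\<in>{Q\<in>upset D q. Q \<le> R}. k Q * a Q * mass D n Q)"
  define f where "f = (\<lambda>q. H q powr (p' - 1))"
  define b where "b = (\<lambda>Q. k Q * mass D (\<lambda>q. f q * m q) Q)"
  define \<phi> where "\<phi> = (\<lambda>q. real_lr_norm r (upset D q) b)"
  define e where "e = (\<lambda>q. if q \<le> R then 1 else 0 :: real)"
  define T where "T = (\<Sum>q\<in>D. H q powr p' * m q)"
  have N0: "0 \<le> mass D n Q" for Q using n by (auto intro: mass_nonneg)
  have H0: "0 \<le> H q" for q unfolding H_def using k a N0 by (auto intro!: sum_nonneg simp: upset_def)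
  have T0: "0 \<le> T" unfolding T_def using m by (auto intro!: sum_nonneg)
  have b0: "0 \<le> b Q" if "Q \<in> D" for Q
    using that k m by (auto simp: b_def f_def intro!: mult_nonneg_nonneg mass_nonneg)
  have \<phi>0: "0 \<le> \<phi> q" for q unfolding \<phi>_def by (intro real_lr_norm_nonneg finite_upset)
  have "T = (\<Sum>q\<in>D. (\<Sum>Q\<in>{Q\<in>{Q\<in>D. Q \<le> R}. q \<le> Q}. k Q * a Q * mass D n Q) * (f q * m q))"
  proof -
    have "H q powr p' = H q * f q" for q
      using H0[of q] p'(1) by (cases "H q = 0") (auto simp: f_def powr_diff)
    moreover have "{Q\<in>upset D q. Q \<le> R} = {Q\<in>{Q\<in>D. Q \<le> R}. q \<le> Q}" for q
      by (auto simp: upset_def)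
    ultimately show ?thesis unfolding T_def by (simp add: H_def mult.assoc)
  qed
  also have "\<dots> = (\<Sum>Q\<in>{Q\<in>D. Q \<le> R}. k Q * a Q * mass D n Q * mass D (\<lambda>q. f q * m q) Q)"
    by (intro sum_mass_swap[symmetric] finite_D) auto
  also have "\<dots> = (\<Sum>Q\<in>{Q\<in>D. Q \<le> R}. b Q * a Q * mass D n Q)"
    by (simp add: b_def mult_ac)
  also have "\<dots> = (\<Sum>q\<in>D. (\<Sum>Q\<in>{Q\<in>{Q\<in>D. Q \<le> R}. q \<le> Q}. b Q * a Q) * n q)"
    by (intro sum_mass_swap finite_D) auto
  also have "\<dots> \<le> (\<Sum>q\<in>D. L * (\<phi> q * e q * n q))"
  proof (rule sum_mono)
    fix q assume q: "q \<in> D"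
    consider "n q = 0" | "\<not> q \<le> R" | "0 < n q" "q \<le> R" using n[OF q] by force
    thus "(\<Sum>Q\<in>{Q\<in>{Q\<in>D. Q \<le> R}. q \<le> Q}. b Q * a Q) * n q \<le> L * (\<phi> q * e q * n q)"
    proof cases
      case 2
      hence none: "{Q\<in>{Q\<in>D. Q \<le> R}. q \<le> Q} = {}" by auto
      show ?thesis unfolding none using 2 by (simp add: e_def)
    next
      case 3
      have "(\<Sum>Q\<in>{Q\<in>{Q\<in>D. Q \<le> R}. q \<le> Q}. b Q * a Q) \<le> (\<Sum>Q\<in>upset D q. b Q * a Q)"
        using finite_upset b0 a by (intro sum_mono2) (auto simp: upset_def)
      also have "\<dots> \<le> \<phi> q * real_lr_norm r' (upset D q) a"
        unfolding \<phi>_def using b0 a by (intro real_lr_norm_Holder r finite_upset) (auto simp: upset_def)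
      also have "\<dots> \<le> \<phi> q * L" using aL q 3 \<phi>0 by (intro mult_left_mono) auto
      finally show ?thesis using 3 by (simp add: e_def mult_right_mono mult_ac)
    qed simp
  qed
  also have "\<dots> = L * (\<Sum>q\<in>D. \<phi> q * e q * n q)" by (simp add: sum_distrib_left)
  also have "\<dots> \<le> L * ((\<Sum>q\<in>D. \<phi> q powr p * n q) powr (1 / p)
      * (\<Sum>q\<in>D. e q powr p' * n q) powr (1 / p'))"
    using L \<phi>0 n by (intro mult_left_mono weighted_Holder p finite_D) (auto simp: e_def)
  also have "(\<Sum>q\<in>D. e q powr p' * n q) = mass D n R"
    unfolding mass_def using finite_D by (intro sum.mono_neutral_cong_right) (auto simp: e_def)
  also have "L * ((\<Sum>q\<in>D. \<phi> q powr p * n q) powr (1 / p) * mass D n R powr (1 / p'))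
      \<le> L * ((C powr p * T) powr (1 / p) * mass D n R powr (1 / p'))"
  proof (intro mult_left_mono mult_right_mono L powr_mono2)
    have "\<forall>q\<in>D. 0 \<le> f q" by (simp add: f_def)
    with two have "(\<Sum>q\<in>D. \<phi> q powr p * n q) \<le> C powr p * (\<Sum>q\<in>D. f q powr p * m q)"
      unfolding forest_two_weight_def \<phi>_def b_def by blast
    moreover have "(p' - 1) * p = p'" using p by (simp add: p'(2) field_simps)
    hence "f q powr p = H q powr p'" for q by (simp add: f_def powr_powr)
    ultimately show "(\<Sum>q\<in>D. \<phi> q powr p * n q) \<le> C powr p * T" by (simp add: T_def)
  qed (use p n in \<open>auto intro!: sum_nonneg\<close>)
  also have "\<dots> = (C * L * mass D n R powr (1 / p')) * T powr (1 / p)"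
    using C T0 p by (simp add: powr_mult powr_powr)
  finally have "T powr (1 / p') \<le> C * L * mass D n R powr (1 / p')"
    using C L by (intro le_of_le_mult_powr[OF pc T0]) auto
  hence "(T powr (1 / p')) powr p' \<le> (C * L * mass D n R powr (1 / p')) powr p'"
    using p'(1) by (intro powr_mono2) auto
  also have "\<dots> = (C * L) powr p' * mass D n R"
    using C L N0 p'(1) by (simp add: powr_mult powr_powr)
  also have "(T powr (1 / p')) powr p' = T" using T0 p'(1) by (simp add: powr_powr)
  finally show "(\<Sum>q\<in>D. (\<Sum>Q\<in>{Q\<in>upset D q. Q \<le> R}. k Q * a Q * mass D n Q) powr p' * m q)
      \<le> (C * L) powr p' * mass D n R"
    by (simp add: T_def H_def)
qed

end

section \<open>Exhaustion by finite families\<close>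

lemma epowr_ennreal: "0 \<le> x \<Longrightarrow> epowr (ennreal x) a = ennreal (x powr a)"
  by (simp add: epowr_def)

lemma epowr_0 [simp]: "epowr 0 a = 0"
  by (simp add: epowr_def)

lemma epowr_top [simp]: "epowr top a = top"
  by (simp add: epowr_def)

lemma epowr_mono: "0 \<le> a \<Longrightarrow> x \<le> y \<Longrightarrow> epowr x a \<le> epowr y a"
  by (cases x rule: ennreal_cases; cases y rule: ennreal_cases)
     (auto simp: epowr_ennreal top_unique intro!: ennreal_leI powr_mono2)

lemma epowr_epowr: "0 < a \<Longrightarrow> a * b = 1 \<Longrightarrow> epowr (epowr x a) b = x"
  by (cases x rule: ennreal_cases) (auto simp: epowr_ennreal powr_powr)

text \<open>Powers with exponents \<open>a\<close> and \<open>1 / a\<close> are inverse order isomorphisms, hence commute with suprema.\<close>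

lemma epowr_le_iff:
  assumes "0 < a" shows "epowr x a \<le> y \<longleftrightarrow> x \<le> epowr y (1 / a)"
proof
  assume "epowr x a \<le> y"
  hence "epowr (epowr x a) (1 / a) \<le> epowr y (1 / a)" using assms by (intro epowr_mono) auto
  thus "x \<le> epowr y (1 / a)" using assms by (simp add: epowr_epowr)
next
  assume "x \<le> epowr y (1 / a)"
  hence "epowr x a \<le> epowr (epowr y (1 / a)) a" using assms by (intro epowr_mono) auto
  thus "epowr x a \<le> y" using assms by (simp add: epowr_epowr)
qed

lemma epowr_SUP:
  assumes "0 < a" shows "epowr (SUP i\<in>I. f i) a = (SUP i\<in>I. epowr (f i) a)"
proof (rule antisym)
  show "epowr (SUP i\<in>I. f i) a \<le> (SUP i\<in>I. epowr (f i) a)"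
    unfolding epowr_le_iff[OF assms] SUP_le_iff
    unfolding epowr_le_iff[OF assms, symmetric] by (auto intro: SUP_upper)
  show "(SUP i\<in>I. epowr (f i) a) \<le> epowr (SUP i\<in>I. f i) a"
    using assms by (intro SUP_least epowr_mono SUP_upper) auto
qed

lemma epowr_mult: "0 < a \<Longrightarrow> epowr (x * y) a = epowr x a * epowr y a"
  by (cases x rule: ennreal_cases; cases y rule: ennreal_cases)
     (auto simp: epowr_ennreal ennreal_mult[symmetric] powr_mult ennreal_mult_top ennreal_top_mult
           ennreal_mult_eq_top_iff epowr_def)

lemma lr_norm_eq_SUP:
  assumes "1 \<le> r"
  shows "lr_norm r I a = (SUP F\<in>{F. finite F \<and> F \<subseteq> I}. lr_norm r F a)"
proof (cases "r = \<infinity>")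
  case True
  have "(SUP i\<in>I. ennreal \<bar>a i\<bar>) = (SUP F\<in>{F. finite F \<and> F \<subseteq> I}. SUP i\<in>F. ennreal \<bar>a i\<bar>)"
  proof (rule antisym)
    show "(SUP i\<in>I. ennreal \<bar>a i\<bar>) \<le> (SUP F\<in>{F. finite F \<and> F \<subseteq> I}. SUP i\<in>F. ennreal \<bar>a i\<bar>)"
      by (intro SUP_least SUP_upper2[of "{i}" for i]) auto
    show "(SUP F\<in>{F. finite F \<and> F \<subseteq> I}. SUP i\<in>F. ennreal \<bar>a i\<bar>) \<le> (SUP i\<in>I. ennreal \<bar>a i\<bar>)"
      by (intro SUP_least SUP_upper) auto
  qed
  thus ?thesis using True by (simp add: lr_norm_def)
next
  case False
  have "(\<Sum>\<^sub>\<infinity>i\<in>I. ennreal (\<bar>a i\<bar> powr enn2real r)) =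
      (SUP F\<in>{F. finite F \<and> F \<subseteq> I}. \<Sum>i\<in>F. ennreal (\<bar>a i\<bar> powr enn2real r))"
    by (rule nonneg_infsum_complete) simp
  also have "\<dots> = (SUP F\<in>{F. finite F \<and> F \<subseteq> I}. \<Sum>\<^sub>\<infinity>i\<in>F. ennreal (\<bar>a i\<bar> powr enn2real r))"
    by (intro SUP_cong) auto
  finally show ?thesis
    using False exponent_pos[OF assms False] by (simp add: lr_norm_def epowr_SUP)
qed

lemma lr_norm_subset_mono:
  assumes "1 \<le> r" "F \<subseteq> G" shows "lr_norm r F a \<le> lr_norm r G a"
  unfolding lr_norm_eq_SUP[OF assms(1), of F] lr_norm_eq_SUP[OF assms(1), of G]
  using assms(2) by (intro SUP_subset_mono) auto

text \<open>Monotone convergence along an exhaustion of the countable index set by finite subsets. The set \<open>F0\<close>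
  makes it possible to consider only families that contain a given cube.\<close>

lemma nn_integral_le_iff_finite:
  fixes \<Psi> :: "'i set \<Rightarrow> 'x \<Rightarrow> ennreal"
  assumes I: "countable I" and F0: "finite F0" "F0 \<subseteq> I"
    and sup: "\<And>x. \<Psi> I x = (SUP F\<in>{F. finite F \<and> F \<subseteq> I}. \<Psi> F x)"
    and mono: "\<And>F G x. F \<subseteq> G \<Longrightarrow> G \<subseteq> I \<Longrightarrow> \<Psi> F x \<le> \<Psi> G x"
    and meas: "\<And>F. finite F \<Longrightarrow> F \<subseteq> I \<Longrightarrow> \<Psi> F \<in> borel_measurable M"
  shows "(\<integral>\<^sup>+x. \<Psi> I x \<partial>M) \<le> B \<longleftrightarrow>
         (\<forall>F. finite F \<and> F0 \<subseteq> F \<and> F \<subseteq> I \<longrightarrow> (\<integral>\<^sup>+x. \<Psi> F x \<partial>M) \<le> B)"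
proof
  assume "(\<integral>\<^sup>+x. \<Psi> I x \<partial>M) \<le> B"
  moreover have "(\<integral>\<^sup>+x. \<Psi> F x \<partial>M) \<le> (\<integral>\<^sup>+x. \<Psi> I x \<partial>M)" if "F \<subseteq> I" for F
    using that by (intro nn_integral_mono mono) auto
  ultimately show "\<forall>F. finite F \<and> F0 \<subseteq> F \<and> F \<subseteq> I \<longrightarrow> (\<integral>\<^sup>+x. \<Psi> F x \<partial>M) \<le> B"
    by (meson order_trans)
next
  assume B: "\<forall>F. finite F \<and> F0 \<subseteq> F \<and> F \<subseteq> I \<longrightarrow> (\<integral>\<^sup>+x. \<Psi> F x \<partial>M) \<le> B"
  define X where "X = (\<lambda>n. F0 \<union> {i\<in>I. to_nat_on I i \<le> n})"
  have X: "finite (X n)" "F0 \<subseteq> X n" "X n \<subseteq> I" for n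
  proof -
    have "inj_on (to_nat_on I) {i\<in>I. to_nat_on I i \<le> n}"
      using inj_on_to_nat_on[OF I] by (rule inj_on_subset) auto
    moreover have "finite (to_nat_on I ` {i\<in>I. to_nat_on I i \<le> n})"
      by (rule finite_subset[of _ "{..n}"]) auto
    ultimately show "finite (X n)" using F0 finite_imageD by (auto simp: X_def)
  qed (use F0 in \<open>auto simp: X_def\<close>)
  have absorb: "\<exists>n. F \<subseteq> X n" if "finite F" "F \<subseteq> I" for F
  proof -
    have "F \<subseteq> X (Max (insert 0 (to_nat_on I ` F)))"
      using that by (auto simp: X_def intro!: Max_ge)
    thus ?thesis by blast
  qed
  have "\<Psi> I x = (SUP n. \<Psi> (X n) x)" for x
  proof (rule antisym)
    show "\<Psi> I x \<le> (SUP n. \<Psi> (X n) x)"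
      unfolding sup
    proof (rule SUP_least)
      fix F assume "F \<in> {F. finite F \<and> F \<subseteq> I}"
      then obtain n where "F \<subseteq> X n" using absorb by blast
      thus "\<Psi> F x \<le> (SUP n. \<Psi> (X n) x)" using X by (intro SUP_upper2[of n] mono) auto
    qed
    show "(SUP n. \<Psi> (X n) x) \<le> \<Psi> I x" using X by (intro SUP_least mono) auto
  qed
  hence "(\<integral>\<^sup>+x. \<Psi> I x \<partial>M) = (\<integral>\<^sup>+x. (SUP n. \<Psi> (X n) x) \<partial>M)" by simp
  also have "\<dots> = (SUP n. \<integral>\<^sup>+x. \<Psi> (X n) x \<partial>M)"
  proof (rule nn_integral_monotone_convergence_SUP)
    show "incseq (\<lambda>n. \<Psi> (X n))"
      unfolding incseq_def le_fun_def using X by (intro allI impI mono) (auto simp: X_def)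
  qed (use X meas in auto)
  also have "\<dots> \<le> B" using B X by (intro SUP_least) auto
  finally show "(\<integral>\<^sup>+x. \<Psi> I x \<partial>M) \<le> B" .
qed

section \<open>Dyadic cubes and the atoms of a finite family\<close>

lemma countable_dyadic_cubes: "countable (dyadic_cubes :: (real ^ 'n) set set)"
proof -
  have "(dyadic_cubes :: (real ^ 'n) set set) = range (\<lambda>(k :: int, m :: int ^ 'n).
     {x. \<forall>i. 2 powi k * of_int (m $ i) \<le> x $ i \<and> x $ i < 2 powi k * (of_int (m $ i) + 1)})"
    by (auto simp: dyadic_cubes_def)
  also have "countable \<dots>" by (intro countable_image countableI_type)
  finally show ?thesis .
qed

lemma dyadic_cube_bounded:
  fixes Q :: "(real ^ 'n) set"
  assumes "Q \<in> dyadic_cubes"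
  obtains a b where "Q \<subseteq> cbox a b"
proof -
  obtain k :: int and m :: "int ^ 'n" where Q: "Q = {x. \<forall>i. 2 powi k * of_int (m $ i) \<le> x $ i \<and>
      x $ i < 2 powi k * (of_int (m $ i) + 1)}" using assms by (auto simp: dyadic_cubes_def)
  have "Q \<subseteq> cbox (\<chi> i. 2 powi k * of_int (m $ i)) (\<chi> i. 2 powi k * (of_int (m $ i) + 1))"
    by (auto simp: Q mem_box_cart less_imp_le)
  thus ?thesis by (rule that)
qed

lemma dyadic_cube_borel:
  fixes Q :: "(real ^ 'n) set"
  assumes "Q \<in> dyadic_cubes" shows "Q \<in> sets borel"
proof -
  obtain k :: int and m :: "int ^ 'n" where Q: "Q = {x. \<forall>i. 2 powi k * of_int (m $ i) \<le> x $ i \<and>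
      x $ i < 2 powi k * (of_int (m $ i) + 1)}" using assms by (auto simp: dyadic_cubes_def)
  have [measurable]: "(\<lambda>x :: real ^ 'n. x $ i) \<in> borel_measurable borel" for i
    by (intro borel_measurable_continuous_onI continuous_intros)
  have "Q = (\<Inter>i. {x\<in>space borel. 2 powi k * of_int (m $ i) \<le> x $ i \<and>
      x $ i < 2 powi k * (of_int (m $ i) + 1)})" by (auto simp: Q)
  also have "\<dots> \<in> sets borel" by (intro sets.countable_INT') auto
  finally show ?thesis .
qed

lemma dyadic_cube_nonempty:
  fixes Q :: "(real ^ 'n) set"
  assumes "Q \<in> dyadic_cubes" shows "Q \<noteq> {}"
proof -
  obtain k :: int and m :: "int ^ 'n" where Q: "Q = {x. \<forall>i. 2 powi k * of_int (m $ i) \<le> x $ i \<and>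
      x $ i < 2 powi k * (of_int (m $ i) + 1)}" using assms by (auto simp: dyadic_cubes_def)
  have "(\<chi> i. 2 powi k * of_int (m $ i)) \<in> Q" by (simp add: Q distrib_left)
  thus ?thesis by blast
qed

text \<open>In units of the smaller length \<open>2 powi k\<close>, the end points of both intervals are integers, and there
  is no integer strictly between \<open>m\<close> and \<open>m + 1\<close>.\<close>

lemma dyadic_interval_nested:
  fixes k l m n :: int and x y :: real
  assumes kl: "k \<le> l"
    and x: "2 powi k * of_int m \<le> x" "x < 2 powi k * (of_int m + 1)"
      "2 powi l * of_int n \<le> x" "x < 2 powi l * (of_int n + 1)"
    and y: "2 powi k * of_int m \<le> y" "y < 2 powi k * (of_int m + 1)"
  shows "2 powi l * of_int n \<le> y" "y < 2 powi l * (of_int n + 1)"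
proof -
  define j where "j = nat (l - k)"
  have l: "2 powi l = 2 powi k * (2 :: real) ^ j"
  proof -
    have "l = k + int j" using kl by (simp add: j_def)
    thus ?thesis by (simp add: power_int_add)
  qed
  have pos: "0 < (2 :: real) powi k" by simp
  have "2 powi k * (2 ^ j * of_int n) < 2 powi k * (of_int m + 1 :: real)"
    using order.strict_trans1[OF x(3,2)] by (simp only: l mult.assoc)
  hence "(2 :: real) ^ j * of_int n < of_int m + 1" using pos by (simp only: mult_less_cancel_left_pos)
  hence "(of_int (2 ^ j * n) :: real) < of_int (m + 1)" by simp
  hence "2 ^ j * n < m + 1" by (simp only: of_int_less_iff)
  hence "of_int (2 ^ j * n) \<le> (of_int m :: real)" by (subst of_int_le_iff) simp
  hence "2 powi k * (2 ^ j * of_int n) \<le> 2 powi k * (of_int m :: real)" by simp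
  thus "2 powi l * of_int n \<le> y" using order.trans[OF _ y(1)] by (simp only: l mult.assoc)
  have "2 powi k * of_int m < 2 powi k * (2 ^ j * (of_int n + 1) :: real)"
    using order.strict_trans1[OF x(1,4)] by (simp only: l mult.assoc)
  hence "(of_int m :: real) < 2 ^ j * (of_int n + 1)" using pos by (simp only: mult_less_cancel_left_pos)
  hence "(of_int m :: real) < of_int (2 ^ j * (n + 1))" by simp
  hence "m < 2 ^ j * (n + 1)" by (simp only: of_int_less_iff)
  hence "(of_int (m + 1) :: real) \<le> of_int (2 ^ j * (n + 1))" by (subst of_int_le_iff) simp
  hence "2 powi k * (of_int m + 1 :: real) \<le> 2 powi k * (2 ^ j * (of_int n + 1))" by simp
  thus "y < 2 powi l * (of_int n + 1)" using order.strict_trans2[OF y(2)] by (simp only: l mult.assoc)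
qed

lemma dyadic_cubes_nested:
  fixes Q Q' :: "(real ^ 'n) set"
  assumes Q: "Q \<in> dyadic_cubes" "Q' \<in> dyadic_cubes" and x: "x \<in> Q" "x \<in> Q'"
  shows "Q \<subseteq> Q' \<or> Q' \<subseteq> Q"
proof -
  obtain k :: int and m :: "int ^ 'n" where k: "Q = {x. \<forall>i. 2 powi k * of_int (m $ i) \<le> x $ i \<and>
      x $ i < 2 powi k * (of_int (m $ i) + 1)}" using Q by (auto simp: dyadic_cubes_def)
  obtain l :: int and n :: "int ^ 'n" where l: "Q' = {x. \<forall>i. 2 powi l * of_int (n $ i) \<le> x $ i \<and>
      x $ i < 2 powi l * (of_int (n $ i) + 1)}" using Q by (auto simp: dyadic_cubes_def)
  show ?thesis
  proof (cases "k \<le> l")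
    case True
    have "y \<in> Q'" if "y \<in> Q" for y
      using that x dyadic_interval_nested[OF True, of "m $ i" "x $ i" "n $ i" "y $ i" for i]
      unfolding k l mem_Collect_eq by blast
    thus ?thesis by blast
  next
    case False
    hence "l \<le> k" by simp
    have "y \<in> Q" if "y \<in> Q'" for y
      using that x dyadic_interval_nested[OF \<open>l \<le> k\<close>, of "n $ i" "x $ i" "m $ i" "y $ i" for i]
      unfolding k l mem_Collect_eq by blast
    thus ?thesis by blast
  qed
qed

lemma finite_forest_dyadic_cubes:
  assumes "finite D" "D \<subseteq> dyadic_cubes" shows "finite_forest D"
proof
  fix q Q Q' assume q: "q \<in> D" "Q \<in> D" "Q' \<in> D" "q \<subseteq> Q" "q \<subseteq> Q'"
  obtain x where "x \<in> q" using q assms dyadic_cube_nonempty by blast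
  thus "Q \<subseteq> Q' \<or> Q' \<subseteq> Q" using q assms by (intro dyadic_cubes_nested[of _ _ x]) auto
qed (use assms in simp)

text \<open>The cubes of \<open>D\<close> that contain a given point form a chain; the point lies in the atom of the
  smallest one.\<close>

definition atom :: "'a set set \<Rightarrow> 'a set \<Rightarrow> 'a set" where
  "atom D Q = Q - \<Union>{Q'\<in>D. Q' \<subset> Q}"

lemma atom_cubes:
  assumes D: "D \<subseteq> dyadic_cubes" and q: "q \<in> D" and x: "x \<in> atom D q"
  shows "{Q\<in>D. x \<in> Q} = upset D q"
proof -
  have "q \<subseteq> Q" if "Q \<in> D" "x \<in> Q" for Q
    using dyadic_cubes_nested[of q Q x] that assms by (auto simp: atom_def)
  thus ?thesis using x by (auto simp: upset_def atom_def)
qed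

lemma atom_unique:
  assumes D: "D \<subseteq> dyadic_cubes" and q: "q \<in> D" "q' \<in> D" and x: "x \<in> atom D q" "x \<in> atom D q'"
  shows "q = q'"
  using atom_cubes[OF D q(1) x(1)] atom_cubes[OF D q(2) x(2)] q by (auto simp: upset_def)

lemma atom_exists:
  assumes "finite D" "Q \<in> D" "x \<in> Q"
  obtains q where "q \<in> D" "x \<in> atom D q"
proof -
  have "finite {Q\<in>D. x \<in> Q}" "{Q\<in>D. x \<in> Q} \<noteq> {}" using assms by auto
  from finite_has_minimal[OF this] obtain q
    where q: "q \<in> D" "x \<in> q" "\<And>Q. Q \<in> D \<Longrightarrow> x \<in> Q \<Longrightarrow> Q \<subseteq> q \<Longrightarrow> q = Q" by blast
  hence "x \<in> atom D q" by (auto simp: atom_def)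
  thus ?thesis using that q by blast
qed

lemma atom_subset: "atom D q \<subseteq> q"
  by (auto simp: atom_def)

lemma atom_sets:
  assumes "finite D" "D \<subseteq> dyadic_cubes" "q \<in> D"
  shows "atom D q \<in> sets lebesgue"
proof -
  have "Q \<in> sets lebesgue" if "Q \<in> D" for Q
    using dyadic_cube_borel[of Q] that assms by auto
  thus ?thesis using assms unfolding atom_def by (intro sets.Diff sets.finite_Union) auto
qed

lemma weight_measurable:
  fixes w :: "real ^ 'n \<Rightarrow> real"
  assumes "locally_integrable w" shows "w \<in> borel_measurable lebesgue"
proof (rule borel_measurable_LIMSEQ_real)
  fix x :: "real ^ 'n"
  obtain N :: nat where "norm x \<le> N" using real_arch_simple by blast
  hence "\<forall>n\<ge>N. indicat_real (cball 0 (real n)) x *\<^sub>R w x = w x" by auto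
  thus "(\<lambda>n. indicat_real (cball 0 (real n)) x *\<^sub>R w x) \<longlonglongrightarrow> w x"
    by (intro tendsto_eventually) (auto simp: eventually_sequentially)
next
  fix n :: nat
  have "set_integrable lebesgue (cball 0 (real n)) w" using assms by (simp add: locally_integrable_def)
  thus "(\<lambda>x. indicat_real (cball 0 (real n)) x *\<^sub>R w x) \<in> borel_measurable lebesgue"
    unfolding set_integrable_def by (rule borel_measurable_integrable)
qed

lemma nn_integral_weight:
  fixes w :: "real ^ 'n \<Rightarrow> real"
  assumes w: "locally_integrable w" "\<And>x. 0 < w x"
    and A: "A \<in> sets lebesgue" "A \<subseteq> Q" "Q \<in> dyadic_cubes"
  shows "(\<integral>\<^sup>+x. indicator A x * ennreal (w x) \<partial>lebesgue) = ennreal (weight_of w A)"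
    and "0 \<le> weight_of w A"
proof -
  obtain a b where ab: "Q \<subseteq> cbox a b" using dyadic_cube_bounded A(3) by blast
  have "set_integrable lebesgue (cbox a b) w" using w by (simp add: locally_integrable_def)
  hence "set_integrable lebesgue A w" using A ab by (auto intro: set_integrable_subset)
  hence "(\<integral>\<^sup>+x. ennreal (indicator A x *\<^sub>R w x) \<partial>lebesgue) = ennreal (weight_of w A)"
    unfolding weight_of_def set_lebesgue_integral_def set_integrable_def
    using w by (intro nn_integral_eq_integral) (auto simp: less_imp_le)
  moreover have "ennreal (indicator A x *\<^sub>R w x) = indicator A x * ennreal (w x)" for x
    by (simp add: indicator_def)
  ultimately show "(\<integral>\<^sup>+x. indicator A x * ennreal (w x) \<partial>lebesgue) = ennreal (weight_of w A)" by simp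
  show "0 \<le> weight_of w A"
    unfolding weight_of_def set_lebesgue_integral_def using w
    by (intro integral_nonneg_AE) (auto simp: less_imp_le indicator_def)
qed

definition atom_weight :: "(real ^ 'n \<Rightarrow> real) \<Rightarrow> (real ^ 'n) set set \<Rightarrow> (real ^ 'n) set \<Rightarrow> real" where
  "atom_weight w D q = weight_of w (atom D q)"

lemma atom_weight_nonneg:
  assumes "locally_integrable w" "\<And>x. 0 < w x" "finite D" "D \<subseteq> dyadic_cubes" "q \<in> D"
  shows "0 \<le> atom_weight w D q"
  unfolding atom_weight_def
  using assms by (intro nn_integral_weight(2)[OF _ _ atom_sets[OF assms(3,4,5)] atom_subset]) auto

lemma atomwise_eq_sum:
  fixes g :: "real ^ 'n \<Rightarrow> ennreal"
  assumes D: "finite D" "D \<subseteq> dyadic_cubes"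
    and g: "\<And>q x. q \<in> D \<Longrightarrow> x \<in> atom D q \<Longrightarrow> g x = G q" "\<And>x. x \<notin> \<Union>D \<Longrightarrow> g x = 0"
  shows "g x = (\<Sum>q\<in>D. G q * indicator (atom D q) x)"
proof (cases "x \<in> \<Union>D")
  case True
  then obtain q where q: "q \<in> D" "x \<in> atom D q" using atom_exists[OF D(1)] by blast
  have "(\<Sum>q\<in>D. G q * indicator (atom D q) x) = (\<Sum>q'\<in>{q}. G q' * indicator (atom D q') x)"
    using D q atom_unique[OF D(2)] by (intro sum.mono_neutral_right) (auto simp: indicator_def)
  thus ?thesis using g(1)[OF q] q by simp
next
  case False
  hence "indicator (atom D q) x = (0 :: ennreal)" if "q \<in> D" for q
    using that atom_subset[of D q] by (auto simp: indicator_def)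
  thus ?thesis using g(2)[OF False] by simp
qed

lemma atomwise_measurable:
  fixes g :: "real ^ 'n \<Rightarrow> ennreal"
  assumes D: "finite D" "D \<subseteq> dyadic_cubes"
    and g: "\<And>q x. q \<in> D \<Longrightarrow> x \<in> atom D q \<Longrightarrow> g x = G q" "\<And>x. x \<notin> \<Union>D \<Longrightarrow> g x = 0"
  shows "g \<in> borel_measurable lebesgue"
proof -
  have "g = (\<lambda>x. \<Sum>q\<in>D. G q * indicator (atom D q) x)"
    by (rule ext, rule atomwise_eq_sum[OF D]) (use g in auto)
  also have "\<dots> \<in> borel_measurable lebesgue"
    using atom_sets[OF D] by (intro borel_measurable_sum borel_measurable_times_ennreal
        borel_measurable_const borel_measurable_indicator) auto
  finally show ?thesis .
qed

text \<open>Integrals of functions that are constant on atoms are finite sums. This, together with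
  \<open>weight_of_cube\<close>, is the dictionary between integrals and forests.\<close>

lemma nn_integral_atomwise:
  fixes g :: "real ^ 'n \<Rightarrow> ennreal" and w :: "real ^ 'n \<Rightarrow> real"
  assumes w: "locally_integrable w" "\<And>x. 0 < w x" and D: "finite D" "D \<subseteq> dyadic_cubes"
    and g: "\<And>q x. q \<in> D \<Longrightarrow> x \<in> atom D q \<Longrightarrow> g x = ennreal (G q)" "\<And>x. x \<notin> \<Union>D \<Longrightarrow> g x = 0"
    and G: "\<And>q. q \<in> D \<Longrightarrow> 0 \<le> G q"
  shows "(\<integral>\<^sup>+x. g x * ennreal (w x) \<partial>lebesgue) = ennreal (\<Sum>q\<in>D. G q * atom_weight w D q)"
proof -
  have [measurable]: "w \<in> borel_measurable lebesgue" using w by (intro weight_measurable)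
  have [measurable]: "atom D q \<in> sets lebesgue" if "q \<in> D" for q using atom_sets[OF D that] .
  have "g x = (\<Sum>q\<in>D. ennreal (G q) * indicator (atom D q) x)" for x
    by (rule atomwise_eq_sum[OF D]) (use g in auto)
  hence "(\<integral>\<^sup>+x. g x * ennreal (w x) \<partial>lebesgue)
      = (\<integral>\<^sup>+x. (\<Sum>q\<in>D. ennreal (G q) * (indicator (atom D q) x * ennreal (w x))) \<partial>lebesgue)"
    by (simp add: sum_distrib_right mult.assoc)
  also have "\<dots> = (\<Sum>q\<in>D. \<integral>\<^sup>+x. ennreal (G q) * (indicator (atom D q) x * ennreal (w x)) \<partial>lebesgue)"
    by (intro nn_integral_sum) measurable
  also have "\<dots> = (\<Sum>q\<in>D. ennreal (G q) * ennreal (atom_weight w D q))"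
  proof (intro sum.cong refl)
    fix q assume q: "q \<in> D"
    have "(\<integral>\<^sup>+x. ennreal (G q) * (indicator (atom D q) x * ennreal (w x)) \<partial>lebesgue)
        = ennreal (G q) * (\<integral>\<^sup>+x. indicator (atom D q) x * ennreal (w x) \<partial>lebesgue)"
      using q by (intro nn_integral_cmult) measurable
    also have "(\<integral>\<^sup>+x. indicator (atom D q) x * ennreal (w x) \<partial>lebesgue) = ennreal (atom_weight w D q)"
      unfolding atom_weight_def
      using D q w by (intro nn_integral_weight(1)[OF _ _ atom_sets[OF D q] atom_subset]) auto
    finally show "(\<integral>\<^sup>+x. ennreal (G q) * (indicator (atom D q) x * ennreal (w x)) \<partial>lebesgue)
        = ennreal (G q) * ennreal (atom_weight w D q)" .
  qed
  also have "\<dots> = ennreal (\<Sum>q\<in>D. G q * atom_weight w D q)"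
    using G atom_weight_nonneg[OF w D] by (simp add: ennreal_mult[symmetric])
  finally show ?thesis .
qed

lemma weight_of_cube:
  fixes w :: "real ^ 'n \<Rightarrow> real"
  assumes w: "locally_integrable w" "\<And>x. 0 < w x" and D: "finite D" "D \<subseteq> dyadic_cubes" and Q: "Q \<in> D"
  shows "weight_of w Q = mass D (atom_weight w D) Q"
proof -
  have "ennreal (weight_of w Q) = (\<integral>\<^sup>+x. indicator Q x * ennreal (w x) \<partial>lebesgue)"
    using w D Q dyadic_cube_borel[of Q] by (intro nn_integral_weight(1)[symmetric, where Q = Q]) auto
  also have "\<dots> = ennreal (\<Sum>q\<in>D. (if q \<subseteq> Q then 1 else 0) * atom_weight w D q)"
  proof (rule nn_integral_atomwise[OF w D])
    fix q x assume q: "q \<in> D" "x \<in> atom D q"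
    have "x \<in> Q \<longleftrightarrow> q \<subseteq> Q" using atom_cubes[OF D(2) q] Q by (auto simp: upset_def)
    thus "indicator Q x = ennreal (if q \<subseteq> Q then 1 else 0)" by (auto simp: indicator_def)
  qed (use Q in auto)
  also have "(\<Sum>q\<in>D. (if q \<subseteq> Q then 1 else 0) * atom_weight w D q) = mass D (atom_weight w D) Q"
    unfolding mass_def using D by (intro sum.mono_neutral_cong_right) auto
  finally show ?thesis
    using nn_integral_weight(2)[OF w, of Q Q] D Q dyadic_cube_borel[of Q] atom_weight_nonneg[OF w D]
    by (subst (asm) ennreal_inj) (auto intro!: mass_nonneg)
qed

lemma lr_norm_indicator:
  assumes r: "1 \<le> r" and F: "finite F"
  shows "lr_norm r F (\<lambda>Q. c Q * indicator Q x) = ennreal (real_lr_norm r {Q\<in>F. x \<in> Q} (\<lambda>Q. \<bar>c Q\<bar>))"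
proof -
  have "real_lr_norm r F (\<lambda>Q. \<bar>c Q * indicator Q x\<bar>)
      = real_lr_norm r F (\<lambda>Q. if Q \<in> {Q\<in>F. x \<in> Q} then \<bar>c Q\<bar> else 0)"
    by (intro real_lr_norm_cong) (auto simp: indicator_def)
  also have "\<dots> = real_lr_norm r {Q\<in>F. x \<in> Q} (\<lambda>Q. \<bar>c Q\<bar>)"
    using F by (intro real_lr_norm_zero_extension r) auto
  finally show ?thesis by (simp add: lr_norm_finite[OF r F])
qed

lemma nn_integral_lr_norm:
  fixes w :: "real ^ 'n \<Rightarrow> real"
  assumes w: "locally_integrable w" "\<And>x. 0 < w x" and D: "finite D" "D \<subseteq> dyadic_cubes"
    and F: "F \<subseteq> D" and r: "1 \<le> r" and p: "0 < p"
  shows "(\<integral>\<^sup>+x. epowr (lr_norm r F (\<lambda>Q. c Q * indicator Q x)) p * ennreal (w x) \<partial>lebesgue)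
       = ennreal (\<Sum>q\<in>D. real_lr_norm r {Q\<in>F. q \<subseteq> Q} (\<lambda>Q. \<bar>c Q\<bar>) powr p * atom_weight w D q)"
    and "(\<lambda>x. epowr (lr_norm r F (\<lambda>Q. c Q * indicator Q x)) p) \<in> borel_measurable lebesgue"
proof -
  have fF: "finite F" using F D finite_subset by blast
  have eq: "epowr (lr_norm r F (\<lambda>Q. c Q * indicator Q x)) p
      = ennreal (real_lr_norm r {Q\<in>F. x \<in> Q} (\<lambda>Q. \<bar>c Q\<bar>) powr p)" for x
    using fF by (simp add: lr_norm_indicator[OF r fF] epowr_ennreal real_lr_norm_nonneg)
  have g: "epowr (lr_norm r F (\<lambda>Q. c Q * indicator Q x)) p
      = ennreal (real_lr_norm r {Q\<in>F. q \<subseteq> Q} (\<lambda>Q. \<bar>c Q\<bar>) powr p)" if "q \<in> D" "x \<in> atom D q" for q x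
  proof -
    have "{Q\<in>F. x \<in> Q} = {Q\<in>F. q \<subseteq> Q}" using atom_cubes[OF D(2) that] F by (auto simp: upset_def)
    thus ?thesis by (simp add: eq)
  qed
  have z: "epowr (lr_norm r F (\<lambda>Q. c Q * indicator Q x)) p = 0" if "x \<notin> \<Union>D" for x
  proof -
    have none: "{Q\<in>F. x \<in> Q} = {}" using that F by auto
    show ?thesis unfolding eq none by simp
  qed
  show "(\<integral>\<^sup>+x. epowr (lr_norm r F (\<lambda>Q. c Q * indicator Q x)) p * ennreal (w x) \<partial>lebesgue)
       = ennreal (\<Sum>q\<in>D. real_lr_norm r {Q\<in>F. q \<subseteq> Q} (\<lambda>Q. \<bar>c Q\<bar>) powr p * atom_weight w D q)"
    by (rule nn_integral_atomwise[OF w D]) (use g z in auto)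
  show "(\<lambda>x. epowr (lr_norm r F (\<lambda>Q. c Q * indicator Q x)) p) \<in> borel_measurable lebesgue"
    by (rule atomwise_measurable[OF D]) (use g z in auto)
qed

lemma Lp_norm_le_iff:
  "0 < p \<Longrightarrow> Lp_norm p w h \<le> B \<longleftrightarrow> (\<integral>\<^sup>+x. epowr (h x) p * ennreal (w x) \<partial>lebesgue) \<le> epowr B p"
  unfolding Lp_norm_def by (subst epowr_le_iff) auto

lemma Lp_lr_norm_le_iff:
  fixes w :: "real ^ 'n \<Rightarrow> real"
  assumes w: "locally_integrable w" "\<And>x. 0 < w x" and I: "I \<subseteq> dyadic_cubes"
    and F0: "finite F0" "F0 \<subseteq> I" and r: "1 \<le> r" and p: "0 < p"
  shows "Lp_lr_norm p r w I (\<lambda>Q x. c Q * indicator Q x) \<le> B \<longleftrightarrow>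
    (\<forall>F. finite F \<and> F0 \<subseteq> F \<and> F \<subseteq> I \<longrightarrow>
      (\<integral>\<^sup>+x. epowr (lr_norm r F (\<lambda>Q. c Q * indicator Q x)) p * ennreal (w x) \<partial>lebesgue) \<le> epowr B p)"
  unfolding Lp_lr_norm_def Lp_norm_le_iff[OF p]
proof (rule nn_integral_le_iff_finite[OF _ F0])
  show "countable I" using countable_dyadic_cubes I countable_subset by blast
  show "epowr (lr_norm r I (\<lambda>Q. c Q * indicator Q x)) p * ennreal (w x) =
    (SUP F\<in>{F. finite F \<and> F \<subseteq> I}. epowr (lr_norm r F (\<lambda>Q. c Q * indicator Q x)) p * ennreal (w x))" for x
    by (subst lr_norm_eq_SUP[OF r]) (simp add: epowr_SUP[OF p] SUP_mult_right_ennreal)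
  show "epowr (lr_norm r F (\<lambda>Q. c Q * indicator Q x)) p * ennreal (w x)
      \<le> epowr (lr_norm r G (\<lambda>Q. c Q * indicator Q x)) p * ennreal (w x)" if "F \<subseteq> G" for F G x
    using that p r by (intro mult_right_mono epowr_mono lr_norm_subset_mono) auto
  fix F assume "finite F" "F \<subseteq> I"
  hence "(\<lambda>x. epowr (lr_norm r F (\<lambda>Q. c Q * indicator Q x)) p) \<in> borel_measurable lebesgue"
    using I by (intro nn_integral_lr_norm(2)[OF w, of F F]) (use r p in auto)
  thus "(\<lambda>x. epowr (lr_norm r F (\<lambda>Q. c Q * indicator Q x)) p * ennreal (w x)) \<in> borel_measurable lebesgue"
    using weight_measurable[OF w(1)] by (intro borel_measurable_times_ennreal) auto
qed

section \<open>The three inequalities in terms of finite forests\<close>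

definition coeff_density :: "((real ^ 'n) set \<Rightarrow> real) \<Rightarrow> (real ^ 'n) set \<Rightarrow> real" where
  "coeff_density lam Q = lam Q / measure lebesgue Q"

lemma T_op_eq: "T_op lam f Q x = coeff_density lam Q * weight_of f Q * indicator Q x"
  by (simp add: T_op_def average_def weight_of_def coeff_density_def)

text \<open>Continuity in the constant, also at \<open>C = 0\<close>; this is why least constants are attained.\<close>

lemma powr_le_of_limit:
  fixes p A B C :: real
  assumes "0 < p" "0 \<le> C" "\<And>e. 0 < e \<Longrightarrow> A \<le> (C + e) powr p * B"
  shows "A \<le> C powr p * B"
proof (rule tendsto_lowerbound)
  show "((\<lambda>e. (C + e) powr p * B) \<longlongrightarrow> C powr p * B) (at_right 0)"
  proof (cases "C = 0")
    case True
    have "((\<lambda>e :: real. e powr p) \<longlongrightarrow> 0) (at_right 0)"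
      using assms(1) by (auto intro!: tendsto_eq_intros eventually_at_rightI[of 0 1])
    hence "((\<lambda>e :: real. e powr p * B) \<longlongrightarrow> 0 * B) (at_right 0)"
      by (intro tendsto_mult tendsto_const)
    thus ?thesis using True by simp
  next
    case False
    thus ?thesis by (auto intro!: tendsto_eq_intros)
  qed
  show "\<forall>\<^sub>F e in at_right 0. A \<le> (C + e) powr p * B"
    using assms(3) by (auto intro!: eventually_at_rightI[of 0 1])
qed simp

lemma is_least_const_exists:
  assumes ex: "0 \<le> C0" "P C0"
    and mono: "\<And>C C'. 0 \<le> C \<Longrightarrow> P C \<Longrightarrow> C \<le> C' \<Longrightarrow> P C'"
    and closed: "\<And>C. 0 \<le> C \<Longrightarrow> (\<And>e. 0 < e \<Longrightarrow> P (C + e)) \<Longrightarrow> P C"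
  shows "\<exists>C. is_least_const P C"
proof
  define X where "X = {C. 0 \<le> C \<and> P C}"
  have X: "X \<noteq> {}" "bdd_below X" using ex by (auto simp: X_def)
  have I0: "0 \<le> Inf X" using X(1) by (intro cInf_greatest) (auto simp: X_def)
  have "P (Inf X)"
  proof (rule closed[OF I0])
    fix e :: real assume "0 < e"
    then obtain C where "C \<in> X" "C < Inf X + e" using cInf_lessD[OF X(1), of "Inf X + e"] by auto
    thus "P (Inf X + e)" using mono[of C "Inf X + e"] by (auto simp: X_def)
  qed
  thus "is_least_const P (Inf X)"
    using I0 X(2) by (auto simp: is_least_const_def X_def intro: cInf_lower)
qed

locale dyadic_two_weight =
  fixes p p' :: real and r r' :: ennreal and lam :: "(real ^ 'n) set \<Rightarrow> real"
    and \<sigma> \<omega> :: "real ^ 'n \<Rightarrow> real"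
  assumes p: "1 < p" "1 / p + 1 / p' = 1" and r: "1 \<le> r" "inverse r + inverse r' = 1"
    and lam: "\<And>Q. Q \<in> dyadic_cubes \<Longrightarrow> 0 \<le> lam Q"
    and \<sigma>: "locally_integrable \<sigma>" "\<And>x. 0 < \<sigma> x"
    and \<omega>: "locally_integrable \<omega>" "\<And>x. 0 < \<omega> x"
begin

abbreviation "\<kappa> \<equiv> coeff_density lam"
abbreviation "\<mu> \<equiv> atom_weight \<sigma>"
abbreviation "\<nu> \<equiv> atom_weight \<omega>"

abbreviation "cube_family D \<equiv> finite D \<and> D \<subseteq> dyadic_cubes"

text \<open>The left-hand sides of the inequalities for a finite family, raised to the power \<open>p\<close> or \<open>p'\<close>: an
  integral, and three sums over atoms.\<close>

abbreviation "energy F c \<equiv>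
  (\<integral>\<^sup>+x. epowr (lr_norm r F (\<lambda>Q. c Q * indicator Q x)) p * ennreal (\<omega> x) \<partial>lebesgue)"

abbreviation "testing_sum D R \<equiv>
  (\<Sum>q\<in>D. real_lr_norm r {Q\<in>upset D q. Q \<subseteq> R} (\<lambda>Q. \<kappa> Q * mass D (\<mu> D) Q) powr p * \<nu> D q)"

abbreviation "norm_sum D g \<equiv>
  (\<Sum>q\<in>D. real_lr_norm r (upset D q) (\<lambda>Q. \<bar>\<kappa> Q * weight_of (\<lambda>x. g x * \<sigma> x) Q\<bar>) powr p * \<nu> D q)"

abbreviation "adjoint_sum D R a \<equiv>
  (\<Sum>q\<in>D. (\<Sum>Q\<in>{Q\<in>upset D q. Q \<subseteq> R}. \<kappa> Q * a Q * mass D (\<nu> D) Q) powr p' * \<mu> D q)"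

lemma conjugate_r_ge_1: "1 \<le> r'"
  using r by (cases rule: conjugate_exponents_cases) (auto simp: ennreal_ge_1)

lemma coeff_density_nonneg: "Q \<in> dyadic_cubes \<Longrightarrow> 0 \<le> \<kappa> Q"
  using lam by (simp add: coeff_density_def)

lemma weight_of_nonneg: "Q \<in> dyadic_cubes \<Longrightarrow> 0 \<le> weight_of \<sigma> Q" "Q \<in> dyadic_cubes \<Longrightarrow> 0 \<le> weight_of \<omega> Q"
  using dyadic_cube_borel[of Q]
    nn_integral_weight(2)[OF \<sigma>, of Q Q] nn_integral_weight(2)[OF \<omega>, of Q Q] by auto

lemma testing_bound_iff_forests:
  assumes C: "0 \<le> C"
  shows "testing_bound p r lam \<sigma> \<omega> C \<longleftrightarrow>
    (\<forall>D. cube_family D \<longrightarrow>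
       forest_testing D p r \<kappa> (\<mu> D) (\<nu> D) C)"
proof -
  define c where "c = (\<lambda>Q. \<kappa> Q * weight_of \<sigma> Q)"
  have c0: "0 \<le> c Q" if "Q \<in> dyadic_cubes" for Q
    using that coeff_density_nonneg weight_of_nonneg by (simp add: c_def)
  have tb: "testing_bound p r lam \<sigma> \<omega> C \<longleftrightarrow> (\<forall>R\<in>dyadic_cubes. \<forall>F. finite F \<and> {R} \<subseteq> F \<and> F \<subseteq> dyadic_subcubes R \<longrightarrow>
      energy F c
        \<le> ennreal (C powr p * weight_of \<sigma> R))"
    unfolding testing_bound_def
  proof (rule ball_cong[OF refl])
    fix R :: "(real ^ 'n) set" assume R: "R \<in> dyadic_cubes"
    have "epowr (ennreal C * ennreal (weight_of \<sigma> R powr (1 / p))) p = ennreal (C powr p * weight_of \<sigma> R)"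
      using p C weight_of_nonneg R
      by (simp add: ennreal_mult[symmetric] epowr_ennreal powr_mult powr_powr)
    moreover have "T_op lam \<sigma> = (\<lambda>Q x. c Q * indicator Q x)"
      by (intro ext) (simp add: T_op_eq c_def)
    moreover have "Lp_lr_norm p r \<omega> (dyadic_subcubes R) (\<lambda>Q x. c Q * indicator Q x) \<le> B \<longleftrightarrow>
      (\<forall>F. finite F \<and> {R} \<subseteq> F \<and> F \<subseteq> dyadic_subcubes R \<longrightarrow>
        energy F c \<le> epowr B p)" for B
      by (rule Lp_lr_norm_le_iff[OF \<omega> _ _ _ r(1)]) (use R p in \<open>auto simp: dyadic_subcubes_def\<close>)
    ultimately show "(Lp_lr_norm p r \<omega> (dyadic_subcubes R) (T_op lam \<sigma>)
        \<le> ennreal C * ennreal (weight_of \<sigma> R powr (1 / p))) \<longleftrightarrow>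
      (\<forall>F. finite F \<and> {R} \<subseteq> F \<and> F \<subseteq> dyadic_subcubes R \<longrightarrow>
        energy F c
          \<le> ennreal (C powr p * weight_of \<sigma> R))"
      by (simp only:)
  qed
  have key: "(energy {Q\<in>D. Q \<subseteq> R} c
        \<le> ennreal (C powr p * weight_of \<sigma> R)) \<longleftrightarrow>
      testing_sum D R
        \<le> C powr p * mass D (\<mu> D) R"
    if D: "finite D" "D \<subseteq> dyadic_cubes" and R: "R \<in> D"
    for D :: "(real ^ 'n) set set" and R
  proof -
    have "energy {Q\<in>D. Q \<subseteq> R} c
      = ennreal (\<Sum>q\<in>D. real_lr_norm r {Q\<in>{Q\<in>D. Q \<subseteq> R}. q \<subseteq> Q} (\<lambda>Q. \<bar>c Q\<bar>) powr p * \<nu> D q)"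
      using p by (intro nn_integral_lr_norm(1)[OF \<omega> D _ r(1)]) auto
    also have "(\<Sum>q\<in>D. real_lr_norm r {Q\<in>{Q\<in>D. Q \<subseteq> R}. q \<subseteq> Q} (\<lambda>Q. \<bar>c Q\<bar>) powr p * \<nu> D q) =
      testing_sum D R"
    proof (intro sum.cong refl)
      fix q
      have sets: "{Q\<in>{Q\<in>D. Q \<subseteq> R}. q \<subseteq> Q} = {Q\<in>upset D q. Q \<subseteq> R}" by (auto simp: upset_def)
      have "real_lr_norm r {Q\<in>upset D q. Q \<subseteq> R} (\<lambda>Q. \<bar>c Q\<bar>)
          = real_lr_norm r {Q\<in>upset D q. Q \<subseteq> R} (\<lambda>Q. \<kappa> Q * mass D (\<mu> D) Q)"
      proof (rule real_lr_norm_cong)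
        fix Q assume "Q \<in> {Q\<in>upset D q. Q \<subseteq> R}"
        hence Q: "Q \<in> D" by (simp add: upset_def)
        hence "0 \<le> c Q" using c0 D by blast
        thus "\<bar>c Q\<bar> = \<kappa> Q * mass D (\<mu> D) Q"
          by (simp add: c_def weight_of_cube[OF \<sigma> D Q])
      qed
      thus "real_lr_norm r {Q\<in>{Q\<in>D. Q \<subseteq> R}. q \<subseteq> Q} (\<lambda>Q. \<bar>c Q\<bar>) powr p * \<nu> D q =
        real_lr_norm r {Q\<in>upset D q. Q \<subseteq> R} (\<lambda>Q. \<kappa> Q * mass D (\<mu> D) Q) powr p * \<nu> D q"
        by (simp only: sets)
    qed
    finally show ?thesis
      using D R atom_weight_nonneg[OF \<sigma> D]
      by (simp add: weight_of_cube[OF \<sigma> D R] ennreal_le_iff mass_nonneg)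
  qed
  show ?thesis
    unfolding tb forest_testing_def
  proof (intro iffI allI ballI impI)
    fix D :: "(real ^ 'n) set set" and R
    assume t: "\<forall>R\<in>dyadic_cubes. \<forall>F. finite F \<and> {R} \<subseteq> F \<and> F \<subseteq> dyadic_subcubes R \<longrightarrow>
      energy F c
        \<le> ennreal (C powr p * weight_of \<sigma> R)"
      and D: "cube_family D" and R: "R \<in> D"
    have "energy {Q\<in>D. Q \<subseteq> R} c
        \<le> ennreal (C powr p * weight_of \<sigma> R)"
      using D R by (intro t[rule_format]) (auto simp: dyadic_subcubes_def)
    thus "testing_sum D R
        \<le> C powr p * mass D (\<mu> D) R"
      using key D R by blast
  next
    fix R :: "(real ^ 'n) set" and F
    assume t: "\<forall>D. cube_family D \<longrightarrow> (\<forall>R\<in>D.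
      testing_sum D R
        \<le> C powr p * mass D (\<mu> D) R)"
      and F: "finite F \<and> {R} \<subseteq> F \<and> F \<subseteq> dyadic_subcubes R"
    have F': "finite F" "F \<subseteq> dyadic_cubes" "R \<in> F" "{Q\<in>F. Q \<subseteq> R} = F"
      using F by (auto simp: dyadic_subcubes_def)
    show "energy F c
        \<le> ennreal (C powr p * weight_of \<sigma> R)"
      using key[OF F'(1-3)] t[rule_format, of F R] F' by simp
  qed
qed


text \<open>Hoelder's inequality on a set of weight \<open>m\<close>: the integral of \<open>\<bar>f\<bar>\<close> is at most \<open>m\<close> times the \<open>L\<^sup>p\<close>
  mean \<open>c\<close> of \<open>f\<close>. It is the integrated tangent inequality at \<open>c\<close>.\<close>

lemma nn_integral_Holder_on:
  fixes f :: "real ^ 'n \<Rightarrow> real"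
  assumes f: "f \<in> borel_measurable lebesgue" and A: "A \<in> sets lebesgue"
    and m: "(\<integral>\<^sup>+x. indicator A x * ennreal (\<sigma> x) \<partial>lebesgue) = ennreal m" "0 \<le> m"
    and e: "(\<integral>\<^sup>+x. indicator A x * (ennreal (\<bar>f x\<bar> powr p) * ennreal (\<sigma> x)) \<partial>lebesgue) = ennreal e" "0 \<le> e"
  shows "(\<integral>\<^sup>+x. indicator A x * (ennreal \<bar>f x\<bar> * ennreal (\<sigma> x)) \<partial>lebesgue)
           \<le> ennreal ((e / m) powr (1 / p) * m)"
proof -
  have [measurable]: "\<sigma> \<in> borel_measurable lebesgue" "f \<in> borel_measurable lebesgue" "A \<in> sets lebesgue"
    using weight_measurable[OF \<sigma>(1)] f A by auto
  define L where "L = (\<integral>\<^sup>+x. indicator A x * (ennreal \<bar>f x\<bar> * ennreal (\<sigma> x)) \<partial>lebesgue)"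
  show ?thesis
  proof (cases "m = 0 \<or> e = 0")
    case True
    have "AE x in lebesgue. indicator A x * (ennreal \<bar>f x\<bar> * ennreal (\<sigma> x)) = 0"
    proof (cases "m = 0")
      case True
      hence "AE x in lebesgue. indicator A x * ennreal (\<sigma> x) = 0"
        using m by (subst nn_integral_0_iff_AE[symmetric]) auto
      thus ?thesis by eventually_elim auto
    next
      case False
      hence "AE x in lebesgue. indicator A x * (ennreal (\<bar>f x\<bar> powr p) * ennreal (\<sigma> x)) = 0"
        using e True by (subst nn_integral_0_iff_AE[symmetric]) auto
      thus ?thesis by eventually_elim (auto simp: indicator_def ennreal_eq_0_iff)
    qed
    hence "L = 0" unfolding L_def by (subst nn_integral_0_iff_AE) auto
    thus ?thesis by (simp add: L_def[symmetric])
  next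
    case False
    hence pos: "0 < m" "0 < e" using m e by auto
    define c where "c = (e / m) powr (1 / p)"
    have c: "0 < c" "c powr p * m = e" using pos p by (simp_all add: c_def powr_powr)
    have "ennreal (p * c powr (p - 1)) * L
        = (\<integral>\<^sup>+x. ennreal (p * c powr (p - 1)) * (indicator A x * (ennreal \<bar>f x\<bar> * ennreal (\<sigma> x))) \<partial>lebesgue)"
      unfolding L_def by (intro nn_integral_cmult[symmetric]) measurable
    also have "\<dots> \<le> (\<integral>\<^sup>+x. indicator A x * (ennreal (\<bar>f x\<bar> powr p) * ennreal (\<sigma> x))
        + ennreal ((p - 1) * c powr p) * (indicator A x * ennreal (\<sigma> x)) \<partial>lebesgue)"
    proof (rule nn_integral_mono)
      fix x
      have "p * \<bar>f x\<bar> * c powr (p - 1) * \<sigma> x \<le> (\<bar>f x\<bar> powr p + (p - 1) * c powr p) * \<sigma> x"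
        using p c \<sigma>(2)[of x] by (intro mult_right_mono Young_tangent) auto
      hence "ennreal (p * c powr (p - 1) * (\<bar>f x\<bar> * \<sigma> x))
          \<le> ennreal (\<bar>f x\<bar> powr p * \<sigma> x + (p - 1) * c powr p * \<sigma> x)"
        by (intro ennreal_leI) (simp add: algebra_simps)
      thus "ennreal (p * c powr (p - 1)) * (indicator A x * (ennreal \<bar>f x\<bar> * ennreal (\<sigma> x)))
        \<le> indicator A x * (ennreal (\<bar>f x\<bar> powr p) * ennreal (\<sigma> x))
        + ennreal ((p - 1) * c powr p) * (indicator A x * ennreal (\<sigma> x))"
        using p \<sigma>(2)[of x]
        by (cases "x \<in> A") (simp_all add: ennreal_mult[symmetric] ennreal_plus[symmetric] less_imp_le del: ennreal_plus)
    qed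
    also have "\<dots> = (\<integral>\<^sup>+x. indicator A x * (ennreal (\<bar>f x\<bar> powr p) * ennreal (\<sigma> x)) \<partial>lebesgue)
        + ennreal ((p - 1) * c powr p) * (\<integral>\<^sup>+x. indicator A x * ennreal (\<sigma> x) \<partial>lebesgue)"
      by (subst nn_integral_add) (simp_all add: nn_integral_cmult)
    also have "\<dots> = ennreal (e + (p - 1) * c powr p * m)"
      using e m p by (simp add: ennreal_mult[symmetric] ennreal_plus[symmetric] del: ennreal_plus)
    also have "e + (p - 1) * c powr p * m = p * c powr (p - 1) * (c * m)"
    proof -
      have "p * c powr (p - 1) * (c * m) = p * ((c powr (p - 1) * c) * m)" by (simp only: mult_ac)
      also have "c powr (p - 1) * c = c powr p" using c by (simp add: powr_diff)
      finally have "p * c powr (p - 1) * (c * m) = p * e" by (simp only: c(2))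
      moreover have "(p - 1) * c powr p * m = (p - 1) * e" by (simp only: mult.assoc c(2))
      ultimately show ?thesis by (simp only: left_diff_distrib)
    qed
    finally have le: "ennreal (p * c powr (p - 1)) * L \<le> ennreal (p * c powr (p - 1)) * ennreal (c * m)"
      using p c m by (simp add: ennreal_mult[symmetric])
    have "0 < p * c powr (p - 1)" using p c by simp
    hence "L \<le> ennreal (c * m)" using le
      by (subst (asm) ennreal_mult_le_mult_iff) (auto simp: ennreal_eq_0_iff)
    thus ?thesis by (simp add: L_def c_def)
  qed
qed

text \<open>A function on the atoms is a step function \<open>g\<close> on the whole space, to which the norm inequality
  applies. Conversely, a function \<open>g\<close> in \<open>L\<^sup>p(\<sigma>)\<close> is compared with the function \<open>f\<close> on the atoms whose
  values are the \<open>L\<^sup>p\<close> means of \<open>g\<close>: the norm does not increase, and the integrals over cubes do not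
  decrease.\<close>

lemma two_weight_bound_iff_forests:
  assumes C: "0 \<le> C"
  shows "two_weight_bound p r lam \<sigma> \<omega> C \<longleftrightarrow>
    (\<forall>D. cube_family D \<longrightarrow>
       forest_two_weight D p r \<kappa> (\<mu> D) (\<nu> D) C)"
proof -
  define E where "E = (\<lambda>f. \<integral>\<^sup>+x. ennreal (\<bar>f x\<bar> powr p) * ennreal (\<sigma> x) \<partial>lebesgue)"
  have E: "epowr (ennreal C * Lp_norm p \<sigma> (\<lambda>x. ennreal \<bar>f x\<bar>)) p = ennreal (C powr p) * E f" for f :: "real ^ 'n \<Rightarrow> real"
  proof -
    have "epowr (epowr (E f) (1 / p)) p = E f" using p by (intro epowr_epowr) auto
    thus ?thesis using p C by (simp add: epowr_mult epowr_ennreal Lp_norm_def E_def)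
  qed
  have Lp: "f \<in> Lp_space p \<sigma> \<longleftrightarrow> f \<in> borel_measurable lebesgue \<and> E f < \<infinity>" for f
    by (auto simp: Lp_space_def Lp_norm_def E_def epowr_ennreal epowr_def less_top)
  have le_iff: "(Lp_lr_norm p r \<omega> dyadic_cubes (T_op lam (\<lambda>x. f x * \<sigma> x))
        \<le> ennreal C * Lp_norm p \<sigma> (\<lambda>x. ennreal \<bar>f x\<bar>)) \<longleftrightarrow>
      (\<forall>F. cube_family F \<longrightarrow>
        ennreal (norm_sum F f)
          \<le> ennreal (C powr p) * E f)" for f
  proof -
    define c where "c = (\<lambda>Q. \<kappa> Q * weight_of (\<lambda>x. f x * \<sigma> x) Q)"
    have "T_op lam (\<lambda>x. f x * \<sigma> x) = (\<lambda>Q x. c Q * indicator Q x)"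
      by (intro ext) (simp add: T_op_eq c_def)
    moreover have "Lp_lr_norm p r \<omega> dyadic_cubes (\<lambda>Q x. c Q * indicator Q x) \<le> B \<longleftrightarrow>
      (\<forall>F. finite F \<and> {} \<subseteq> F \<and> F \<subseteq> dyadic_cubes \<longrightarrow>
        energy F c \<le> epowr B p)" for B
      by (rule Lp_lr_norm_le_iff[OF \<omega> _ _ _ r(1)]) (use p in auto)
    moreover have "energy F c
        = ennreal (\<Sum>q\<in>F. real_lr_norm r (upset F q) (\<lambda>Q. \<bar>c Q\<bar>) powr p * \<nu> F q)"
      if "finite F" "F \<subseteq> dyadic_cubes" for F
      unfolding upset_def using p by (intro nn_integral_lr_norm(1)[OF \<omega> that _ r(1)]) auto
    ultimately show ?thesis by (auto simp: E c_def)
  qed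
  show ?thesis
  proof (intro iffI allI impI)
    fix D :: "(real ^ 'n) set set"
    assume two: "two_weight_bound p r lam \<sigma> \<omega> C" and "cube_family D"
    hence D: "finite D" "D \<subseteq> dyadic_cubes" by auto
    let ?m = "\<mu> D" and ?n = "\<nu> D"
    show "forest_two_weight D p r \<kappa> ?m ?n C"
      unfolding forest_two_weight_def
    proof (intro allI impI)
      fix f :: "(real ^ 'n) set \<Rightarrow> real" assume f: "\<forall>q\<in>D. 0 \<le> f q"
      define g where "g = (\<lambda>x. \<Sum>q\<in>D. f q * indicator (atom D q) x)"
      have gm: "g \<in> borel_measurable lebesgue"
        unfolding g_def using atom_sets[OF D] by (intro borel_measurable_sum borel_measurable_times) auto
      have g0: "0 \<le> g x" for x unfolding g_def using f by (auto intro!: sum_nonneg)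
      have g_atom: "g x = f q" if "q \<in> D" "x \<in> atom D q" for q x
      proof -
        have "g x = (\<Sum>q'\<in>{q}. f q' * indicator (atom D q') x)"
          unfolding g_def using D that atom_unique[OF D(2)]
          by (intro sum.mono_neutral_right) (auto simp: indicator_def)
        thus ?thesis using that by simp
      qed
      have g_out: "g x = 0" if "x \<notin> \<Union>D" for x
        unfolding g_def using that atom_subset[of D] by (intro sum.neutral) (auto simp: indicator_def)
      have Eg: "E g = ennreal (\<Sum>q\<in>D. f q powr p * ?m q)"
        unfolding E_def
        by (rule nn_integral_atomwise[OF \<sigma> D]) (use g_atom g_out f p in auto)
      hence "g \<in> Lp_space p \<sigma>" using gm by (simp add: Lp)
      with two have "Lp_lr_norm p r \<omega> dyadic_cubes (T_op lam (\<lambda>x. g x * \<sigma> x))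
        \<le> ennreal C * Lp_norm p \<sigma> (\<lambda>x. ennreal \<bar>g x\<bar>)" by (simp add: two_weight_bound_def)
      hence "ennreal (norm_sum D g)
          \<le> ennreal (C powr p * (\<Sum>q\<in>D. f q powr p * ?m q))"
        using D unfolding le_iff Eg by (simp add: ennreal_mult')
      moreover have "\<bar>\<kappa> Q * weight_of (\<lambda>x. g x * \<sigma> x) Q\<bar> = \<kappa> Q * mass D (\<lambda>q. f q * ?m q) Q"
        if Q: "Q \<in> D" for Q
      proof -
        have "Q \<in> sets lebesgue" using dyadic_cube_borel[of Q] D Q by auto
        hence [measurable]: "(\<lambda>x. indicat_real Q x *\<^sub>R (g x * \<sigma> x)) \<in> borel_measurable lebesgue"
          using gm weight_measurable[OF \<sigma>(1)] by measurable
        have pos: "0 \<le> indicat_real Q x *\<^sub>R (g x * \<sigma> x)" for x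
          using g0[of x] \<sigma>(2)[of x] by (simp add: less_imp_le)
        have "weight_of (\<lambda>x. g x * \<sigma> x) Q
            = enn2real (\<integral>\<^sup>+x. ennreal (indicat_real Q x *\<^sub>R (g x * \<sigma> x)) \<partial>lebesgue)"
          unfolding weight_of_def set_lebesgue_integral_def
          by (rule integral_eq_nn_integral) (measurable, use pos in auto)
        also have "(\<integral>\<^sup>+x. ennreal (indicat_real Q x *\<^sub>R (g x * \<sigma> x)) \<partial>lebesgue)
            = (\<integral>\<^sup>+x. ennreal (indicat_real Q x * g x) * ennreal (\<sigma> x) \<partial>lebesgue)"
          using g0 \<sigma>(2) by (intro nn_integral_cong) (simp add: ennreal_mult[symmetric] less_imp_le mult.assoc)
        also have "\<dots> = ennreal (\<Sum>q\<in>D. (if q \<subseteq> Q then f q else 0) * ?m q)"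
        proof (rule nn_integral_atomwise[OF \<sigma> D])
          fix q x assume q: "q \<in> D" "x \<in> atom D q"
          have "x \<in> Q \<longleftrightarrow> q \<subseteq> Q" using atom_cubes[OF D(2) q] Q by (auto simp: upset_def)
          thus "ennreal (indicat_real Q x * g x) = ennreal (if q \<subseteq> Q then f q else 0)"
            using g_atom[OF q] by (auto simp: indicator_def)
        qed (use f g_out in auto)
        also have "(\<Sum>q\<in>D. (if q \<subseteq> Q then f q else 0) * ?m q) = mass D (\<lambda>q. f q * ?m q) Q"
          unfolding mass_def using D by (intro sum.mono_neutral_cong_right) auto
        finally have "weight_of (\<lambda>x. g x * \<sigma> x) Q = mass D (\<lambda>q. f q * ?m q) Q"
          using f atom_weight_nonneg[OF \<sigma> D] by (simp add: mass_nonneg)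
        moreover have "0 \<le> mass D (\<lambda>q. f q * ?m q) Q"
          using f atom_weight_nonneg[OF \<sigma> D] by (simp add: mass_nonneg)
        ultimately show ?thesis using coeff_density_nonneg[of Q] D Q by auto
      qed
      hence "real_lr_norm r (upset D q) (\<lambda>Q. \<bar>\<kappa> Q * weight_of (\<lambda>x. g x * \<sigma> x) Q\<bar>)
          = real_lr_norm r (upset D q) (\<lambda>Q. \<kappa> Q * mass D (\<lambda>q. f q * ?m q) Q)" for q
        by (intro real_lr_norm_cong) (simp add: upset_def)
      moreover have "0 \<le> C powr p * (\<Sum>q\<in>D. f q powr p * ?m q)"
        using atom_weight_nonneg[OF \<sigma> D] by (auto intro!: sum_nonneg mult_nonneg_nonneg)
      ultimately show "(\<Sum>q\<in>D. real_lr_norm r (upset D q) (\<lambda>Q. \<kappa> Q * mass D (\<lambda>q. f q * ?m q) Q) powr p * ?n q)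
          \<le> C powr p * (\<Sum>q\<in>D. f q powr p * ?m q)"
        by (simp add: ennreal_le_iff)
    qed
  next
    assume forests: "\<forall>D. cube_family D \<longrightarrow>
       forest_two_weight D p r \<kappa> (\<mu> D) (\<nu> D) C"
    show "two_weight_bound p r lam \<sigma> \<omega> C"
      unfolding two_weight_bound_def le_iff
    proof (intro ballI allI impI)
      fix g and D :: "(real ^ 'n) set set"
      assume "g \<in> Lp_space p \<sigma>" and "cube_family D"
      hence g: "g \<in> borel_measurable lebesgue" "E g < \<infinity>" and D: "finite D" "D \<subseteq> dyadic_cubes"
        by (auto simp: Lp)
      have [measurable]: "g \<in> borel_measurable lebesgue" "\<sigma> \<in> borel_measurable lebesgue"
        using g weight_measurable[OF \<sigma>(1)] by auto
      have atom_m [measurable]: "atom D q \<in> sets lebesgue" if "q \<in> D" for q using atom_sets[OF D that] .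
      let ?m = "\<mu> D" and ?n = "\<nu> D"
      note m0 = atom_weight_nonneg[OF \<sigma> D] and n0 = atom_weight_nonneg[OF \<omega> D]
      define I where "I = (\<lambda>A. \<integral>\<^sup>+x. indicator A x * (ennreal (\<bar>g x\<bar> powr p) * ennreal (\<sigma> x)) \<partial>lebesgue)"
      have sum_I: "(\<Sum>q\<in>D. I (atom D q)) \<le> E g"
      proof -
        have "(\<Sum>q\<in>D. I (atom D q))
            = (\<integral>\<^sup>+x. (\<Sum>q\<in>D. indicator (atom D q) x * (ennreal (\<bar>g x\<bar> powr p) * ennreal (\<sigma> x))) \<partial>lebesgue)"
          unfolding I_def by (intro nn_integral_sum[symmetric]) measurable
        also have "\<dots> \<le> E g"
          unfolding E_def
        proof (rule nn_integral_mono)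
          fix x
          have "(\<Sum>q\<in>D. indicator (atom D q) x) \<le> (1 :: ennreal)"
          proof (cases "\<exists>q\<in>D. x \<in> atom D q")
            case True
            then obtain q where q: "q \<in> D" "x \<in> atom D q" by blast
            have "(\<Sum>q\<in>D. indicator (atom D q) x) = (\<Sum>q\<in>{q}. indicator (atom D q) x :: ennreal)"
              using D q atom_unique[OF D(2)] by (intro sum.mono_neutral_right) (auto simp: indicator_def)
            thus ?thesis using q by simp
          next
            case False
            hence "(\<Sum>q\<in>D. indicator (atom D q) x) = (0 :: ennreal)"
              by (intro sum.neutral) (auto simp: indicator_def)
            thus ?thesis by simp
          qed
          hence "(\<Sum>q\<in>D. indicator (atom D q) x) * (ennreal (\<bar>g x\<bar> powr p) * ennreal (\<sigma> x))
              \<le> 1 * (ennreal (\<bar>g x\<bar> powr p) * ennreal (\<sigma> x))" by (intro mult_right_mono) auto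
          thus "(\<Sum>q\<in>D. indicator (atom D q) x * (ennreal (\<bar>g x\<bar> powr p) * ennreal (\<sigma> x)))
              \<le> ennreal (\<bar>g x\<bar> powr p) * ennreal (\<sigma> x)" by (simp add: sum_distrib_right)
        qed
        finally show ?thesis .
      qed
      have I_fin: "I (atom D q) = ennreal (enn2real (I (atom D q)))" if "q \<in> D" for q
      proof -
        have "I (atom D q) \<le> (\<Sum>q\<in>D. I (atom D q))" using D that by (intro member_le_sum) auto
        also have "\<dots> < \<infinity>" using sum_I g(2) by (rule le_less_trans)
        finally show ?thesis by simp
      qed
      define f where "f = (\<lambda>q. (enn2real (I (atom D q)) / ?m q) powr (1 / p))"
      have f0: "0 \<le> f q" for q by (simp add: f_def)
      have part: "(\<integral>\<^sup>+x. indicator (atom D q) x * (ennreal \<bar>g x\<bar> * ennreal (\<sigma> x)) \<partial>lebesgue)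
          \<le> ennreal (f q * ?m q)" if q: "q \<in> D" for q
        unfolding f_def
      proof (rule nn_integral_Holder_on[OF g(1) atom_m[OF q]])
        show "(\<integral>\<^sup>+x. indicator (atom D q) x * ennreal (\<sigma> x) \<partial>lebesgue) = ennreal (?m q)"
          unfolding atom_weight_def using D q
          by (intro nn_integral_weight(1)[OF \<sigma> atom_m[OF q] atom_subset]) auto
        show "(\<integral>\<^sup>+x. indicator (atom D q) x * (ennreal (\<bar>g x\<bar> powr p) * ennreal (\<sigma> x)) \<partial>lebesgue)
            = ennreal (enn2real (I (atom D q)))" using I_fin[OF q] by (simp add: I_def)
      qed (use m0 q in auto)
      have avg: "\<bar>weight_of (\<lambda>x. g x * \<sigma> x) Q\<bar> \<le> mass D (\<lambda>q. f q * ?m q) Q" if Q: "Q \<in> D" for Q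
        \<comment> \<open>By convention, the average of a non-integrable function is \<open>0\<close>.\<close>
      proof (cases "set_integrable lebesgue Q (\<lambda>x. g x * \<sigma> x)")
        case False
        hence "weight_of (\<lambda>x. g x * \<sigma> x) Q = 0"
          unfolding weight_of_def set_lebesgue_integral_def set_integrable_def
          by (rule not_integrable_integral_eq)
        thus ?thesis using m0 f0 by (simp add: mass_nonneg)
      next
        case True
        have "ennreal \<bar>weight_of (\<lambda>x. g x * \<sigma> x) Q\<bar>
            \<le> (\<integral>\<^sup>+x. ennreal (norm (indicat_real Q x *\<^sub>R (g x * \<sigma> x))) \<partial>lebesgue)"
          using integral_norm_bound_ennreal[OF True[unfolded set_integrable_def]]
          by (simp add: weight_of_def set_lebesgue_integral_def)
        also have "\<dots> \<le> (\<integral>\<^sup>+x. (\<Sum>q\<in>{q\<in>D. q \<subseteq> Q}. indicator (atom D q) x * (ennreal \<bar>g x\<bar> * ennreal (\<sigma> x))) \<partial>lebesgue)"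
        proof (rule nn_integral_mono)
          fix x
          show "ennreal (norm (indicat_real Q x *\<^sub>R (g x * \<sigma> x)))
            \<le> (\<Sum>q\<in>{q\<in>D. q \<subseteq> Q}. indicator (atom D q) x * (ennreal \<bar>g x\<bar> * ennreal (\<sigma> x)))"
          proof (cases "x \<in> Q")
            case True
            then obtain q where q: "q \<in> D" "x \<in> atom D q" using atom_exists[OF D(1) Q] by blast
            have "q \<subseteq> Q" using atom_cubes[OF D(2) q] Q True by (auto simp: upset_def)
            hence "indicator (atom D q) x * (ennreal \<bar>g x\<bar> * ennreal (\<sigma> x))
                \<le> (\<Sum>q\<in>{q\<in>D. q \<subseteq> Q}. indicator (atom D q) x * (ennreal \<bar>g x\<bar> * ennreal (\<sigma> x)))"
              using D q by (intro member_le_sum[where f = "\<lambda>q. indicator (atom D q) x * (ennreal \<bar>g x\<bar> * ennreal (\<sigma> x))"]) auto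
            moreover have "ennreal (norm (indicat_real Q x *\<^sub>R (g x * \<sigma> x)))
                = indicator (atom D q) x * (ennreal \<bar>g x\<bar> * ennreal (\<sigma> x))"
              using True q \<sigma>(2)[of x] by (simp add: abs_mult ennreal_mult[symmetric])
            ultimately show ?thesis by simp
          qed simp
        qed
        also have "\<dots> = (\<Sum>q\<in>{q\<in>D. q \<subseteq> Q}.
            \<integral>\<^sup>+x. indicator (atom D q) x * (ennreal \<bar>g x\<bar> * ennreal (\<sigma> x)) \<partial>lebesgue)"
          by (intro nn_integral_sum) simp
        also have "\<dots> \<le> (\<Sum>q\<in>{q\<in>D. q \<subseteq> Q}. ennreal (f q * ?m q))"
          using part by (intro sum_mono) auto
        also have "\<dots> = ennreal (mass D (\<lambda>q. f q * ?m q) Q)"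
          unfolding mass_def using f0 m0 by (intro sum_ennreal) auto
        finally show ?thesis using f0 m0 by (simp add: ennreal_le_iff mass_nonneg)
      qed
      have "(norm_sum D g)
          \<le> (\<Sum>q\<in>D. real_lr_norm r (upset D q) (\<lambda>Q. \<kappa> Q * mass D (\<lambda>q. f q * ?m q) Q) powr p * ?n q)"
      proof (intro sum_mono mult_right_mono powr_mono2 real_lr_norm_mono r(1) n0)
        fix q Q assume "Q \<in> upset D q"
        hence Q: "Q \<in> D" by (simp add: upset_def)
        thus "\<bar>\<kappa> Q * weight_of (\<lambda>x. g x * \<sigma> x) Q\<bar> \<le> \<kappa> Q * mass D (\<lambda>q. f q * ?m q) Q"
          using coeff_density_nonneg[of Q] D avg[OF Q] by (auto simp: abs_mult intro!: mult_left_mono)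
      qed (use p D in \<open>auto simp: upset_def intro!: real_lr_norm_nonneg\<close>)
      also have "\<dots> \<le> C powr p * (\<Sum>q\<in>D. f q powr p * ?m q)"
        using forests D f0 unfolding forest_two_weight_def by blast
      also have "\<dots> \<le> C powr p * (\<Sum>q\<in>D. enn2real (I (atom D q)))"
      proof (intro mult_left_mono sum_mono)
        fix q assume q: "q \<in> D"
        show "f q powr p * ?m q \<le> enn2real (I (atom D q))"
          using p m0[OF q] by (cases "?m q = 0") (simp_all add: f_def powr_powr)
      qed simp
      finally have "ennreal (norm_sum D g)
          \<le> ennreal (C powr p * (\<Sum>q\<in>D. enn2real (I (atom D q))))" by (rule ennreal_leI)
      also have "\<dots> = ennreal (C powr p) * (\<Sum>q\<in>D. I (atom D q))"
        using I_fin by (simp add: ennreal_mult' sum_nonneg sum_ennreal[symmetric] del: sum_ennreal)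
      also have "\<dots> \<le> ennreal (C powr p) * E g" using sum_I by (intro mult_left_mono) auto
      finally show "ennreal (norm_sum D g)
          \<le> ennreal (C powr p) * E g" .
    qed
  qed
qed


text \<open>Together with the next lemma: for a sequence of constants on the cubes of \<open>D\<close>, the essential
  supremum of the norm is its maximum over the atoms of positive weight.\<close>

lemma Linf_lr_norm_le:
  assumes D: "finite D" "D \<subseteq> dyadic_cubes"
    and a: "\<And>Q. 0 \<le> a Q" "\<And>Q. Q \<notin> D \<Longrightarrow> a Q = 0" and L: "0 \<le> L"
    and bound: "\<And>q. q \<in> D \<Longrightarrow> 0 < \<nu> D q \<Longrightarrow> real_lr_norm r' (upset D q) a \<le> L"
  shows "Linf_lr_norm r' \<omega> dyadic_cubes (\<lambda>Q x. a Q * indicator Q x) \<le> ennreal L"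
proof -
  have \<omega>_m [measurable]: "\<omega> \<in> borel_measurable lebesgue" using weight_measurable[OF \<omega>(1)] .
  define h where "h = (\<lambda>x. lr_norm r' dyadic_cubes (\<lambda>Q. a Q * indicator Q x))"
  have h_eq: "h x = ennreal (real_lr_norm r' {Q\<in>D. x \<in> Q} a)" for x
  proof -
    have "h x = lr_norm r' D (\<lambda>Q. a Q * indicator Q x)"
    proof (rule antisym)
      show "h x \<le> lr_norm r' D (\<lambda>Q. a Q * indicator Q x)"
        unfolding h_def lr_norm_eq_SUP[OF conjugate_r_ge_1, of dyadic_cubes]
      proof (rule SUP_least)
        fix F assume "F \<in> {F. finite F \<and> F \<subseteq> (dyadic_cubes :: (real ^ 'n) set set)}"
        hence F: "finite F" by simp
        define b where "b = (\<lambda>Q. a Q * indicator Q x)"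
        have "real_lr_norm r' F (\<lambda>Q. \<bar>b Q\<bar>) \<le> real_lr_norm r' (F \<union> D) (\<lambda>Q. \<bar>b Q\<bar>)"
          using F D by (intro real_lr_norm_mono conjugate_r_ge_1) auto
        also have "\<dots> = real_lr_norm r' (F \<union> D) (\<lambda>Q. if Q \<in> D then \<bar>b Q\<bar> else 0)"
          by (intro real_lr_norm_cong) (simp add: b_def a)
        also have "\<dots> = real_lr_norm r' D (\<lambda>Q. \<bar>b Q\<bar>)"
          using F D by (intro real_lr_norm_zero_extension conjugate_r_ge_1) auto
        finally show "lr_norm r' F (\<lambda>Q. a Q * indicator Q x) \<le> lr_norm r' D (\<lambda>Q. a Q * indicator Q x)"
          using F D by (simp add: lr_norm_finite[OF conjugate_r_ge_1] b_def ennreal_leI)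
      qed
      show "lr_norm r' D (\<lambda>Q. a Q * indicator Q x) \<le> h x"
        unfolding h_def using D by (intro lr_norm_subset_mono conjugate_r_ge_1) auto
    qed
    thus ?thesis using a by (simp add: lr_norm_indicator[OF conjugate_r_ge_1 D(1)])
  qed
  have h_atom: "h x = ennreal (real_lr_norm r' (upset D q) a)" if "q \<in> D" "x \<in> atom D q" for q x
    using atom_cubes[OF D(2) that] by (simp add: h_eq)
  have h_out: "h x = 0" if "x \<notin> \<Union>D" for x
  proof -
    have none: "{Q\<in>D. x \<in> Q} = {}" using that by auto
    show ?thesis unfolding h_eq none by simp
  qed
  have "h \<in> borel_measurable lebesgue"
    by (rule atomwise_measurable[OF D]) (use h_atom h_out in auto)
  hence h_m: "h \<in> borel_measurable (density lebesgue (\<lambda>x. ennreal (\<omega> x)))" by simp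
  have null: "AE x in lebesgue. x \<notin> atom D q" if q: "q \<in> D" "\<not> 0 < \<nu> D q" for q
  proof -
    have [measurable]: "atom D q \<in> sets lebesgue" using atom_sets[OF D q(1)] .
    have "\<nu> D q = 0" using atom_weight_nonneg[OF \<omega> D q(1)] q by simp
    hence "(\<integral>\<^sup>+x. indicator (atom D q) x * ennreal (\<omega> x) \<partial>lebesgue) = 0"
      using nn_integral_weight(1)[OF \<omega> atom_sets[OF D q(1)] atom_subset] D q
      by (auto simp: atom_weight_def)
    hence "AE x in lebesgue. indicator (atom D q) x * ennreal (\<omega> x) = 0"
      by (subst (asm) nn_integral_0_iff_AE) auto
    thus ?thesis
    proof eventually_elim
      fix x assume "indicator (atom D q) x * ennreal (\<omega> x) = 0"
      thus "x \<notin> atom D q" using \<omega>(2)[of x] by (auto simp: indicator_def ennreal_eq_0_iff not_le)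
    qed
  qed
  have "AE x in lebesgue. \<forall>q\<in>{q\<in>D. \<not> 0 < \<nu> D q}. x \<notin> atom D q"
    using D null by (intro AE_finite_allI) auto
  hence "AE x in lebesgue. h x \<le> ennreal L"
  proof eventually_elim
    fix x assume x: "\<forall>q\<in>{q\<in>D. \<not> 0 < \<nu> D q}. x \<notin> atom D q"
    show "h x \<le> ennreal L"
    proof (cases "x \<in> \<Union>D")
      case True
      then obtain q where q: "q \<in> D" "x \<in> atom D q" using atom_exists[OF D(1)] by blast
      hence "real_lr_norm r' (upset D q) a \<le> L" using x by (intro bound) auto
      thus ?thesis by (simp add: h_atom[OF q] ennreal_leI)
    qed (simp add: h_out)
  qed
  hence "AE x in density lebesgue (\<lambda>x. ennreal (\<omega> x)). h x \<le> ennreal L"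
    by (subst AE_density) auto
  thus ?thesis unfolding Linf_lr_norm_def Linf_norm_def h_def[symmetric] by (intro esssup_I h_m)
qed

lemma le_Linf_lr_norm:
  assumes D: "finite D" "D \<subseteq> dyadic_cubes" and a: "\<And>Q. Q \<in> dyadic_cubes \<Longrightarrow> 0 \<le> a Q"
    and q: "q \<in> D" "0 < \<nu> D q"
  shows "ennreal (real_lr_norm r' (upset D q) a) \<le> Linf_lr_norm r' \<omega> dyadic_cubes (\<lambda>Q x. a Q * indicator Q x)"
proof (rule ccontr)
  define h where "h = (\<lambda>x. lr_norm r' dyadic_cubes (\<lambda>Q. a Q * indicator Q x))"
  have [measurable]: "\<omega> \<in> borel_measurable lebesgue" using weight_measurable[OF \<omega>(1)] .
  have [measurable]: "atom D q \<in> sets lebesgue" using atom_sets[OF D q(1)] .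
  assume small: "\<not> ?thesis"
  have "AE x in density lebesgue (\<lambda>x. ennreal (\<omega> x)). h x \<le> Linf_lr_norm r' \<omega> dyadic_cubes (\<lambda>Q x. a Q * indicator Q x)"
    unfolding Linf_lr_norm_def Linf_norm_def h_def[symmetric] by (rule esssup_AE)
  hence "AE x in lebesgue. 0 < ennreal (\<omega> x) \<longrightarrow> h x \<le> Linf_lr_norm r' \<omega> dyadic_cubes (\<lambda>Q x. a Q * indicator Q x)"
    by (subst (asm) AE_density) auto
  hence "AE x in lebesgue. indicator (atom D q) x * ennreal (\<omega> x) = 0"
  proof eventually_elim
    fix x assume x: "0 < ennreal (\<omega> x) \<longrightarrow> h x \<le> Linf_lr_norm r' \<omega> dyadic_cubes (\<lambda>Q x. a Q * indicator Q x)"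
    have "x \<notin> atom D q"
    proof
      assume xq: "x \<in> atom D q"
      have "real_lr_norm r' (upset D q) (\<lambda>Q. \<bar>a Q\<bar>) = real_lr_norm r' (upset D q) a"
        using a D by (intro real_lr_norm_cong) (auto simp: upset_def)
      hence "ennreal (real_lr_norm r' (upset D q) a) = lr_norm r' D (\<lambda>Q. a Q * indicator Q x)"
        using atom_cubes[OF D(2) q(1) xq] by (simp add: lr_norm_indicator[OF conjugate_r_ge_1 D(1)])
      also have "\<dots> \<le> h x" unfolding h_def using D by (intro lr_norm_subset_mono conjugate_r_ge_1) auto
      also have "\<dots> \<le> Linf_lr_norm r' \<omega> dyadic_cubes (\<lambda>Q x. a Q * indicator Q x)"
        using x \<omega>(2)[of x] by simp
      finally show False using small by simp
    qed
    thus "indicator (atom D q) x * ennreal (\<omega> x) = 0" by simp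
  qed
  hence "(\<integral>\<^sup>+x. indicator (atom D q) x * ennreal (\<omega> x) \<partial>lebesgue) = 0"
    by (subst nn_integral_0_iff_AE) auto
  moreover have "(\<integral>\<^sup>+x. indicator (atom D q) x * ennreal (\<omega> x) \<partial>lebesgue) = ennreal (\<nu> D q)"
    unfolding atom_weight_def using D q
    by (intro nn_integral_weight(1)[OF \<omega> atom_sets[OF D q(1)] atom_subset]) auto
  ultimately show False using q by (simp add: ennreal_eq_0_iff)
qed

lemma Lp_norm_T_adj_le_iff:
  assumes a: "\<And>Q. Q \<in> dyadic_cubes \<Longrightarrow> 0 \<le> a Q" and R: "R \<in> dyadic_cubes"
  shows "Lp_norm p' \<sigma> (T_adj lam R (\<lambda>Q x. a Q * indicator Q x * \<omega> x)) \<le> B \<longleftrightarrow>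
    (\<forall>D. cube_family D \<and> R \<in> D \<longrightarrow>
      ennreal (adjoint_sum D R a) \<le> epowr B p')"
proof -
  have p': "1 < p'" using conjugate_gt_1[OF p] by simp
  define d where "d = (\<lambda>Q. \<kappa> Q * a Q * weight_of \<omega> Q)"
  define S where "S = (\<lambda>F x. \<Sum>\<^sub>\<infinity>Q\<in>F. ennreal (d Q * indicator Q x))"
  let ?I = "dyadic_subcubes R :: (real ^ 'n) set set"
  have I: "?I \<subseteq> dyadic_cubes" by (auto simp: dyadic_subcubes_def)
  have d0: "0 \<le> d Q" if "Q \<in> dyadic_cubes" for Q
    using that coeff_density_nonneg a weight_of_nonneg by (simp add: d_def)
  have wt: "weight_of (\<lambda>x. a Q * indicator Q x * \<omega> x) Q = a Q * weight_of \<omega> Q" for Q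
  proof -
    have "weight_of (\<lambda>x. a Q * indicator Q x * \<omega> x) Q
        = (LINT x|lebesgue. a Q * (indicat_real Q x *\<^sub>R \<omega> x))"
      unfolding weight_of_def set_lebesgue_integral_def
      by (intro Bochner_Integration.integral_cong) (auto simp: indicator_def)
    thus ?thesis by (simp add: weight_of_def set_lebesgue_integral_def)
  qed
  have avg: "average Q (\<lambda>x. a Q * indicator Q x * \<omega> x) = a Q * weight_of \<omega> Q / measure lebesgue Q" for Q
    unfolding average_def weight_of_def[symmetric] wt ..
  have lam_avg: "lam Q * average Q (\<lambda>x. a Q * indicator Q x * \<omega> x) = d Q" for Q
    unfolding avg by (simp add: d_def coeff_density_def)
  have T: "T_adj lam R (\<lambda>Q x. a Q * indicator Q x * \<omega> x) x = S ?I x" for x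
    unfolding T_adj_def S_def
    by (intro infsum_cong) (simp only: lam_avg)
  let ?J = "\<lambda>F. \<integral>\<^sup>+x. epowr (S F x) p' * ennreal (\<sigma> x) \<partial>lebesgue"
  have S_SUP: "S F x = (SUP F\<in>{G. finite G \<and> G \<subseteq> F}. S F x)" for F x
  proof -
    have "S F x = (SUP F\<in>{G. finite G \<and> G \<subseteq> F}. \<Sum>Q\<in>F. ennreal (d Q * indicator Q x))"
      unfolding S_def by (rule nonneg_infsum_complete) simp
    also have "\<dots> = (SUP F\<in>{G. finite G \<and> G \<subseteq> F}. S F x)"
      by (intro SUP_cong) (auto simp: S_def)
    finally show ?thesis .
  qed
  have S_atom: "epowr (S F x) p' = ennreal ((\<Sum>Q\<in>{Q\<in>F. q \<subseteq> Q}. d Q) powr p')"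
    if D: "finite D" "D \<subseteq> dyadic_cubes" and F: "F \<subseteq> D" and q: "q \<in> D" "x \<in> atom D q" for D F q x
  proof -
    have "finite F" using F D finite_subset by blast
    have mem: "x \<in> Q \<longleftrightarrow> q \<subseteq> Q" if "Q \<in> F" for Q
      using atom_cubes[OF D(2) q] F that by (auto simp: upset_def)
    have "S F x = (\<Sum>Q\<in>F. ennreal (d Q * indicator Q x))" using \<open>finite F\<close> by (simp add: S_def)
    also have "\<dots> = ennreal (\<Sum>Q\<in>F. d Q * indicator Q x)"
      using d0 F D by (intro sum_ennreal mult_nonneg_nonneg) auto
    also have "(\<Sum>Q\<in>F. d Q * indicator Q x) = (\<Sum>Q\<in>{Q\<in>F. q \<subseteq> Q}. d Q)"
      using \<open>finite F\<close> mem by (intro sum.mono_neutral_cong_right) (auto simp: indicator_def)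
    finally have "S F x = ennreal (\<Sum>Q\<in>{Q\<in>F. q \<subseteq> Q}. d Q)" .
    moreover have "0 \<le> (\<Sum>Q\<in>{Q\<in>F. q \<subseteq> Q}. d Q)" by (intro sum_nonneg d0) (use F D in auto)
    ultimately show ?thesis by (simp add: epowr_ennreal)
  qed
  have S_out: "epowr (S F x) p' = 0"
    if D: "finite D" "D \<subseteq> dyadic_cubes" and F: "F \<subseteq> D" and x: "x \<notin> \<Union>D" for D F x
  proof -
    have "S F x = (\<Sum>\<^sub>\<infinity>Q\<in>F. 0)"
      unfolding S_def using F x by (intro infsum_cong) (auto simp: indicator_def)
    thus ?thesis by simp
  qed
  have S_int: "?J F
      = ennreal (\<Sum>q\<in>D. (\<Sum>Q\<in>{Q\<in>F. q \<subseteq> Q}. d Q) powr p' * \<mu> D q)"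
    if D: "finite D" "D \<subseteq> dyadic_cubes" and F: "F \<subseteq> D" for D F
    by (rule nn_integral_atomwise[OF \<sigma> D]) (use S_atom[OF D F] S_out[OF D F] in auto)
  have "Lp_norm p' \<sigma> (T_adj lam R (\<lambda>Q x. a Q * indicator Q x * \<omega> x)) \<le> B \<longleftrightarrow>
      ?J ?I \<le> epowr B p'"
    using p' by (subst Lp_norm_le_iff) (auto simp: T)
  also have "\<dots> \<longleftrightarrow> (\<forall>F. finite F \<and> {R} \<subseteq> F \<and> F \<subseteq> ?I \<longrightarrow>
      ?J F \<le> epowr B p')"
  proof (rule nn_integral_le_iff_finite)
    show "countable ?I" using countable_dyadic_cubes I countable_subset by blast
    show "epowr (S ?I x) p' * ennreal (\<sigma> x) =
        (SUP F\<in>{F. finite F \<and> F \<subseteq> ?I}. epowr (S F x) p' * ennreal (\<sigma> x))" for x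
      using p' by (subst S_SUP) (simp add: epowr_SUP SUP_mult_right_ennreal)
    show "epowr (S F x) p' * ennreal (\<sigma> x) \<le> epowr (S G x) p' * ennreal (\<sigma> x)" if "F \<subseteq> G" for F G x
    proof (intro mult_right_mono epowr_mono)
      show "S F x \<le> S G x"
        by (subst (1 2) S_SUP) (use that in \<open>auto intro!: SUP_subset_mono\<close>)
    qed (use p' in auto)
    fix F assume F: "finite F" "F \<subseteq> ?I"
    hence F': "F \<subseteq> dyadic_cubes" using I by blast
    have "(\<lambda>x. epowr (S F x) p') \<in> borel_measurable lebesgue"
      by (rule atomwise_measurable[OF F(1) F'])
        (use S_atom[OF F(1) F' order.refl] S_out[OF F(1) F' order.refl] in auto)
    thus "(\<lambda>x. epowr (S F x) p' * ennreal (\<sigma> x)) \<in> borel_measurable lebesgue"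
      using weight_measurable[OF \<sigma>(1)] by (intro borel_measurable_times_ennreal) auto
  qed (use R in \<open>auto simp: dyadic_subcubes_def\<close>)
  also have "\<dots> \<longleftrightarrow> (\<forall>D. cube_family D \<and> R \<in> D \<longrightarrow>
      ?J {Q\<in>D. Q \<subseteq> R} \<le> epowr B p')"
  proof (intro iffI allI impI)
    fix D :: "(real ^ 'n) set set"
    assume t: "\<forall>F. finite F \<and> {R} \<subseteq> F \<and> F \<subseteq> ?I \<longrightarrow>
      ?J F \<le> epowr B p'"
      and D: "cube_family D \<and> R \<in> D"
    show "?J {Q\<in>D. Q \<subseteq> R} \<le> epowr B p'"
      using D by (intro t[rule_format]) (auto simp: dyadic_subcubes_def)
  next
    fix F :: "(real ^ 'n) set set"
    assume t: "\<forall>D. cube_family D \<and> R \<in> D \<longrightarrow>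
      ?J {Q\<in>D. Q \<subseteq> R} \<le> epowr B p'"
      and F: "finite F \<and> {R} \<subseteq> F \<and> F \<subseteq> ?I"
    have "{Q\<in>F. Q \<subseteq> R} = F" using F by (auto simp: dyadic_subcubes_def)
    thus "?J F \<le> epowr B p'"
      using t[rule_format, of F] F I by auto
  qed
  also have "\<dots> \<longleftrightarrow> (\<forall>D. cube_family D \<and> R \<in> D \<longrightarrow>
      ennreal (adjoint_sum D R a) \<le> epowr B p')"
  proof -
    have "?J {Q\<in>D. Q \<subseteq> R} =
      ennreal (adjoint_sum D R a)"
      if D: "finite D" "D \<subseteq> dyadic_cubes" for D
    proof -
      have "{Q\<in>{Q\<in>D. Q \<subseteq> R}. q \<subseteq> Q} = {Q\<in>upset D q. Q \<subseteq> R}" for q by (auto simp: upset_def)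
      moreover have "(\<Sum>Q\<in>{Q\<in>upset D q. Q \<subseteq> R}. d Q)
          = (\<Sum>Q\<in>{Q\<in>upset D q. Q \<subseteq> R}. \<kappa> Q * a Q * mass D (\<nu> D) Q)" for q
        using weight_of_cube[OF \<omega> D] by (intro sum.cong) (auto simp: d_def upset_def)
      ultimately show ?thesis by (subst S_int[OF D]) auto
    qed
    thus ?thesis by auto
  qed
  finally show ?thesis .
qed

text \<open>For the implication from forests to cubes, the bound \<open>L\<close> is taken as the maximum over the finitely
  many atoms of positive weight. It is finite even if the essential supremum is not, and the product of \<open>C = 0\<close>
  with an infinite norm does not arise.\<close>

lemma dual_testing_bound_iff_forests:
  assumes C: "0 \<le> C"
  shows "dual_testing_bound p' r' lam \<sigma> \<omega> C \<longleftrightarrow>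
    (\<forall>D. cube_family D \<longrightarrow>
       forest_dual_testing D p' r' \<kappa> (\<mu> D) (\<nu> D) C)"
proof (intro iffI allI impI)
  have p': "1 < p'" using conjugate_gt_1[OF p] by simp
  fix D :: "(real ^ 'n) set set"
  assume dual: "dual_testing_bound p' r' lam \<sigma> \<omega> C" and "cube_family D"
  hence D: "finite D" "D \<subseteq> dyadic_cubes" by auto
  note m0 = atom_weight_nonneg[OF \<sigma> D] and n0 = atom_weight_nonneg[OF \<omega> D]
  show "forest_dual_testing D p' r' \<kappa> (\<mu> D) (\<nu> D) C"
    unfolding forest_dual_testing_def
  proof (intro ballI allI impI)
    fix R :: "(real ^ 'n) set" and a :: "(real ^ 'n) set \<Rightarrow> real" and L :: real
    assume R: "R \<in> D" and a: "\<forall>Q\<in>D. 0 \<le> a Q" and L: "0 \<le> L"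
      and bound: "\<forall>q\<in>D. 0 < \<nu> D q \<longrightarrow> real_lr_norm r' (upset D q) a \<le> L"
    have RD: "R \<in> dyadic_cubes" using R D by auto
    define b where "b = (\<lambda>Q. if Q \<in> D then a Q else 0)"
    have b0: "0 \<le> b Q" for Q using a by (simp add: b_def)
    have "real_lr_norm r' (upset D q) b = real_lr_norm r' (upset D q) a" for q
      by (intro real_lr_norm_cong) (simp add: b_def upset_def)
    hence Linf: "Linf_lr_norm r' \<omega> dyadic_cubes (\<lambda>Q x. b Q * indicator Q x) \<le> ennreal L"
      using bound by (intro Linf_lr_norm_le[OF D b0 _ L]) (auto simp: b_def)
    have "Lp_norm p' \<sigma> (T_adj lam R (\<lambda>Q x. b Q * indicator Q x * \<omega> x))
        \<le> ennreal C * Linf_lr_norm r' \<omega> dyadic_cubes (\<lambda>Q x. b Q * indicator Q x)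
            * ennreal (weight_of \<omega> R powr (1 / p'))"
      using dual b0 RD unfolding dual_testing_bound_def Let_def by blast
    also have "\<dots> \<le> ennreal C * ennreal L * ennreal (weight_of \<omega> R powr (1 / p'))"
      by (intro mult_right_mono mult_left_mono Linf) auto
    also have "\<dots> = ennreal (C * L * weight_of \<omega> R powr (1 / p'))"
      using C L by (simp add: ennreal_mult)
    finally have "ennreal (adjoint_sum D R b)
       \<le> epowr (ennreal (C * L * weight_of \<omega> R powr (1 / p'))) p'"
      using D R b0 RD by (subst (asm) Lp_norm_T_adj_le_iff) auto
    also have "\<dots> = ennreal ((C * L) powr p' * mass D (\<nu> D) R)"
      using C L p' weight_of_nonneg(2)[OF RD]
      by (simp add: epowr_ennreal powr_mult[of "C * L"] powr_powr weight_of_cube[OF \<omega> D R])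
    finally have "(adjoint_sum D R b)
       \<le> (C * L) powr p' * mass D (\<nu> D) R"
      using n0 by (subst (asm) ennreal_le_iff) (auto intro!: mult_nonneg_nonneg mass_nonneg)
    moreover have "(\<Sum>Q\<in>{Q\<in>upset D q. Q \<subseteq> R}. \<kappa> Q * b Q * mass D (\<nu> D) Q)
        = (\<Sum>Q\<in>{Q\<in>upset D q. Q \<subseteq> R}. \<kappa> Q * a Q * mass D (\<nu> D) Q)" for q
      by (intro sum.cong) (auto simp: b_def upset_def)
    ultimately show "(adjoint_sum D R a)
       \<le> (C * L) powr p' * mass D (\<nu> D) R"
      by simp
  qed
next
  have p': "1 < p'" using conjugate_gt_1[OF p] by simp
  assume forests: "\<forall>D. cube_family D \<longrightarrow>
       forest_dual_testing D p' r' \<kappa> (\<mu> D) (\<nu> D) C"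
  show "dual_testing_bound p' r' lam \<sigma> \<omega> C"
    unfolding dual_testing_bound_def Let_def
  proof (intro ballI allI impI)
    fix R :: "(real ^ 'n) set" and a :: "(real ^ 'n) set \<Rightarrow> real"
    assume R: "R \<in> dyadic_cubes" and a: "\<forall>Q\<in>dyadic_cubes. 0 \<le> a Q"
    let ?Linf = "Linf_lr_norm r' \<omega> dyadic_cubes (\<lambda>Q x. a Q * indicator Q x)"
    show "Lp_norm p' \<sigma> (T_adj lam R (\<lambda>Q x. a Q * indicator Q x * \<omega> x))
        \<le> ennreal C * ?Linf * ennreal (weight_of \<omega> R powr (1 / p'))"
    proof (subst Lp_norm_T_adj_le_iff)
      show "\<forall>D. cube_family D \<and> R \<in> D \<longrightarrow>
        ennreal (adjoint_sum D R a)
        \<le> epowr (ennreal C * ?Linf * ennreal (weight_of \<omega> R powr (1 / p'))) p'"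
      proof (intro allI impI)
        fix D :: "(real ^ 'n) set set" assume "cube_family D \<and> R \<in> D"
        hence D: "finite D" "D \<subseteq> dyadic_cubes" and RD: "R \<in> D" by auto
        define X where "X = insert 0 ((\<lambda>q. real_lr_norm r' (upset D q) a) ` {q\<in>D. 0 < \<nu> D q})"
        define L where "L = Max X"
        have X: "finite X" "X \<noteq> {}" using D by (auto simp: X_def)
        have L0: "0 \<le> L" unfolding L_def using X by (intro Max_ge) (auto simp: X_def)
        have "L \<in> X" unfolding L_def using X by (rule Max_in)
        hence L_le: "ennreal L \<le> ?Linf"
          unfolding X_def using le_Linf_lr_norm[OF D] a by auto
        have "real_lr_norm r' (upset D q) a \<le> L" if "q \<in> D" "0 < \<nu> D q" for q
          unfolding L_def using X that by (intro Max_ge) (auto simp: X_def)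
        hence L_ge: "\<forall>q\<in>D. 0 < \<nu> D q \<longrightarrow> real_lr_norm r' (upset D q) a \<le> L" by blast
        have aD: "\<forall>Q\<in>D. 0 \<le> a Q" using a D by blast
        have test: "forest_dual_testing D p' r' \<kappa> (\<mu> D) (\<nu> D) C"
          using forests D by simp
        have "(adjoint_sum D R a)
          \<le> (C * L) powr p' * mass D (\<nu> D) R"
          by (rule test[unfolded forest_dual_testing_def, THEN bspec, OF RD, THEN spec, THEN spec,
                THEN mp, OF aD, THEN mp, OF L0, THEN mp, OF L_ge])
        hence "ennreal (adjoint_sum D R a)
          \<le> ennreal ((C * L) powr p' * weight_of \<omega> R)"
          by (simp add: weight_of_cube[OF \<omega> D RD] ennreal_leI)
        also have "\<dots> = epowr (ennreal (C * L * weight_of \<omega> R powr (1 / p'))) p'"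
          using C L0 p' weight_of_nonneg(2)[OF R]
          by (simp add: epowr_ennreal powr_mult[of "C * L"] powr_powr)
        also have "ennreal (C * L * weight_of \<omega> R powr (1 / p'))
            = ennreal C * ennreal L * ennreal (weight_of \<omega> R powr (1 / p'))"
          using C L0 by (simp add: ennreal_mult)
        also have "epowr (ennreal C * ennreal L * ennreal (weight_of \<omega> R powr (1 / p'))) p'
            \<le> epowr (ennreal C * ?Linf * ennreal (weight_of \<omega> R powr (1 / p'))) p'"
          using p' by (intro epowr_mono mult_right_mono mult_left_mono L_le) auto
        finally show "ennreal (adjoint_sum D R a)
          \<le> epowr (ennreal C * ?Linf * ennreal (weight_of \<omega> R powr (1 / p'))) p'" .
      qed
    qed (use a R in auto)
  qed
qed


text \<open>A constant that is approximated from above by admissible ones is admissible for every forest,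
  by continuity.\<close>

lemma least_constants_exist:
  shows "(\<exists>C\<ge>0. two_weight_bound p r lam \<sigma> \<omega> C) \<Longrightarrow> \<exists>C. is_least_const (two_weight_bound p r lam \<sigma> \<omega>) C"
    and "(\<exists>C\<ge>0. testing_bound p r lam \<sigma> \<omega> C) \<Longrightarrow> \<exists>C. is_least_const (testing_bound p r lam \<sigma> \<omega>) C"
    and "(\<exists>C\<ge>0. dual_testing_bound p' r' lam \<sigma> \<omega> C) \<Longrightarrow> \<exists>C. is_least_const (dual_testing_bound p' r' lam \<sigma> \<omega>) C"
proof -
  have p': "1 < p'" using conjugate_gt_1[OF p] by simp
  have raise: "X \<le> ennreal C' * Y" if "X \<le> ennreal C * Y" "C \<le> C'" for X Y C C'
    using that(1) mult_right_mono[OF ennreal_leI[OF that(2)], of Y] by (rule order_trans) simp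
  {
    assume "\<exists>C\<ge>0. two_weight_bound p r lam \<sigma> \<omega> C"
    then obtain C0 where C0: "0 \<le> C0" "two_weight_bound p r lam \<sigma> \<omega> C0" by blast
    show "\<exists>C. is_least_const (two_weight_bound p r lam \<sigma> \<omega>) C"
    proof (rule is_least_const_exists[where P = "two_weight_bound p r lam \<sigma> \<omega>", OF C0])
      fix C C' :: real
      assume C: "0 \<le> C" "two_weight_bound p r lam \<sigma> \<omega> C" "C \<le> C'"
      show "two_weight_bound p r lam \<sigma> \<omega> C'"
        unfolding two_weight_bound_def by (intro ballI, rule raise[OF bspec[OF C(2)[unfolded two_weight_bound_def]] C(3)])
    next
      fix C :: real
      assume C: "0 \<le> C" and lim: "\<And>e. 0 < e \<Longrightarrow> two_weight_bound p r lam \<sigma> \<omega> (C + e)"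
      show "two_weight_bound p r lam \<sigma> \<omega> C"
        unfolding two_weight_bound_iff_forests[OF C] forest_two_weight_def
      proof (intro allI impI, rule powr_le_of_limit)
        fix D :: "(real ^ 'n) set set" and f :: "(real ^ 'n) set \<Rightarrow> real" and e :: real
        assume "cube_family D" "\<forall>q\<in>D. 0 \<le> f q" "0 < e"
        thus "(\<Sum>q\<in>D. real_lr_norm r (upset D q) (\<lambda>Q. \<kappa> Q * mass D (\<lambda>q. f q * \<mu> D q) Q) powr p
            * \<nu> D q) \<le> (C + e) powr p * (\<Sum>q\<in>D. f q powr p * \<mu> D q)"
          using lim[of e] C by (simp add: two_weight_bound_iff_forests forest_two_weight_def)
      qed (use p C in simp_all)
    qed
  }
  {
    assume "\<exists>C\<ge>0. testing_bound p r lam \<sigma> \<omega> C"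
    then obtain C0 where C0: "0 \<le> C0" "testing_bound p r lam \<sigma> \<omega> C0" by blast
    show "\<exists>C. is_least_const (testing_bound p r lam \<sigma> \<omega>) C"
    proof (rule is_least_const_exists[where P = "testing_bound p r lam \<sigma> \<omega>", OF C0])
      fix C C' :: real
      assume C: "0 \<le> C" "testing_bound p r lam \<sigma> \<omega> C" "C \<le> C'"
      show "testing_bound p r lam \<sigma> \<omega> C'"
        unfolding testing_bound_def by (intro ballI, rule raise[OF bspec[OF C(2)[unfolded testing_bound_def]] C(3)])
    next
      fix C :: real
      assume C: "0 \<le> C" and lim: "\<And>e. 0 < e \<Longrightarrow> testing_bound p r lam \<sigma> \<omega> (C + e)"
      show "testing_bound p r lam \<sigma> \<omega> C"
        unfolding testing_bound_iff_forests[OF C] forest_testing_def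
      proof (intro allI ballI impI, rule powr_le_of_limit)
        fix D :: "(real ^ 'n) set set" and R and e :: real
        assume "cube_family D" "R \<in> D" "0 < e"
        thus "testing_sum D R \<le> (C + e) powr p * mass D (\<mu> D) R"
          using lim[of e] C by (simp add: testing_bound_iff_forests forest_testing_def)
      qed (use p C in simp_all)
    qed
  }
  {
    assume "\<exists>C\<ge>0. dual_testing_bound p' r' lam \<sigma> \<omega> C"
    then obtain C0 where C0: "0 \<le> C0" "dual_testing_bound p' r' lam \<sigma> \<omega> C0" by blast
    show "\<exists>C. is_least_const (dual_testing_bound p' r' lam \<sigma> \<omega>) C"
    proof (rule is_least_const_exists[where P = "dual_testing_bound p' r' lam \<sigma> \<omega>", OF C0])
      fix C C' :: real
      assume C: "0 \<le> C" "dual_testing_bound p' r' lam \<sigma> \<omega> C" "C \<le> C'"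
      show "dual_testing_bound p' r' lam \<sigma> \<omega> C'"
        unfolding dual_testing_bound_def Let_def mult.assoc
        by (intro ballI allI impI, rule raise[OF C(2)[unfolded dual_testing_bound_def Let_def mult.assoc,
              THEN bspec, THEN spec, THEN mp] C(3)])
    next
      fix C :: real
      assume C: "0 \<le> C" and lim: "\<And>e. 0 < e \<Longrightarrow> dual_testing_bound p' r' lam \<sigma> \<omega> (C + e)"
      show "dual_testing_bound p' r' lam \<sigma> \<omega> C"
        unfolding dual_testing_bound_iff_forests[OF C] forest_dual_testing_def powr_mult mult.assoc
      proof (intro allI ballI impI, rule powr_le_of_limit)
        fix D :: "(real ^ 'n) set set" and R and a :: "(real ^ 'n) set \<Rightarrow> real" and L e :: real
        assume "cube_family D" "R \<in> D" "\<forall>Q\<in>D. 0 \<le> a Q" "0 \<le> L"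
          "\<forall>q\<in>D. 0 < \<nu> D q \<longrightarrow> real_lr_norm r' (upset D q) a \<le> L" "0 < e"
        thus "(\<Sum>q\<in>D. (\<Sum>Q\<in>{Q\<in>upset D q. Q \<subseteq> R}. \<kappa> Q * (a Q * mass D (\<nu> D) Q)) powr p'
            * \<mu> D q) \<le> (C + e) powr p' * (L powr p' * mass D (\<nu> D) R)"
          using lim[of e] C
          by (simp add: dual_testing_bound_iff_forests forest_dual_testing_def powr_mult mult.assoc)
      qed (use p' C in simp_all)
    qed
  }
qed

lemma two_weight_bound_of_testing:
  assumes C: "0 \<le> C" "testing_bound p r lam \<sigma> \<omega> C"
    and Cs: "0 \<le> Cs" "dual_testing_bound p' r' lam \<sigma> \<omega> Cs"
  shows "0 \<le> stein_const p p' r r' * 20 * p * p' * (C + Cs)"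
    and "two_weight_bound p r lam \<sigma> \<omega> (stein_const p p' r r' * 20 * p * p' * (C + Cs))"
proof -
  have "0 \<le> stein_const p p' r r'" by (simp add: stein_const_def)
  thus K: "0 \<le> stein_const p p' r r' * 20 * p * p' * (C + Cs)"
    using p C Cs conjugate_gt_1[OF p] by simp
  show "two_weight_bound p r lam \<sigma> \<omega> (stein_const p p' r r' * 20 * p * p' * (C + Cs))"
    unfolding two_weight_bound_iff_forests[OF K]
  proof (intro allI impI)
    fix D :: "(real ^ 'n) set set" assume "cube_family D"
    hence D: "finite D" "D \<subseteq> dyadic_cubes" by auto
    interpret finite_forest D by (rule finite_forest_dyadic_cubes[OF D])
    show "forest_two_weight D p r \<kappa> (\<mu> D) (\<nu> D)
        (stein_const p p' r r' * 20 * p * p' * (C + Cs))"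
    proof (rule forest_two_weight_of_testing[OF p r _ _ _ C(1) _ Cs(1)])
      show "forest_testing D p r \<kappa> (\<mu> D) (\<nu> D) C"
        using C D testing_bound_iff_forests by blast
      show "forest_dual_testing D p' r' \<kappa> (\<mu> D) (\<nu> D) Cs"
        using Cs D dual_testing_bound_iff_forests by blast
    qed (use D coeff_density_nonneg atom_weight_nonneg[OF \<sigma> D] atom_weight_nonneg[OF \<omega> D] in auto)
  qed
qed

lemma testing_of_two_weight_bound:
  assumes C: "0 \<le> C" "two_weight_bound p r lam \<sigma> \<omega> C"
  shows "testing_bound p r lam \<sigma> \<omega> C" "dual_testing_bound p' r' lam \<sigma> \<omega> C"
  unfolding testing_bound_iff_forests[OF C(1)] dual_testing_bound_iff_forests[OF C(1)]
proof (safe)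
  fix D :: "(real ^ 'n) set set" assume D: "finite D" "D \<subseteq> dyadic_cubes"
  interpret finite_forest D by (rule finite_forest_dyadic_cubes[OF D])
  have two: "forest_two_weight D p r \<kappa> (\<mu> D) (\<nu> D) C"
    using C D two_weight_bound_iff_forests by blast
  show "forest_testing D p r \<kappa> (\<mu> D) (\<nu> D) C"
    by (rule forest_testing_of_two_weight[OF p(1) r(1) _ _ _ two])
      (use D coeff_density_nonneg atom_weight_nonneg[OF \<sigma> D] atom_weight_nonneg[OF \<omega> D] in auto)
  show "forest_dual_testing D p' r' \<kappa> (\<mu> D) (\<nu> D) C"
    by (rule forest_dual_testing_of_two_weight[OF p r _ _ _ C(1) two])
      (use D coeff_density_nonneg atom_weight_nonneg[OF \<sigma> D] atom_weight_nonneg[OF \<omega> D] in auto)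
qed

end

section \<open>The two weight theorem\<close>

theorem theorem1p1:
  fixes p p' :: real and r r' :: ennreal
    and lam :: "(real ^ 'n) set \<Rightarrow> real"
    and \<sigma> \<omega> :: "real ^ 'n \<Rightarrow> real"
  assumes "1 \<le> r" and "1 < p"
    and "1 / p + 1 / p' = 1" and "inverse r + inverse r' = 1"
    and "\<And>Q. Q \<in> dyadic_cubes \<Longrightarrow> 0 \<le> lam Q"
    and "locally_integrable \<sigma>" and "\<And>x. 0 < \<sigma> x"
    and "locally_integrable \<omega>" and "\<And>x. 0 < \<omega> x"
  shows "((\<exists>Ct\<ge>0. two_weight_bound p r lam \<sigma> \<omega> Ct) \<longleftrightarrow>
            (\<exists>C\<ge>0. testing_bound p r lam \<sigma> \<omega> C) \<and>
            (\<exists>Cs\<ge>0. dual_testing_bound p' r' lam \<sigma> \<omega> Cs))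
       \<and> ((\<exists>Ct\<ge>0. two_weight_bound p r lam \<sigma> \<omega> Ct) \<longrightarrow>
            (\<exists>Ct C Cs.
               is_least_const (two_weight_bound p r lam \<sigma> \<omega>) Ct \<and>
               is_least_const (testing_bound p r lam \<sigma> \<omega>) C \<and>
               is_least_const (dual_testing_bound p' r' lam \<sigma> \<omega>) Cs \<and>
               Ct \<le> stein_const p p' r r' * 20 * p * p' * (C + Cs)))"
proof (intro conjI impI)
  interpret dyadic_two_weight p p' r r' lam \<sigma> \<omega>
    using assms by unfold_locales auto
  show iff: "(\<exists>Ct\<ge>0. two_weight_bound p r lam \<sigma> \<omega> Ct) \<longleftrightarrow>
      (\<exists>C\<ge>0. testing_bound p r lam \<sigma> \<omega> C) \<and> (\<exists>Cs\<ge>0. dual_testing_bound p' r' lam \<sigma> \<omega> Cs)"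
    using two_weight_bound_of_testing testing_of_two_weight_bound by blast
  assume two: "\<exists>Ct\<ge>0. two_weight_bound p r lam \<sigma> \<omega> Ct"
  obtain Ct where Ct: "is_least_const (two_weight_bound p r lam \<sigma> \<omega>) Ct"
    using least_constants_exist(1)two by blast
  obtain C where C: "is_least_const (testing_bound p r lam \<sigma> \<omega>) C"
    using least_constants_exist(2)two iff by blast
  obtain Cs where Cs: "is_least_const (dual_testing_bound p' r' lam \<sigma> \<omega>) Cs"
    using least_constants_exist(3)two iff by blast
  have "Ct \<le> stein_const p p' r r' * 20 * p * p' * (C + Cs)"
    using Ct C Cs two_weight_bound_of_testing[of C Cs] unfolding is_least_const_def by blast
  thus "\<exists>Ct C Cs.
               is_least_const (two_weight_bound p r lam \<sigma> \<omega>) Ct \<and>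
               is_least_const (testing_bound p r lam \<sigma> \<omega>) C \<and>
               is_least_const (dual_testing_bound p' r' lam \<sigma> \<omega>) Cs \<and>
               Ct \<le> stein_const p p' r r' * 20 * p * p' * (C + Cs)"
    using Ct C Cs by blast
qed

end
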